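(* Let $\mathscr H=\mathbb C^3\otimes\mathbb C^3$, and let $Z=F_2^Y(X)$ be the simplicial effect defined by $Y=P_{\mathscr H}(N\mathbb Z_{/3})$ and $X\subset\mathrm{tr}_2(Y)$, $X_0=Y_0$, $X_1=Y_1$, $X_2=\{\{\Pi^{ab}\}_{a,b\in\mathbb Z_{/3}}\in Y_2\mid\Pi^{11}=\Pi^{21}=\Pi^{12}=0\}$. Then the map $$\mathrm{Den}(\mathscr H)\to\mathrm{St}(Z),\qquad \rho\mapsto\Big(\Pi\mapsto\mathrm{Tr}\big(\rho\,(\bar\Pi^0-\tfrac12\Pi^2)\big)\Big)$$ is a bijection, where $\Pi:\mathbb Z_{/3}\to\mathrm{Proj}(\mathscr H)$ ranges over projective measurements (the elements of $Z_1$) and $\bar\Pi^0=\mathbb 1-\Pi^0$.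
   Context: $\mathrm{Den}(\mathscr H)$ is the set of density operators (positive operators of trace $1$) on $\mathscr H$; $\mathrm{Proj}(\mathscr H)$ is the set of orthogonal projectors. A cyclic set is a simplicial set $X$ with maps $\tau_n:X_n\to X_n$ ($\tau_0=\mathrm{id}$) satisfying $\tau_n^{n+1}=\mathrm{id}$; $d_i\tau_n=\tau_{n-1}d_{i-1}$ for $1\le i\le n$; $d_0\tau_n=d_n$; $s_i\tau_n=\tau_{n+1}s_{i-1}$ for $1\le i\le n$; $s_0\tau_n=\tau_{n+1}^2s_n$. The cyclic set $Y$: $Y_n$ is the set of families $\{\Pi^{a_1\dots a_n}\}_{(a_1,\dots,a_n)\in(\mathbb Z_{/3})^n}$ of orthogonal projectors on $\mathscr H$ with $\sum\Pi^{a_1\dots a_n}=\mathbb 1$. Any structure map $\theta^*$ of the nerve $N(\mathbb Z_{/3})$ acts on $Y$ by summing over fibres, $(\theta^*\Pi)^y=\sum_{x:\theta^*x=y}\Pi^x$. Here $N(\mathbb Z_{/3})_n=(\mathbb Z_{/3})^n$ has the usual simplicial structure ($d_0,d_n$ drop the first/last entry, $d_i$ adds the $i$-th and $(i+1)$-st entries, $s_i$ inserts $0$) and the cyclic structure determined by the central element $1\in\mathbb Z_{/3}$: $\tau_n(k_1,\dots,k_n)=(1-k_1-\cdots-k_n,k_1,\dots,k_{n-1})$. $F_2^Y(X)\subset Y$ is the simplicial (here cyclic) subset consisting of those $n$-simplices $\sigma:\Delta^n\to Y$ whose 2-truncation factors through $X$. In particular $Z_1=Y_1$ is the set of triples $(\Pi^0,\Pi^1,\Pi^2)$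 of projectors summing to $\mathbb 1$, and $Z_2=X_2$. A state on a cyclic set $W$ is a morphism of cyclic sets from $W$ to the nerve $N[0,1]$ of the effect algebra $[0,1]$. Equivalently, $\mathrm{St}(W)$ is the set of functions $\varphi:W_1\to[0,1]$ such that $\varphi(\tau_1x)=1-\varphi(x)$ for all $x\in W_1$, and $\varphi(d_1\sigma)=\varphi(d_2\sigma)+\varphi(d_0\sigma)$ for all $\sigma\in W_2$. *)

theory Defs
  imports "HOL-Analysis.Analysis" "HOL-Library.Numeral_Type" "HOL-Library.Nonpos_Ints"
begin

section \<open>Cyclic sets\<close>

text \<open>
  All structure maps are indexed by the dimension of their source: \<open>face W n i\<close> is
  \<open>d\<^sub>i : W\<^sub>n \<rightarrow> W\<^sub>n\<^sub>-\<^sub>1\<close> (meaningful for \<open>1 \<le> n\<close>, \<open>i \<le> n\<close>),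
  \<open>degen W n i\<close> is \<open>s\<^sub>i : W\<^sub>n \<rightarrow> W\<^sub>n\<^sub>+\<^sub>1\<close> (for \<open>i \<le> n\<close>) and
  \<open>cyc W n\<close> is \<open>\<tau>\<^sub>n : W\<^sub>n \<rightarrow> W\<^sub>n\<close>.
\<close>

record 'a cyclic_data =
  cells :: "nat \<Rightarrow> 'a set"
  face :: "nat \<Rightarrow> nat \<Rightarrow> 'a \<Rightarrow> 'a"
  degen :: "nat \<Rightarrow> nat \<Rightarrow> 'a \<Rightarrow> 'a"
  cyc :: "nat \<Rightarrow> 'a \<Rightarrow> 'a"

locale cyclic_set =
  fixes W :: "'a cyclic_data"
  assumes face_closed: "x \<in> cells W (Suc n) \<Longrightarrow> i \<le> Suc n \<Longrightarrow> face W (Suc n) i x \<in> cells W n"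
    and degen_closed: "x \<in> cells W n \<Longrightarrow> i \<le> n \<Longrightarrow> degen W n i x \<in> cells W (Suc n)"
    and cyc_closed: "x \<in> cells W n \<Longrightarrow> cyc W n x \<in> cells W n"
    and face_face: "x \<in> cells W (Suc (Suc n)) \<Longrightarrow> i < j \<Longrightarrow> j \<le> Suc (Suc n) \<Longrightarrow>
      face W (Suc n) i (face W (Suc (Suc n)) j x) = face W (Suc n) (j - 1) (face W (Suc (Suc n)) i x)"
    and degen_degen: "x \<in> cells W n \<Longrightarrow> i \<le> j \<Longrightarrow> j \<le> n \<Longrightarrow>
      degen W (Suc n) i (degen W n j x) = degen W (Suc n) (Suc j) (degen W n i x)"
    and face_degen: "x \<in> cells W n \<Longrightarrow> j \<le> n \<Longrightarrow> i \<le> Suc n \<Longrightarrow>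
      face W (Suc n) i (degen W n j x) =
        (if i < j then degen W (n - 1) (j - 1) (face W n i x)
         else if i \<le> Suc j then x
         else degen W (n - 1) j (face W n (i - 1) x))"
    and cyc_0: "x \<in> cells W 0 \<Longrightarrow> cyc W 0 x = x"
    and cyc_pow: "x \<in> cells W n \<Longrightarrow> (cyc W n ^^ Suc n) x = x"
    and face_cyc: "x \<in> cells W n \<Longrightarrow> 1 \<le> i \<Longrightarrow> i \<le> n \<Longrightarrow>
      face W n i (cyc W n x) = cyc W (n - 1) (face W n (i - 1) x)"
    and face_0_cyc: "x \<in> cells W n \<Longrightarrow> 1 \<le> n \<Longrightarrow> face W n 0 (cyc W n x) = face W n n x"
    and degen_cyc: "x \<in> cells W n \<Longrightarrow> 1 \<le> i \<Longrightarrow> i \<le> n \<Longrightarrow>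
      degen W n i (cyc W n x) = cyc W (Suc n) (degen W n (i - 1) x)"
    and degen_0_cyc: "x \<in> cells W n \<Longrightarrow>
      degen W n 0 (cyc W n x) = (cyc W (Suc n) ^^ 2) (degen W n n x)"

definition cyclic_maps :: "'a cyclic_data \<Rightarrow> 'b cyclic_data \<Rightarrow> (nat \<Rightarrow> 'a \<Rightarrow> 'b) set" where
  "cyclic_maps W V = {f.
     (\<forall>n. f n \<in> cells W n \<rightarrow>\<^sub>E cells V n) \<and>
     (\<forall>n. \<forall>i\<le>Suc n. \<forall>x\<in>cells W (Suc n). f n (face W (Suc n) i x) = face V (Suc n) i (f (Suc n) x)) \<and>
     (\<forall>n. \<forall>i\<le>n. \<forall>x\<in>cells W n. f (Suc n) (degen W n i x) = degen V n i (f n x)) \<and>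
     (\<forall>n. \<forall>x\<in>cells W n. f n (cyc W n x) = cyc V n (f n x))}"


section \<open>Nerves\<close>

text \<open>
  An \<open>n\<close>-simplex is the list \<open>[k\<^sub>1, \<dots>, k\<^sub>n]\<close>; since lists are indexed from \<open>0\<close>, the inner face \<open>d\<^sub>i\<close>
  adds the list entries \<open>i - 1\<close> and \<open>i\<close>.
\<close>

definition nerve_face :: "nat \<Rightarrow> nat \<Rightarrow> 'k::monoid_add list \<Rightarrow> 'k list" where
  "nerve_face n i k =
     (if i = 0 then tl k
      else if i = n then butlast k
      else take (i - 1) k @ [k ! (i - 1) + k ! i] @ drop (Suc i) k)"

definition nerve_degen :: "nat \<Rightarrow> nat \<Rightarrow> 'k::monoid_add list \<Rightarrow> 'k list" where
  "nerve_degen n i k = take i k @ [0] @ drop i k"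

definition nerve_cyc :: "nat \<Rightarrow> 'k::ring_1 list \<Rightarrow> 'k list" where
  "nerve_cyc n k = (if n = 0 then k else (1 - sum_list k) # butlast k)"

definition nerve_Z3 :: "3 list cyclic_data" where
  "nerve_Z3 = \<lparr>cells = (\<lambda>n. {k. length k = n}),
     face = nerve_face, degen = nerve_degen, cyc = nerve_cyc\<rparr>"

text \<open>
  The nerve of the effect algebra \<open>[0,1]\<close>: here \<open>n\<close>-simplices are the summable \<open>n\<close>-tuples, and
  the first entry of \<open>\<tau>\<^sub>n k\<close> is the orthosupplement of the sum of \<open>k\<close>.
\<close>

definition nerve_unit_interval :: "real list cyclic_data" where
  "nerve_unit_interval = \<lparr>cells = (\<lambda>n. {k. length k = n \<and> set k \<subseteq> {0..1} \<and> sum_list k \<le> 1}),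
     face = nerve_face, degen = nerve_degen, cyc = nerve_cyc\<rparr>"


section \<open>States\<close>

text \<open>
  A state on \<open>W\<close> is a cyclic map from \<open>W\<close> to \<open>nerve_unit_interval\<close>. It is identified with its
  degree-one component; by \<open>bij_betw_cyclic_maps_states\<close> below this is a bijection onto \<open>states W\<close>
  for every cyclic set \<open>W\<close>.
\<close>

definition states :: "'a cyclic_data \<Rightarrow> ('a \<Rightarrow> real) set" where
  "states W = {\<phi> \<in> cells W 1 \<rightarrow>\<^sub>E {0..1}.
     (\<forall>x\<in>cells W 1. \<phi> (cyc W 1 x) = 1 - \<phi> x) \<and>
     (\<forall>\<sigma>\<in>cells W 2. \<phi> (face W 2 1 \<sigma>) = \<phi> (face W 2 2 \<sigma>) + \<phi> (face W 2 0 \<sigma>))}"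

fun extend_state :: "'a cyclic_data \<Rightarrow> ('a \<Rightarrow> real) \<Rightarrow> nat \<Rightarrow> 'a \<Rightarrow> real list" where
  "extend_state W \<phi> 0 x = []"
| "extend_state W \<phi> (Suc 0) x = [\<phi> x]"
| "extend_state W \<phi> (Suc (Suc n)) x =
     hd (extend_state W \<phi> (Suc n) (face W (Suc (Suc n)) (Suc (Suc n)) x)) #
     extend_state W \<phi> (Suc n) (face W (Suc (Suc n)) 0 x)"

lemma length_extend_state [simp]: "length (extend_state W \<phi> n x) = n"
  by (induction W \<phi> n x rule: extend_state.induct) auto

lemma tl_extend_state:
  "tl (extend_state W \<phi> (Suc (Suc n)) x) = extend_state W \<phi> (Suc n) (face W (Suc (Suc n)) 0 x)"
  by simp

lemma (in cyclic_set) butlast_extend_state: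
  "x \<in> cells W (Suc (Suc n)) \<Longrightarrow>
    butlast (extend_state W \<phi> (Suc (Suc n)) x) = extend_state W \<phi> (Suc n) (face W (Suc (Suc n)) (Suc (Suc n)) x)"
proof (induction n arbitrary: x)
  case 0
  then show ?case by simp
next
  case (Suc n)
  let ?m = "Suc (Suc n)"
  have c0: "face W (Suc ?m) 0 x \<in> cells W ?m"
    using Suc.prems face_closed by blast
  have e: "extend_state W \<phi> ?m (face W (Suc ?m) 0 x) \<noteq> []"
    by (metis length_extend_state list.size(3) nat.distinct(1))
  have "butlast (extend_state W \<phi> (Suc ?m) x) =
      hd (extend_state W \<phi> ?m (face W (Suc ?m) (Suc ?m) x)) # butlast (extend_state W \<phi> ?m (face W (Suc ?m) 0 x))"
    using e by (simp del: extend_state.simps(3) add: extend_state.simps(3)[of W \<phi> "Suc n" x])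
  also have "butlast (extend_state W \<phi> ?m (face W (Suc ?m) 0 x)) =
      extend_state W \<phi> (Suc n) (face W ?m ?m (face W (Suc ?m) 0 x))"
    by (rule Suc.IH[OF c0])
  also have "face W ?m ?m (face W (Suc ?m) 0 x) = face W ?m 0 (face W (Suc ?m) (Suc ?m) x)"
    using face_face[of x "Suc n" 0 "Suc ?m"] Suc.prems by simp
  finally show ?case by simp
qed

lemma list_eq_tl_butlast:
  assumes "length xs = length ys" "2 \<le> length xs" "tl xs = tl ys" "butlast xs = butlast ys"
  shows "xs = ys"
proof -
  obtain a b xs' where x: "xs = a # b # xs'"
    using assms(2) by (cases xs; cases "tl xs") auto
  obtain c d ys' where y: "ys = c # d # ys'"
    using assms(1,2) by (cases ys; cases "tl ys") auto
  show ?thesis using assms x y by simp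
qed

lemma length_nerve_face: "length k = Suc n \<Longrightarrow> i \<le> Suc n \<Longrightarrow> length (nerve_face (Suc n) i k) = n"
  by (auto simp: nerve_face_def)

lemma tl_nerve_face:
  assumes "length k = Suc (Suc n)" "0 < i" "i < Suc (Suc n)"
  shows "tl (nerve_face (Suc (Suc n)) i k) = nerve_face (Suc n) (i - 1) (tl k)"
proof -
  obtain a b xs' where x: "k = a # b # xs'"
    using assms(1) by (cases k; cases "tl k") auto
  show ?thesis
  proof (cases "i = 1")
    case True
    then show ?thesis using x assms by (auto simp: nerve_face_def)
  next
    case False
    then obtain j where "i = Suc (Suc j)"
      using assms(2) by (cases i; cases "i - 1") auto
    then show ?thesis using x assms by (auto simp: nerve_face_def nth_Cons')
  qed
qed

lemma butlast_nerve_face: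
  assumes "length k = Suc (Suc n)" "0 < i" "i < Suc (Suc n)"
  shows "butlast (nerve_face (Suc (Suc n)) i k) = nerve_face (Suc n) i (butlast k)"
proof -
  obtain m c where x: "k = m @ [c]" "length m = Suc n"
    using assms(1) by (cases k rule: rev_cases) auto
  show ?thesis
  proof (cases "i = Suc n")
    case True
    then show ?thesis using x by (auto simp: nerve_face_def butlast_append butlast_conv_take)
  next
    case False
    then show ?thesis using x assms by (auto simp: nerve_face_def butlast_append nth_append)
  qed
qed

lemma sum_list_nerve_face:
  fixes k :: "real list"
  assumes "length k = Suc (Suc n)"
  shows "sum_list (nerve_face (Suc (Suc n)) 1 k) = sum_list k"
proof -
  obtain a b xs' where x: "k = a # b # xs'"
    using assms(1) by (cases k; cases "tl k") auto
  show ?thesis using x by (auto simp: nerve_face_def)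
qed

context cyclic_set
begin

lemma extend_state_face:
  assumes "\<phi> \<in> states W"
  shows "x \<in> cells W (Suc n) \<Longrightarrow> i \<le> Suc n \<Longrightarrow>
    extend_state W \<phi> n (face W (Suc n) i x) = nerve_face (Suc n) i (extend_state W \<phi> (Suc n) x)"
proof (induction n arbitrary: x i)
  case 0
  then show ?case by (auto simp: nerve_face_def)
next
  case (Suc n)
  show ?case
  proof (cases "i = 0 \<or> i = Suc (Suc n)")
    case True
    then show ?thesis using butlast_extend_state[OF Suc.prems(1), of \<phi>] by (auto simp: nerve_face_def)
  next
    case False
    then have i: "0 < i" "i < Suc (Suc n)" using Suc.prems by auto
    show ?thesis
    proof (cases n)
      case 0
      then show ?thesis using i Suc.prems assms
        by (auto simp: states_def nerve_face_def numeral_2_eq_2 less_Suc_eq)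
    next
      case (Suc m)
      let ?M = "extend_state W \<phi> (Suc (Suc n)) x" and ?L = "extend_state W \<phi> (Suc n) (face W (Suc (Suc n)) i x)"
      have cl: "face W (Suc (Suc n)) j x \<in> cells W (Suc n)" if "j \<le> Suc (Suc n)" for j
        using face_closed Suc.prems that by blast
      have "tl ?L = extend_state W \<phi> n (face W (Suc n) 0 (face W (Suc (Suc n)) i x))"
        unfolding Suc by simp
      also have "\<dots> = extend_state W \<phi> n (face W (Suc n) (i - 1) (face W (Suc (Suc n)) 0 x))"
        using face_face[OF Suc.prems(1), of 0 i] i by simp
      also have "\<dots> = nerve_face (Suc n) (i - 1) (tl ?M)"
        using Suc.IH[of "face W (Suc (Suc n)) 0 x" "i - 1"] cl i by simp
      also have "\<dots> = tl (nerve_face (Suc (Suc n)) i ?M)"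
        using tl_nerve_face[of ?M n i] i by simp
      finally have 1: "tl ?L = tl (nerve_face (Suc (Suc n)) i ?M)" .
      have "butlast ?L = extend_state W \<phi> n (face W (Suc n) (Suc n) (face W (Suc (Suc n)) i x))"
        using butlast_extend_state[of "face W (Suc (Suc n)) i x" m \<phi>] cl i unfolding Suc by simp
      also have "\<dots> = extend_state W \<phi> n (face W (Suc n) i (face W (Suc (Suc n)) (Suc (Suc n)) x))"
        using face_face[OF Suc.prems(1), of i "Suc (Suc n)"] i by simp
      also have "\<dots> = nerve_face (Suc n) i (butlast ?M)"
        using Suc.IH[of "face W (Suc (Suc n)) (Suc (Suc n)) x" i] cl i butlast_extend_state[OF Suc.prems(1), of \<phi>]
        by simp
      also have "\<dots> = butlast (nerve_face (Suc (Suc n)) i ?M)"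
        using butlast_nerve_face[of ?M n i] i by simp
      finally have 2: "butlast ?L = butlast (nerve_face (Suc (Suc n)) i ?M)" .
      show ?thesis
        by (rule list_eq_tl_butlast[OF _ _ 1 2])
          (use i Suc length_nerve_face[of ?M "Suc n" i] in simp_all)
    qed
  qed
qed

lemma extend_state_degen:
  assumes "\<phi> \<in> states W"
  shows "x \<in> cells W n \<Longrightarrow> i \<le> n \<Longrightarrow>
    extend_state W \<phi> (Suc n) (degen W n i x) = nerve_degen n i (extend_state W \<phi> n x)"
proof (induction n arbitrary: x i)
  case 0
  let ?y = "degen W 0 0 x" and ?z = "degen W (Suc 0) 0 (degen W 0 0 x)"
  have y: "?y \<in> cells W (Suc 0)" using degen_closed[of x 0 0] 0 by simp
  then have z: "?z \<in> cells W 2" using degen_closed[of ?y "Suc 0" 0] by (simp add: numeral_2_eq_2)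
  have "face W 2 0 ?z = ?y" "face W 2 1 ?z = ?y"
    using face_degen[OF y, of 0 0] face_degen[OF y, of 0 1] by (simp_all add: numeral_2_eq_2)
  moreover have "face W 2 2 ?z = ?y"
    using face_degen[OF y, of 0 2] face_degen[of x 0 0 1] 0 by (simp add: numeral_2_eq_2)
  ultimately have "\<phi> ?y = \<phi> ?y + \<phi> ?y"
    using assms z by (force simp: states_def)
  then show ?case using 0 by (simp add: nerve_degen_def)
next
  case (Suc n)
  let ?L = "extend_state W \<phi> (Suc (Suc n)) (degen W (Suc n) i x)" and ?M = "extend_state W \<phi> (Suc n) x"
  let ?R = "nerve_degen (Suc n) i ?M"
  have s: "degen W (Suc n) i x \<in> cells W (Suc (Suc n))" using degen_closed Suc.prems by blast
  have cl: "face W (Suc n) j x \<in> cells W n" if "j \<le> Suc n" for j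
    using face_closed Suc.prems that by blast
  have f: "extend_state W \<phi> n (face W (Suc n) j x) = nerve_face (Suc n) j ?M" if "j \<le> Suc n" for j
    by (rule extend_state_face[OF assms Suc.prems(1) that])
  have "tl ?L = extend_state W \<phi> (Suc n) (face W (Suc (Suc n)) 0 (degen W (Suc n) i x))" by simp
  also have "\<dots> = tl ?R"
  proof (cases i)
    case 0
    then show ?thesis using face_degen[OF Suc.prems, of 0] by (simp add: nerve_degen_def)
  next
    case (Suc j)
    have "extend_state W \<phi> (Suc n) (degen W n j (face W (Suc n) 0 x)) = nerve_degen n j (tl ?M)"
      using Suc.IH[of "face W (Suc n) 0 x" j] cl Suc Suc.prems f[of 0] by (simp add: nerve_face_def)
    moreover have "?M \<noteq> []" by (metis length_extend_state list.size(3) nat.distinct(1))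
    ultimately show ?thesis using Suc face_degen[OF Suc.prems, of 0]
      by (cases ?M) (simp_all add: nerve_degen_def)
  qed
  finally have 1: "tl ?L = tl ?R" .
  have "butlast ?L = extend_state W \<phi> (Suc n) (face W (Suc (Suc n)) (Suc (Suc n)) (degen W (Suc n) i x))"
    by (rule butlast_extend_state[OF s])
  also have "\<dots> = butlast ?R"
  proof (cases "i = Suc n")
    case True
    then show ?thesis using face_degen[OF Suc.prems, of "Suc (Suc n)"]
      by (simp add: nerve_degen_def)
  next
    case False
    then have i: "i \<le> n" using Suc.prems by simp
    have "extend_state W \<phi> (Suc n) (degen W n i (face W (Suc n) (Suc n) x)) = nerve_degen n i (butlast ?M)"
      using Suc.IH[of "face W (Suc n) (Suc n) x" i] cl i f[of "Suc n"] by (simp add: nerve_face_def)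
    moreover obtain m c where "?M = m @ [c]" "length m = n"
      by (metis length_extend_state length_Suc_conv_rev)
    ultimately show ?thesis using i face_degen[OF Suc.prems, of "Suc (Suc n)"]
      by (simp add: nerve_degen_def butlast_append)
  qed
  finally have 2: "butlast ?L = butlast ?R" .
  show ?case
    by (rule list_eq_tl_butlast[OF _ _ 1 2]) (simp_all add: nerve_degen_def)
qed

lemma extend_state_cyc:
  assumes "\<phi> \<in> states W"
  shows "x \<in> cells W n \<Longrightarrow> extend_state W \<phi> n (cyc W n x) = nerve_cyc n (extend_state W \<phi> n x)"
proof (induction n arbitrary: x)
  case 0
  then show ?case by (simp add: nerve_cyc_def)
next
  case (Suc n)
  show ?case
  proof (cases n)
    case 0
    then show ?thesis using Suc.prems assms by (simp add: nerve_cyc_def states_def)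
  next
    case (Suc m)
    let ?L = "extend_state W \<phi> (Suc n) (cyc W (Suc n) x)" and ?M = "extend_state W \<phi> (Suc n) x"
    let ?R = "nerve_cyc (Suc n) ?M"
    have c: "cyc W (Suc n) x \<in> cells W (Suc n)" using cyc_closed Suc.prems by blast
    have "tl ?L = extend_state W \<phi> n (face W (Suc n) 0 (cyc W (Suc n) x))"
      unfolding Suc by simp
    also have "\<dots> = extend_state W \<phi> n (face W (Suc n) (Suc n) x)"
      using face_0_cyc[OF Suc.prems] by simp
    also have "\<dots> = butlast ?M"
      using butlast_extend_state[of x m \<phi>] Suc.prems unfolding Suc by simp
    finally have 1: "tl ?L = tl ?R" by (simp add: nerve_cyc_def)
    have "butlast ?L = extend_state W \<phi> n (face W (Suc n) (Suc n) (cyc W (Suc n) x))"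
      using butlast_extend_state[of _ m \<phi>] c unfolding Suc by simp
    also have "\<dots> = extend_state W \<phi> n (cyc W n (face W (Suc n) n x))"
      using face_cyc[OF Suc.prems, of "Suc n"] by simp
    also have "\<dots> = nerve_cyc n (extend_state W \<phi> n (face W (Suc n) n x))"
      by (rule Suc.IH, rule face_closed) (use Suc.prems in auto)
    also have "\<dots> = nerve_cyc n (nerve_face (Suc n) n ?M)"
      using extend_state_face[OF assms Suc.prems, of n] by simp
    also have "\<dots> = butlast ?R"
    proof -
      obtain p c where "?M = p @ [c]" "length p = Suc m"
        by (metis length_extend_state length_Suc_conv_rev Suc)
      moreover then obtain q d where "p = q @ [d]" "length q = m"
        by (metis length_Suc_conv_rev)
      ultimately have q: "?M = q @ [d, c]" "length q = m" by auto
      have "nerve_face (Suc n) n ?M = q @ [d + c]"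
        unfolding q(1) using Suc q(2) by (simp add: nerve_face_def nth_append)
      then show ?thesis using Suc q(1) by (simp add: nerve_cyc_def butlast_append)
    qed
    finally have 2: "butlast ?L = butlast ?R" .
    show ?thesis
      by (rule list_eq_tl_butlast[OF _ _ 1 2]) (simp_all add: nerve_cyc_def Suc del: extend_state.simps)
  qed
qed

lemma extend_state_cells:
  assumes "\<phi> \<in> states W"
  shows "x \<in> cells W n \<Longrightarrow> extend_state W \<phi> n x \<in> cells nerve_unit_interval n"
proof (induction n arbitrary: x)
  case 0
  then show ?case by (simp add: nerve_unit_interval_def)
next
  case (Suc n)
  show ?case
  proof (cases n)
    case 0
    then show ?thesis using Suc.prems assms by (auto simp: nerve_unit_interval_def states_def)
  next
    case (Suc m)
    let ?M = "extend_state W \<phi> (Suc n) x"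
    have f: "nerve_face (Suc n) i ?M \<in> cells nerve_unit_interval n" if "i \<le> Suc n" for i
      using Suc.IH[of "face W (Suc n) i x"] face_closed[OF Suc.prems that]
        extend_state_face[OF assms Suc.prems that] by simp
    have "set (tl ?M) \<subseteq> {0..1}" "set (butlast ?M) \<subseteq> {0..1}"
      using f[of 0] f[of "Suc n"] by (auto simp: nerve_face_def nerve_unit_interval_def)
    moreover obtain a b l where M: "?M = a # b # l"
      by (metis length_extend_state length_Suc_conv Suc)
    ultimately have "set ?M \<subseteq> {0..1}" by auto
    moreover have "sum_list ?M \<le> 1"
      using f[of 1] sum_list_nerve_face[of ?M m] Suc by (simp add: nerve_unit_interval_def)
    ultimately show ?thesis by (simp add: nerve_unit_interval_def)
  qed
qed

lemma cyclic_map_eqI: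
  assumes f: "f \<in> cyclic_maps W nerve_unit_interval" and g: "g \<in> cyclic_maps W nerve_unit_interval"
    and e: "\<And>x. x \<in> cells W 1 \<Longrightarrow> f 1 x = g 1 x"
  shows "f = g"
proof -
  have len: "length (h n x) = n" if "h \<in> cyclic_maps W nerve_unit_interval" "x \<in> cells W n" for h n x
    using that by (auto simp: cyclic_maps_def nerve_unit_interval_def PiE_iff)
  have fc: "nerve_face (Suc n) i (h (Suc n) x) = h n (face W (Suc n) i x)"
    if "h \<in> cyclic_maps W nerve_unit_interval" "x \<in> cells W (Suc n)" "i \<le> Suc n" for h n x i
    using that by (auto simp: cyclic_maps_def nerve_unit_interval_def)
  have "f n x = g n x" if "x \<in> cells W n" for n x
    using that
  proof (induction n arbitrary: x)
    case 0
    then show ?case using len[OF f, of x 0] len[OF g, of x 0] by simp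
  next
    case (Suc n)
    show ?case
    proof (cases n)
      case 0
      then show ?thesis using e Suc.prems by simp
    next
      case (Suc m)
      have "nerve_face (Suc n) i (f (Suc n) x) = nerve_face (Suc n) i (g (Suc n) x)" if "i \<le> Suc n" for i
        using fc[OF f Suc.prems that] fc[OF g Suc.prems that]
          Suc.IH[OF face_closed[OF Suc.prems that]] by simp
      from this[of 0] this[of "Suc n"]
      have t: "tl (f (Suc n) x) = tl (g (Suc n) x)" "butlast (f (Suc n) x) = butlast (g (Suc n) x)"
        by (simp_all add: nerve_face_def)
      show ?thesis
        by (rule list_eq_tl_butlast[OF _ _ t])
          (use Suc len[OF f Suc.prems] len[OF g Suc.prems] in simp_all)
    qed
  qed
  moreover have "f n x = g n x" if "x \<notin> cells W n" for n x
    using f g that by (auto simp: cyclic_maps_def PiE_iff extensional_def)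
  ultimately show ?thesis by blast
qed

lemma cyclic_map_state:
  assumes f: "f \<in> cyclic_maps W nerve_unit_interval"
  shows "(\<lambda>x\<in>cells W 1. hd (f 1 x)) \<in> states W"
proof -
  have cl: "f n x \<in> cells nerve_unit_interval n" if "x \<in> cells W n" for n x
    using f that by (auto simp: cyclic_maps_def PiE_iff)
  have one: "\<exists>a. f 1 x = [a] \<and> 0 \<le> a \<and> a \<le> 1" if "x \<in> cells W 1" for x
    using cl[OF that] by (auto simp: nerve_unit_interval_def length_Suc_conv)
  have cy: "f 1 (cyc W 1 x) = nerve_cyc 1 (f 1 x)" if "x \<in> cells W 1" for x
    using f that by (auto simp: cyclic_maps_def nerve_unit_interval_def)
  have fc: "f 1 (face W 2 i x) = nerve_face 2 i (f 2 x)" if "x \<in> cells W 2" "i \<le> 2" for x i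
    using f that by (auto simp: cyclic_maps_def nerve_unit_interval_def numeral_2_eq_2)
  have A: "hd (f 1 (cyc W 1 x)) = 1 - hd (f 1 x)" if "x \<in> cells W 1" for x
    using one[OF that] cy[OF that] by (auto simp: nerve_cyc_def)
  have B: "hd (f 1 (face W 2 1 x)) = hd (f 1 (face W 2 2 x)) + hd (f 1 (face W 2 0 x))"
    if "x \<in> cells W 2" for x
  proof -
    obtain a b where "f 2 x = [a, b]"
      using cl[OF \<open>x \<in> cells W 2\<close>] by (auto simp: nerve_unit_interval_def length_Suc_conv numeral_2_eq_2)
    then show ?thesis using fc[OF that] by (simp add: nerve_face_def)
  qed
  have fcl: "face W 2 i x \<in> cells W 1" if "x \<in> cells W 2" "i \<le> 2" for x i
    using face_closed[of x 1 i] that by (simp add: numeral_2_eq_2)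
  show ?thesis
    unfolding states_def
  proof (intro CollectI conjI ballI)
    show "(\<lambda>x\<in>cells W 1. hd (f 1 x)) \<in> cells W 1 \<rightarrow>\<^sub>E {0..1}"
      using one by fastforce
  qed (simp_all add: A B cyc_closed fcl del: One_nat_def)
qed

theorem bij_betw_cyclic_maps_states:
  "bij_betw (\<lambda>f. \<lambda>x\<in>cells W 1. hd (f 1 x)) (cyclic_maps W nerve_unit_interval) (states W)"
proof (rule bij_betwI')
  fix f g assume f: "f \<in> cyclic_maps W nerve_unit_interval" and g: "g \<in> cyclic_maps W nerve_unit_interval"
  show "((\<lambda>x\<in>cells W 1. hd (f 1 x)) = (\<lambda>x\<in>cells W 1. hd (g 1 x))) = (f = g)"
  proof
    assume e: "(\<lambda>x\<in>cells W 1. hd (f 1 x)) = (\<lambda>x\<in>cells W 1. hd (g 1 x))"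
    show "f = g"
    proof (rule cyclic_map_eqI[OF f g])
      fix x assume x: "x \<in> cells W 1"
      have "length (f 1 x) = 1" "length (g 1 x) = 1"
        using f g x by (auto simp: cyclic_maps_def nerve_unit_interval_def PiE_iff)
      moreover have "hd (f 1 x) = hd (g 1 x)" using fun_cong[OF e, of x] x by simp
      ultimately show "f 1 x = g 1 x" by (auto simp: length_Suc_conv)
    qed
  qed simp
next
  fix \<phi> assume phi: "\<phi> \<in> states W"
  let ?f = "\<lambda>n. \<lambda>x\<in>cells W n. extend_state W \<phi> n x"
  have "?f \<in> cyclic_maps W nerve_unit_interval"
    unfolding cyclic_maps_def
    using extend_state_cells[OF phi] extend_state_face[OF phi] extend_state_degen[OF phi]
      extend_state_cyc[OF phi] face_closed degen_closed cyc_closed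
    by (auto simp: nerve_unit_interval_def)
  moreover have "\<phi> = (\<lambda>x\<in>cells W 1. hd (?f 1 x))"
    using phi by (auto simp: states_def PiE_iff extensional_def fun_eq_iff)
  ultimately show "\<exists>f\<in>cyclic_maps W nerve_unit_interval. \<phi> = (\<lambda>x\<in>cells W 1. hd (f 1 x))"
    by (rule bexI[where x = ?f, rotated])
qed (rule cyclic_map_state)

end


section \<open>Operators\<close>

text \<open>
  Operators on \<open>\<complex>\<^sup>3 \<otimes> \<complex>\<^sup>3\<close> are matrices in the product basis \<open>e\<^sub>i \<otimes> e\<^sub>j\<close>, indexed by the pairs \<open>(i, j)\<close>.
\<close>

type_synonym 'n operator = "((complex, 'n) vec, 'n) vec"
type_synonym two_qutrits = "3 \<times> 3"

definition cinner :: "complex ^ 'n::finite \<Rightarrow> complex ^ 'n \<Rightarrow> complex" where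
  "cinner x y = (\<Sum>i\<in>UNIV. cnj (x $ i) * y $ i)"

definition adjoint_op :: "'n::finite operator \<Rightarrow> 'n operator" where
  "adjoint_op A = (\<chi> i j. cnj (A $ j $ i))"

definition positive_op :: "'n::finite operator \<Rightarrow> bool" where
  "positive_op A \<longleftrightarrow> (\<forall>x. cinner x (A *v x) \<in> \<real>\<^sub>\<ge>\<^sub>0)"

definition Den :: "'n::finite operator set" where
  "Den = {\<rho>. positive_op \<rho> \<and> trace \<rho> = 1}"

definition Proj :: "'n::finite operator set" where
  "Proj = {P. P ** P = P \<and> adjoint_op P = P}"


section \<open>Projective measurements with outcomes in a cyclic set\<close>

definition pushforward :: "'a set \<Rightarrow> 'b set \<Rightarrow> ('a \<Rightarrow> 'b) \<Rightarrow> ('a \<Rightarrow> 'c::comm_monoid_add) \<Rightarrow> 'b \<Rightarrow> 'c" where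
  "pushforward A B \<theta> \<pi> = (\<lambda>y\<in>B. \<Sum>x\<in>{x \<in> A. \<theta> x = y}. \<pi> x)"

text \<open>
  The cyclic set \<open>P\<^sub>\<H>(W)\<close>, for \<open>W\<close> with finitely many simplices in each dimension (otherwise
  the sums would need finite supports).
\<close>

definition measurements :: "'a cyclic_data \<Rightarrow> ('a \<Rightarrow> 'n::finite operator) cyclic_data" where
  "measurements W = \<lparr>
     cells = (\<lambda>n. {\<pi> \<in> cells W n \<rightarrow>\<^sub>E Proj. (\<Sum>a\<in>cells W n. \<pi> a) = mat 1}),
     face = (\<lambda>n i. pushforward (cells W n) (cells W (n - 1)) (face W n i)),
     degen = (\<lambda>n i. pushforward (cells W n) (cells W (Suc n)) (degen W n i)),
     cyc = (\<lambda>n. pushforward (cells W n) (cells W n) (cyc W n))\<rparr>"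


section \<open>The subobject determined by a 2-truncation\<close>

text \<open>
  \<open>sub_simplex Y n \<sigma> m \<sigma>'\<close>: the simplex \<open>\<sigma>' \<in> Y\<^sub>m\<close> is of the form \<open>\<theta>\<^sup>*\<sigma>\<close> for a monotone
  \<open>\<theta> : [m] \<rightarrow> [n]\<close>, i.e. it lies in the image of \<open>\<sigma> : \<Delta>\<^sup>n \<rightarrow> Y\<close>.
\<close>

inductive sub_simplex :: "'a cyclic_data \<Rightarrow> nat \<Rightarrow> 'a \<Rightarrow> nat \<Rightarrow> 'a \<Rightarrow> bool"
  for Y :: "'a cyclic_data" and n :: nat and \<sigma> :: 'a where
  refl: "sub_simplex Y n \<sigma> n \<sigma>"
| face: "sub_simplex Y n \<sigma> (Suc m) x \<Longrightarrow> i \<le> Suc m \<Longrightarrow> sub_simplex Y n \<sigma> m (face Y (Suc m) i x)"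
| degen: "sub_simplex Y n \<sigma> m x \<Longrightarrow> i \<le> m \<Longrightarrow> sub_simplex Y n \<sigma> (Suc m) (degen Y m i x)"

definition F2 :: "'a cyclic_data \<Rightarrow> (nat \<Rightarrow> 'a set) \<Rightarrow> 'a cyclic_data" where
  "F2 Y X = Y\<lparr>cells := (\<lambda>n. {\<sigma> \<in> cells Y n. \<forall>m\<le>2. \<forall>\<sigma>'. sub_simplex Y n \<sigma> m \<sigma>' \<longrightarrow> \<sigma>' \<in> X m})\<rparr>"

abbreviation Y_cyc :: "(3 list \<Rightarrow> two_qutrits operator) cyclic_data" where
  "Y_cyc \<equiv> measurements nerve_Z3"

text \<open>Only the dimensions up to 2 of \<open>X\<close> are relevant.\<close>

definition X_trunc :: "nat \<Rightarrow> (3 list \<Rightarrow> two_qutrits operator) set" where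
  "X_trunc n = (if n = 2
     then {\<pi> \<in> cells Y_cyc 2. \<pi> [1, 1] = 0 \<and> \<pi> [2, 1] = 0 \<and> \<pi> [1, 2] = 0}
     else cells Y_cyc n)"

definition Z_cyc :: "(3 list \<Rightarrow> two_qutrits operator) cyclic_data" where
  "Z_cyc = F2 Y_cyc X_trunc"

end

theory Submission
  imports Defs
begin

text \<open>
  Write \<open>\<mu>(P) = \<phi>(1 - P, P, 0)\<close> for a state \<open>\<phi>\<close>. The 2-simplices of \<open>Z\<close> say precisely that \<open>\<mu>\<close> is a finitely
  additive probability measure on projectors and that \<open>\<phi>(a, b, c) = \<mu>(b) + \<mu>(c) / 2\<close>, so the statement
  is equivalent to Gleason's theorem, proved here for every finite dimension at least three.

  On a real three-dimensional space let \<open>f\<close> be a bounded frame function with \<open>f(p)\<close> close to its supremum.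
  Its average over a quarter turn about \<open>p\<close> is constant on the equator and almost decreasing along
  every great circle descending from its highest point (Piron, Cooke--Keane--Moran). Quantitatively this
  shows that \<open>f\<close> attains its supremum, and then that the average about a maximum is an affine function of the
  squared cosine of the angle to \<open>p\<close>. Subtracting from \<open>f\<close> the diagonal form with the same values at a
  maximum, an orthogonal minimum and the third axis leaves a frame function that is antisymmetric under
  quarter turns about the axes, and such a function vanishes. In the complex case, totally real
  three-dimensional subspaces give continuity of \<open>x \<mapsto> \<mu>(\<bar>x\<rangle>\<langle>x\<bar>)\<close>, and the density operator is built by
  splitting off vectors of maximal measure one after the other.
\<close>

section \<open>Frame functions on three-dimensional space\<close>

text \<open>The obstacle is that no continuity is available: values at nearby lines are related only
  through common frames. On the great circle with highest point \<open>s\<close>, every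
  perpendicular pair shares its normal with the pair formed by \<open>s\<close> and a horizontal
  vector. After symmetrisation the horizontal vector has value 0, so both the values and the squared
  cosines of a perpendicular pair add up to those of \<open>s\<close>. A lower bound for one member
  is then an upper bound for the other, which is where the almost monotone descent comes from; its
  error is proportional to the gap between the value at the pole and the supremum. The weight 1/2 of
  the third outcome comes from \<open>2 + 2 = 1\<close> in Z/3: the allowed pair
  \<open>(2, 2)\<close> becomes outcome 1 under the inner face, while each outer face shows outcome
  2.\<close>

text \<open>
  Frame functions are treated as functions of lines, invariant under nonzero scalars, which avoids
  normalising vectors; their value at \<open>0\<close> is irrelevant.
\<close>

definition frame_function :: "(real^3 \<Rightarrow> real) \<Rightarrow> real \<Rightarrow> bool" where
  "frame_function f w \<longleftrightarrow>
     (\<forall>v c. c \<noteq> 0 \<longrightarrow> f (c *\<^sub>R v) = f v) \<and>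
     (\<forall>u v t. u \<noteq> 0 \<longrightarrow> v \<noteq> 0 \<longrightarrow> t \<noteq> 0 \<longrightarrow> u \<bullet> v = 0 \<longrightarrow> u \<bullet> t = 0 \<longrightarrow> v \<bullet> t = 0 \<longrightarrow> f u + f v + f t = w)"

abbreviation e3 :: "real^3" where "e3 \<equiv> vector [0, 0, 1]"

lemma inner_real3: "(u::real^3) \<bullet> v = u$1 * v$1 + u$2 * v$2 + u$3 * v$3"
  by (simp add: inner_vec_def sum_3)

lemma vec3_eq_iff: "(u::real^3) = v \<longleftrightarrow> u$1 = v$1 \<and> u$2 = v$2 \<and> u$3 = v$3"
  by (simp add: vec_eq_iff forall_3)

lemma frame_function_scale: "frame_function f w \<Longrightarrow> c \<noteq> 0 \<Longrightarrow> f (c *\<^sub>R v) = f v"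
  by (simp add: frame_function_def)

lemma frame_function_sum:
  "frame_function f w \<Longrightarrow> u \<noteq> 0 \<Longrightarrow> v \<noteq> 0 \<Longrightarrow> t \<noteq> 0 \<Longrightarrow> u \<bullet> v = 0 \<Longrightarrow> u \<bullet> t = 0 \<Longrightarrow> v \<bullet> t = 0
    \<Longrightarrow> f u + f v + f t = w"
  by (simp add: frame_function_def)

text \<open>Two orthogonal pairs in the same plane are completed by the same normal
  \<open>n\<close>, so their sums agree. The factors \<open>e \<bullet> e\<close> and
  \<open>s \<bullet> s\<close> make the second vector orthogonal to the first although
  \<open>s\<close> and \<open>e\<close> are not normalised.\<close>

lemma frame_function_circle:
  assumes f: "frame_function f w"
    and nz: "s \<noteq> 0" "e \<noteq> 0" and orth: "s \<bullet> e = 0" and ab: "\<alpha> \<noteq> 0 \<or> \<beta> \<noteq> 0"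
  shows "f (\<alpha> *\<^sub>R s + \<beta> *\<^sub>R e) + f ((- \<beta> * (e \<bullet> e)) *\<^sub>R s + (\<alpha> * (s \<bullet> s)) *\<^sub>R e) = f s + f e"
proof -
  define n where "n = cross3 s e"
  have n: "n \<bullet> s = 0" "n \<bullet> e = 0" "n \<noteq> 0"
  proof -
    show "n \<bullet> s = 0" "n \<bullet> e = 0" by (simp_all add: n_def dot_cross_self)
    have "(norm n)\<^sup>2 = (norm s * norm e)\<^sup>2"
      using norm_cross_dot[of s e] orth unfolding n_def by simp
    then show "n \<noteq> 0" using nz by auto
  qed
  have ss: "s \<bullet> s \<noteq> 0" and ee: "e \<bullet> e \<noteq> 0" using nz by auto
  let ?v = "\<alpha> *\<^sub>R s + \<beta> *\<^sub>R e" and ?v' = "(- \<beta> * (e \<bullet> e)) *\<^sub>R s + (\<alpha> * (s \<bullet> s)) *\<^sub>R e"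
  have es: "e \<bullet> s = 0" using orth by (simp add: inner_commute)
  have nz2: "a *\<^sub>R s + b *\<^sub>R e \<noteq> 0" if "a \<noteq> 0 \<or> b \<noteq> 0" for a b
  proof
    assume z: "a *\<^sub>R s + b *\<^sub>R e = 0"
    have "a * (s \<bullet> s) = (a *\<^sub>R s + b *\<^sub>R e) \<bullet> s" "b * (e \<bullet> e) = (a *\<^sub>R s + b *\<^sub>R e) \<bullet> e"
      using orth es by (simp_all add: inner_add_left)
    then show False using z ss ee that by simp
  qed
  have "?v \<noteq> 0" "?v' \<noteq> 0" using nz2[OF ab] nz2[of "- \<beta> * (e \<bullet> e)" "\<alpha> * (s \<bullet> s)"] ab ss ee by auto
  moreover have "?v \<bullet> ?v' = 0" using orth es by (simp add: inner_add_left inner_add_right inner_diff_right)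
  moreover have "?v \<bullet> n = 0" "?v' \<bullet> n = 0" using n by (simp_all add: inner_commute[of _ n] inner_add_right inner_diff_right)
  ultimately have "f ?v + f ?v' + f n = w" using frame_function_sum[OF f] n(3) by blast
  moreover have "f s + f e + f n = w"
    using frame_function_sum[OF f nz n(3) orth] n by (simp add: inner_commute)
  ultimately show ?thesis by simp
qed

text \<open>A linear isometry from real^3 when the triple is orthonormal. The target is arbitrary
  because it serves both for rotations of real^3 and for totally real embeddings into a complex
  space.\<close>

definition combination :: "'a::real_vector \<Rightarrow> 'a \<Rightarrow> 'a \<Rightarrow> real^3 \<Rightarrow> 'a" where
  "combination a b c v = v$1 *\<^sub>R a + v$2 *\<^sub>R b + v$3 *\<^sub>R c"

definition orthonormal3 :: "'a::real_inner \<Rightarrow> 'a \<Rightarrow> 'a \<Rightarrow> bool" where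
  "orthonormal3 a b c \<longleftrightarrow> a \<bullet> a = 1 \<and> b \<bullet> b = 1 \<and> c \<bullet> c = 1 \<and> a \<bullet> b = 0 \<and> a \<bullet> c = 0 \<and> b \<bullet> c = 0"

lemma inner_combination:
  "orthonormal3 a b c \<Longrightarrow> combination a b c u \<bullet> combination a b c v = u \<bullet> v"
  unfolding inner_real3[of u v] combination_def orthonormal3_def
  by (simp add: inner_add_left inner_add_right inner_commute[of b a] inner_commute[of c a] inner_commute[of c b])

lemma orthogonal_transformation_combination:
  fixes a :: "real^3"
  shows "orthonormal3 a b c \<Longrightarrow> orthogonal_transformation (combination a b c)"
  unfolding orthogonal_transformation_def
  by (auto simp: inner_combination intro!: linearI) (simp_all add: combination_def algebra_simps)

lemma combination_eq_0_iff: "orthonormal3 a b c \<Longrightarrow> combination a b c v = 0 \<longleftrightarrow> v = 0"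
  by (metis inner_combination inner_eq_zero_iff)

lemma combination_surj:
  fixes a :: "real^3"
  assumes "orthonormal3 a b c"
  obtains u where "v = combination a b c u"
  by (meson assms orthogonal_transformation_combination orthogonal_transformation_surj surjE)

lemma inner_combination_basis:
  assumes "orthonormal3 a b c"
  shows "combination a b c u \<bullet> a = u$1" "combination a b c u \<bullet> b = u$2" "combination a b c u \<bullet> c = u$3"
  using assms unfolding orthonormal3_def combination_def
  by (simp_all add: inner_add_left inner_commute[of b a] inner_commute[of c a] inner_commute[of c b])

text \<open>Polarised Parseval identity for an orthogonal triple of arbitrary lengths; it makes sums
  of rank-one terms over a frame independent of the frame.\<close>

lemma parseval3:
  assumes "u \<noteq> 0" "v \<noteq> 0" "t \<noteq> 0" "u \<bullet> v = 0" "u \<bullet> t = 0" "v \<bullet> t = 0"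
  shows "(x::real^3) \<bullet> y = (x \<bullet> u) * (y \<bullet> u) / (u \<bullet> u) + (x \<bullet> v) * (y \<bullet> v) / (v \<bullet> v) + (x \<bullet> t) * (y \<bullet> t) / (t \<bullet> t)"
proof -
  have n: "(z /\<^sub>R norm z) \<bullet> (z /\<^sub>R norm z) = 1" if "z \<noteq> 0" for z :: "real^3"
    using that by (simp add: dot_square_norm power2_eq_square field_simps)
  have o: "orthonormal3 (u /\<^sub>R norm u) (v /\<^sub>R norm v) (t /\<^sub>R norm t)"
    unfolding orthonormal3_def using assms n by simp
  obtain x' where x: "x = combination (u /\<^sub>R norm u) (v /\<^sub>R norm v) (t /\<^sub>R norm t) x'" using combination_surj[OF o] .
  obtain y' where y: "y = combination (u /\<^sub>R norm u) (v /\<^sub>R norm v) (t /\<^sub>R norm t) y'" using combination_surj[OF o] .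
  have "x \<bullet> y = x'$1 * y'$1 + x'$2 * y'$2 + x'$3 * y'$3"
    unfolding x y inner_combination[OF o] by (simp add: inner_real3)
  also have "\<dots> = (x \<bullet> (u /\<^sub>R norm u)) * (y \<bullet> (u /\<^sub>R norm u)) + (x \<bullet> (v /\<^sub>R norm v)) * (y \<bullet> (v /\<^sub>R norm v))
      + (x \<bullet> (t /\<^sub>R norm t)) * (y \<bullet> (t /\<^sub>R norm t))"
    unfolding x y inner_combination_basis[OF o] ..
  also have "\<dots> = (x \<bullet> u) * (y \<bullet> u) / (u \<bullet> u) + (x \<bullet> v) * (y \<bullet> v) / (v \<bullet> v) + (x \<bullet> t) * (y \<bullet> t) / (t \<bullet> t)"
    by (simp add: dot_square_norm power2_eq_square divide_simps)
  finally show ?thesis .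
qed

lemma frame_function_combination:
  fixes a :: "real^3"
  assumes "frame_function f w" "orthonormal3 a b c"
  shows "frame_function (\<lambda>v. f (combination a b c v)) w"
proof -
  have "combination a b c (k *\<^sub>R v) = k *\<^sub>R combination a b c v" for k v
    by (simp add: combination_def algebra_simps)
  then show ?thesis using assms unfolding frame_function_def
    by (simp add: inner_combination combination_eq_0_iff)
qed

section \<open>Completion to orthonormal triples\<close>

lemma orthonormal3_extend:
  fixes a :: "real^3"
  assumes "a \<bullet> a = 1" "b \<bullet> b = 1" "a \<bullet> b = 0"
  shows "orthonormal3 a b (cross3 a b)"
proof -
  have "cross3 a b \<bullet> cross3 a b = 1"
    using assms norm_cross_dot[of a b] by (simp add: norm_eq_1 dot_square_norm power_mult_distrib)
  then show ?thesis using assms by (simp add: orthonormal3_def dot_cross_self)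
qed

lemma ex_orthogonal_unit3:
  fixes a :: "real^3"
  obtains b where "b \<bullet> b = 1" "a \<bullet> b = 0"
proof -
  obtain b where "b \<noteq> 0" "orthogonal a b"
    using orthogonal_to_vector_exists[of a] by auto
  then have "(b /\<^sub>R norm b) \<bullet> (b /\<^sub>R norm b) = 1" "a \<bullet> (b /\<^sub>R norm b) = 0"
    by (simp_all add: orthogonal_def dot_square_norm power2_eq_square)
  then show ?thesis using that by blast
qed

lemma ex_orthonormal3_last:
  fixes c :: "real^3"
  assumes "c \<bullet> c = 1"
  obtains a b where "orthonormal3 a b c"
proof -
  obtain b where b: "b \<bullet> b = 1" "c \<bullet> b = 0" using ex_orthogonal_unit3[of c] by metis
  from orthonormal3_extend[OF assms b] show ?thesis
    using that[of b "cross3 c b"] by (auto simp: orthonormal3_def inner_commute)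
qed

section \<open>Frame functions symmetrised about a pole\<close>

text \<open>Squared cosine of the angle to \<open>e3\<close>: a function of lines, like the frame
  functions it is compared with.\<close>

definition height :: "real^3 \<Rightarrow> real" where
  "height v = (v$3)\<^sup>2 / (v \<bullet> v)"

text \<open>
  In the gnomonic projection \<open>w \<mapsto> (Re w, Im w, 1)\<close>, the great circle with highest point \<open>w\<close> is the
  line \<open>w (1 + i t)\<close>. Along boundedly many such lines one can get from \<open>w\<close> to every point outside the
  circle of radius \<open>r \<bar>w\<bar>\<close>; what matters below is that the number of lines depends on \<open>r\<close> only.
\<close>

lemma complex_spiral_factorisation:
  fixes r :: real
  assumes r: "1 < r"
  shows "\<exists>N. \<forall>z::complex. r \<le> norm z \<longrightarrow>
    (\<exists>\<tau> \<sigma>. z = Complex 1 \<tau> ^ N * Complex 1 \<sigma> * Complex 1 (- \<sigma>))"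
proof -
  have q: "0 < 1 - 1/r" using r by simp
  \<comment> \<open>With this many turns, each of angle at most pi/n, \<open>cos t ^ n\<close> stays
    above \<open>1/r\<close>; the 4 added below makes \<open>pi / n\<close> at most 1, which
    Bernoulli's inequality requires.\<close>
  obtain N :: nat where N: "pi\<^sup>2 / (1 - 1/r) < N" using reals_Archimedean2 by blast
  define n where "n = N + 4"
  have n: "pi\<^sup>2 / (1 - 1/r) < n" "4 \<le> n" "0 < real n" using N by (simp_all add: n_def)
  then have nq: "pi\<^sup>2 / n < 1 - 1/r" using q by (simp add: field_simps)
  have cn: "1/r \<le> cos t ^ n" "0 < cos t" if "\<bar>t\<bar> \<le> pi / n" for t
  proof -
    have pn: "pi / n \<le> 1" using n(2) pi_less_4 by simp
    then have tp: "\<bar>t\<bar> < pi/2" using that pi_gt3 by linarith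
    then show c: "0 < cos t" using cos_gt_zero_pi[of t] by auto
    have "cos t \<ge> 1 - t\<^sup>2 / 2"
    proof -
      have "(sin (t/2))\<^sup>2 \<le> (t/2)\<^sup>2" using abs_sin_x_le_abs_x[of "t/2"] by (simp only: abs_le_square_iff)
      then show ?thesis using cos_double_sin[of "t/2"] by (simp add: power_divide)
    qed
    moreover have "t\<^sup>2 \<le> (pi / n)\<^sup>2" using that by (metis abs_le_square_iff abs_of_nonneg pi_ge_zero divide_nonneg_nonneg of_nat_0_le_iff)
    ultimately have c1: "cos t \<ge> 1 + (- (pi / n)\<^sup>2)" by (smt (verit) zero_le_power2 field_sum_of_halves)
    from pn have "-1 \<le> - (pi / n)\<^sup>2" by (simp add: power_le_one)
    then have "1 + n * (- (pi / n)\<^sup>2) \<le> (1 + (- (pi / n)\<^sup>2)) ^ n" by (rule Bernoulli_inequality)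
    also have "\<dots> \<le> cos t ^ n" using c1 pn by (intro power_mono) (auto simp: power_le_one)
    finally have "1 - pi\<^sup>2 / n \<le> cos t ^ n" using n by (simp add: power2_eq_square field_simps)
    then show "1/r \<le> cos t ^ n" using nq by simp
  qed
  show ?thesis
  proof (intro exI[of _ n] allI impI)
    fix z :: complex assume z: "r \<le> norm z"
    \<comment> \<open>The \<open>n\<close> factors \<open>1 + i tan t\<close> give the right
      argument and modulus \<open>1 / cos t ^ n\<close>; the last two factors are conjugate and
      supply the missing real stretch \<open>1 + \<sigma>\<^sup>2 = a\<close>.\<close>
    define t where "t = Arg z / n"
    have t: "\<bar>t\<bar> \<le> pi / n" using Arg_bounded[of z] n by (auto simp: t_def divide_simps)
    have c0: "cos t \<noteq> 0" using cn(2)[OF t] by simp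
    define a where "a = norm z * cos t ^ n"
    have "1 \<le> a"
    proof -
      have "1 = r * (1/r)" using r by simp
      also have "\<dots> \<le> norm z * cos t ^ n" using cn[OF t] z r by (intro mult_mono) auto
      finally show ?thesis by (simp add: a_def)
    qed
    define \<sigma> where "\<sigma> = sqrt (a - 1)"
    have s: "Complex 1 \<sigma> * Complex 1 (- \<sigma>) = of_real a"
      using \<open>1 \<le> a\<close> by (simp add: \<sigma>_def complex_eq_iff)
    have "Complex 1 (tan t) = cis t / of_real (cos t)"
      using c0 by (simp add: complex_eq_iff tan_def)
    then have "Complex 1 (tan t) ^ n = cis (real n * t) / of_real (cos t ^ n)"
      by (simp only: power_divide Complex.DeMoivre of_real_power)
    also have "real n * t = Arg z" using n by (simp add: t_def)
    finally have "Complex 1 (tan t) ^ n * of_real a = cis (Arg z) * of_real (norm z)"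
      using c0 by (simp add: a_def)
    also have "\<dots> = z" by (metis mult.commute rcis_def rcis_cmod_Arg)
    finally show "\<exists>\<tau> \<sigma>. z = Complex 1 \<tau> ^ n * Complex 1 \<sigma> * Complex 1 (- \<sigma>)"
      using s by (metis mult.assoc)
  qed
qed

text \<open>
  Averaging a frame function over a quarter turn about \<open>e3\<close> makes it constant on the equator;
  subtracting that constant gives such a \<open>C\<close>.
\<close>

locale pole_function =
  fixes C :: "real^3 \<Rightarrow> real"
  assumes frame: "frame_function C (C e3)"
    and equator: "\<And>v. v \<noteq> 0 \<Longrightarrow> v$3 = 0 \<Longrightarrow> C v = 0"
begin

lemma circle:
  assumes "s \<noteq> 0" "e \<noteq> 0" "s \<bullet> e = 0" "e$3 = 0" "\<alpha> \<noteq> 0 \<or> \<beta> \<noteq> 0"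
  shows "C (\<alpha> *\<^sub>R s + \<beta> *\<^sub>R e) + C ((- \<beta> * (e \<bullet> e)) *\<^sub>R s + (\<alpha> * (s \<bullet> s)) *\<^sub>R e) = C s"
  using frame_function_circle[OF frame assms(1-3,5)] equator[OF assms(2,4)] by simp

text \<open>On the great circle with highest point \<open>s\<close> the other direction
  \<open>e\<close> is horizontal and scaled to the length of \<open>s\<close>, so heights are
  \<open>height s\<close> times a squared cosine, while \<open>circle\<close> makes the values add
  up.\<close>

lemma split:
  assumes s: "s \<noteq> 0" and a: "0 \<le> a" "a \<le> 1"
  shows "\<exists>v v'. v \<noteq> 0 \<and> v' \<noteq> 0 \<and> C v + C v' = C s \<and> height v = a * height s \<and> height v' = (1 - a) * height s"
proof -
  define e0 :: "real^3" where "e0 = (if s$1 = 0 \<and> s$2 = 0 then vector [1,0,0] else vector [- s$2, s$1, 0])"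
  have e0: "e0 \<noteq> 0" "s \<bullet> e0 = 0" "e0$3 = 0"
    by (auto simp: e0_def vec3_eq_iff inner_real3)
  define e where "e = (norm s / norm e0) *\<^sub>R e0"
  have e: "e \<noteq> 0" "s \<bullet> e = 0" "e$3 = 0" using e0 s by (auto simp: e_def)
  have "norm e = norm s" using e0 by (simp add: e_def)
  then have ee: "e \<bullet> e = s \<bullet> s" by (simp add: dot_square_norm)
  have ss: "s \<bullet> s \<noteq> 0" using s by simp
  define v where "v = sqrt a *\<^sub>R s + sqrt (1 - a) *\<^sub>R e"
  define v' where "v' = (- sqrt (1 - a) * (e \<bullet> e)) *\<^sub>R s + (sqrt a * (s \<bullet> s)) *\<^sub>R e"
  have "C v + C v' = C s" unfolding v_def v'_def
    by (rule circle[OF s e(1,2,3)]) auto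
  moreover have q: "(x *\<^sub>R s + y *\<^sub>R e) \<bullet> (x *\<^sub>R s + y *\<^sub>R e) = (x\<^sup>2 + y\<^sup>2) * (s \<bullet> s)" for x y
    using e(2) ee inner_commute[of s e]
    by (simp add: inner_add_left inner_add_right power2_eq_square distrib_right)
  have vv: "v \<bullet> v = s \<bullet> s" "v' \<bullet> v' = (s \<bullet> s)\<^sup>2 * (s \<bullet> s)"
    unfolding v_def v'_def q ee using a by (simp_all add: power_mult_distrib flip: distrib_right)
  moreover have "v$3 = sqrt a * s$3" "v'$3 = - sqrt (1 - a) * (s \<bullet> s) * s$3"
    using e ee by (simp_all add: v_def v'_def)
  then have "height v = a * height s" "height v' = (1 - a) * height s"
    unfolding height_def vv using a ss by (simp_all add: power_mult_distrib)
  moreover have "v \<noteq> 0" "v' \<noteq> 0" using vv ss by auto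
  ultimately show ?thesis by blast
qed

text \<open>Turns the bound of \<open>split_min\<close> into that of
  \<open>split_max\<close>.\<close>

lemma minus: "pole_function (\<lambda>v. - C v)"
proof
  show "frame_function (\<lambda>v. - C v) (- C e3)"
    unfolding frame_function_def
  proof (intro conjI allI impI)
    fix u v t :: "real^3"
    assume "u \<noteq> 0" "v \<noteq> 0" "t \<noteq> 0" "u \<bullet> v = 0" "u \<bullet> t = 0" "v \<bullet> t = 0"
    then show "- C u + - C v + - C t = - C e3" using frame_function_sum[OF frame, of u v t] by simp
  qed (simp add: frame_function_scale[OF frame])
qed (simp add: equator)

text \<open>Repeated use of \<open>split\<close> cuts \<open>s\<close> into \<open>n\<close> pieces
  of equal height whose values add up to \<open>C s\<close>; a piece of least value is the
  witness.\<close>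

lemma split_min: 
  assumes "s \<noteq> 0" "0 < n"
  shows "\<exists>v. v \<noteq> 0 \<and> height v = height s / real n \<and> real n * C v \<le> C s"
  using assms(2,1)
proof (induction n arbitrary: s rule: nat_induct_non_zero)
  case 1
  then show ?case by auto
next
  case (Suc n)
  let ?a = "1 / real (Suc n)"
  obtain v v' where v: "v \<noteq> 0" "v' \<noteq> 0" "C v + C v' = C s" "height v = ?a * height s" "height v' = (1 - ?a) * height s"
    using split[OF Suc.prems, of ?a] by auto
  obtain v'' where v'': "v'' \<noteq> 0" "height v'' = height v' / real n" "real n * C v'' \<le> C v'"
    using Suc.IH[OF v(2)] by auto
  have h: "height v'' = height s / real (Suc n)" 
  proof -
    have "1 - ?a = real n / real (Suc n)" by (simp add: field_simps)
    then show ?thesis using v''(2) v(5) Suc.hyps by simp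
  qed
  show ?case
  proof (cases "C v \<le> C v''")
    case True
    then have "real n * C v \<le> C v'" using v''(3) by (smt (verit) mult_left_mono of_nat_0_le_iff)
    then show ?thesis using v by (intro exI[of _ v]) (simp add: algebra_simps)
  next
    case False
    then have "real (Suc n) * C v'' \<le> C s" using v(3) v''(3) by (simp add: algebra_simps)
    then show ?thesis using h v''(1) by blast
  qed
qed

lemma split_max: 
  assumes "s \<noteq> 0" "0 < n"
  shows "\<exists>v. v \<noteq> 0 \<and> height v = height s / real n \<and> C s \<le> real n * C v"
proof -
  interpret m: pole_function "\<lambda>v. - C v" by (rule minus)
  show ?thesis using m.split_min[OF assms] by auto
qed

text \<open>In the vertical plane through \<open>s\<close>, whose normal is horizontal, the vector
  orthogonal to \<open>s\<close> has the complementary height. Through it lower bounds become upper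
  bounds.\<close>

lemma ex_complement:
  assumes "s \<noteq> 0"
  shows "\<exists>v. v \<noteq> 0 \<and> C s + C v = C e3 \<and> height v = 1 - height s"
proof -
  define z where "z = s - (s$3) *\<^sub>R e3"
  have e3: "e3 \<bullet> e3 = 1" "e3 \<noteq> 0" by (auto simp: inner_real3 vec3_eq_iff)
  show ?thesis
  proof (cases "z = 0")
    case True
    then have s: "s = (s$3) *\<^sub>R e3" by (simp add: z_def)
    then have "s$3 \<noteq> 0" using assms by auto
    then have "C s = C e3" using frame_function_scale[OF frame, of "s$3" e3] s by simp
    moreover have "s$1 = 0" "s$2 = 0" using True by (simp_all add: z_def vec3_eq_iff)
    then have "height s = 1" using \<open>s$3 \<noteq> 0\<close> by (simp add: height_def inner_real3 power2_eq_square)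
    ultimately show ?thesis using equator[of "vector [1,0,0]"]
      by (intro exI[of _ "vector [1,0,0]"]) (auto simp: height_def vec3_eq_iff)
  next
    case False
    let ?v = "(- (z \<bullet> z)) *\<^sub>R e3 + (s$3) *\<^sub>R z"
    have z: "z$3 = 0" "e3 \<bullet> z = 0" by (simp_all add: z_def inner_real3)
    have sz: "s = (s$3) *\<^sub>R e3 + 1 *\<^sub>R z" by (simp add: z_def)
    have zz: "z \<bullet> z > 0" using False by simp
    have "C s + C ?v = C e3"
      using circle[OF e3(2) False z(2,1), of "s$3" 1] e3(1) sz by simp
    moreover have ss: "s \<bullet> s = (s$3)\<^sup>2 + z \<bullet> z" "?v \<bullet> ?v = (z \<bullet> z) * (s \<bullet> s)"
    proof -
      have q: "(x *\<^sub>R e3 + y *\<^sub>R z) \<bullet> (x *\<^sub>R e3 + y *\<^sub>R z) = x\<^sup>2 + y\<^sup>2 * (z \<bullet> z)" for x y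
        using z(2) inner_commute[of e3 z] e3(1)
        by (simp add: inner_add_left inner_add_right power2_eq_square)
      show s2: "s \<bullet> s = (s$3)\<^sup>2 + z \<bullet> z" using q[of "s$3" 1] sz by simp
      show "?v \<bullet> ?v = (z \<bullet> z) * (s \<bullet> s)" unfolding q s2 by (simp add: power2_eq_square algebra_simps)
    qed
    have "?v \<noteq> 0" using ss(2) zz assms by auto
    moreover have v3: "?v$3 = - (z \<bullet> z)" using z by simp
    have "height ?v = 1 - height s" unfolding height_def ss(2) v3 using zz ss(1) inner_eq_zero_iff[of s] assms
      by (simp add: divide_simps power2_eq_square)
    ultimately show ?thesis by blast
  qed
qed

end

section \<open>Approximate descent from a lower bound\<close>

locale bounded_pole_function = pole_function +
  fixes \<delta> :: real
  assumes lower: "v \<noteq> 0 \<Longrightarrow> - \<delta> \<le> C v" and \<delta>: "0 \<le> \<delta>"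
begin

definition gnomonic :: "complex \<Rightarrow> real" where
  "gnomonic w = C (vector [Re w, Im w, 1])"

text \<open>Multiplication by \<open>1 + i t\<close> moves \<open>w\<close> by \<open>t\<close> in
  the direction \<open>i w\<close>, which is horizontal and orthogonal to \<open>s\<close>; the
  perpendicular vector on the same circle has value at least \<open>- \<delta>\<close>.\<close>

lemma gnomonic_descent: "gnomonic (w * Complex 1 t) \<le> gnomonic w + \<delta>"
proof (cases "w = 0")
  case True
  then show ?thesis using \<delta> by simp
next
  case False
  define s e :: "real^3" where "s = vector [Re w, Im w, 1]" and "e = vector [- Im w, Re w, 0]"
  have se: "s \<noteq> 0" "e \<noteq> 0" "s \<bullet> e = 0" "e$3 = 0"
    using False by (auto simp: s_def e_def vec3_eq_iff inner_real3 complex_eq_iff)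
  have v: "vector [Re (w * Complex 1 t), Im (w * Complex 1 t), 1] = 1 *\<^sub>R s + t *\<^sub>R e"
    by (simp add: s_def e_def vec3_eq_iff)
  let ?v' = "(- t * (e \<bullet> e)) *\<^sub>R s + (1 * (s \<bullet> s)) *\<^sub>R e"
  have "?v' \<noteq> 0"
  proof
    assume "?v' = 0"
    then have "?v' \<bullet> e = 0" by simp
    then show False using se by (simp add: inner_diff_left)
  qed
  then show ?thesis using circle[OF se(1-4), of 1 t] lower[of ?v'] v
    by (simp add: gnomonic_def s_def)
qed

lemma gnomonic_spiral: "gnomonic (w * Complex 1 \<tau> ^ n * Complex 1 \<sigma> * Complex 1 \<sigma>') \<le> gnomonic w + (real n + 2) * \<delta>"
proof -
  have "gnomonic (w * Complex 1 \<tau> ^ n) \<le> gnomonic w + real n * \<delta>"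
  proof (induction n)
    case (Suc n)
    have "gnomonic (w * Complex 1 \<tau> ^ n * Complex 1 \<tau>) \<le> gnomonic (w * Complex 1 \<tau> ^ n) + \<delta>" by (rule gnomonic_descent)
    then show ?case using Suc by (simp add: algebra_simps)
  qed simp
  then show ?thesis
    using gnomonic_descent[of "w * Complex 1 \<tau> ^ n" \<sigma>] gnomonic_descent[of "w * Complex 1 \<tau> ^ n * Complex 1 \<sigma>" \<sigma>']
    by (simp add: algebra_simps)
qed

lemma C_eq_gnomonic:
  assumes "s$3 \<noteq> 0"
  shows "C s = gnomonic (Complex (s$1 / s$3) (s$2 / s$3))"
proof -
  have "s = (s$3) *\<^sub>R vector [s$1 / s$3, s$2 / s$3, 1]" using assms by (simp add: vec3_eq_iff)
  then show ?thesis using frame_function_scale[OF frame, of "s$3" "vector [s$1 / s$3, s$2 / s$3, 1]"] assms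
    by (simp add: gnomonic_def)
qed

end

text \<open>\<open>(1 - height v) / height v\<close> is the squared modulus of the gnomonic image of
  \<open>v\<close>, so the inequality on heights says that the image of \<open>t\<close> is at least
  \<open>r\<close> times as far out as that of \<open>s\<close>. Cleared of denominators it also
  allows \<open>t\<close> on the equator.\<close>

lemma approx_decreasing:
  fixes r :: real
  assumes r: "1 < r"
  obtains N :: nat where "\<And>C \<delta> s t. bounded_pole_function C \<delta> \<Longrightarrow> s \<noteq> 0 \<Longrightarrow> t \<noteq> 0 \<Longrightarrow> 0 < height s \<Longrightarrow> height s < 1 \<Longrightarrow>
    r\<^sup>2 * (1 - height s) * height t \<le> (1 - height t) * height s \<Longrightarrow> C t \<le> C s + real N * \<delta>"
proof -
  obtain N where N: "\<And>z. r \<le> norm z \<Longrightarrow> \<exists>\<tau> \<sigma>. z = Complex 1 \<tau> ^ N * Complex 1 \<sigma> * Complex 1 (- \<sigma>)"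
    using complex_spiral_factorisation[OF r] by metis
  show ?thesis
  proof (rule that[of "N + 2"])
    fix C \<delta> and s t :: "real^3"
    assume "bounded_pole_function C \<delta>" and nz: "s \<noteq> 0" "t \<noteq> 0" and h: "0 < height s" "height s < 1"
      and le: "r\<^sup>2 * (1 - height s) * height t \<le> (1 - height t) * height s"
    then interpret bounded_pole_function C \<delta> by simp
    have s3: "s$3 \<noteq> 0" using h by (auto simp: height_def)
    show "C t \<le> C s + real (N + 2) * \<delta>"
    proof (cases "t$3 = 0")
      case True
      have "\<delta> \<le> real (N + 2) * \<delta>" using \<delta> by (simp add: algebra_simps)
      then show ?thesis using equator[OF nz(2) True] lower[OF nz(1)] by simp
    next
      case False
      define w z where "w = Complex (s$1 / s$3) (s$2 / s$3)" and "z = Complex (t$1 / t$3) (t$2 / t$3)"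
      have w1: "(norm (Complex (v$1 / v$3) (v$2 / v$3)))\<^sup>2 = (1 - height v) / height v" if "v \<noteq> 0" "v$3 \<noteq> 0" for v :: "real^3"
      proof -
        have "v \<bullet> v \<noteq> 0" using that by simp
        then show ?thesis unfolding height_def cmod_power2 using that
          by (simp add: divide_simps) (simp add: inner_real3 power2_eq_square algebra_simps)
      qed
      have ht_pos: "0 < height t" using False nz by (simp add: height_def)
      have "r\<^sup>2 * ((1 - height s) / height s) \<le> (1 - height t) / height t"
        using le h ht_pos by (simp add: divide_simps mult.commute mult.left_commute)
      then have "(r * norm w)\<^sup>2 \<le> (norm z)\<^sup>2"
        using w1[OF nz(1) s3] w1[OF nz(2) False] by (simp add: w_def z_def power_mult_distrib)
      then have rw: "r * norm w \<le> norm z" by (rule power2_le_imp_le) simp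
      have "(norm w)\<^sup>2 > 0" using w1[OF nz(1) s3] h by (simp add: w_def)
      then have w0: "w \<noteq> 0" by auto
      then have "r \<le> norm (z / w)" using rw by (simp add: norm_divide field_simps)
      then obtain \<tau> \<sigma> where "z / w = Complex 1 \<tau> ^ N * Complex 1 \<sigma> * Complex 1 (- \<sigma>)" using N by blast
      then have "z = w * Complex 1 \<tau> ^ N * Complex 1 \<sigma> * Complex 1 (- \<sigma>)" using w0 by (simp add: field_simps)
      then have "gnomonic z \<le> gnomonic w + (real N + 2) * \<delta>" using gnomonic_spiral by metis
      then show ?thesis unfolding C_eq_gnomonic[OF s3] C_eq_gnomonic[OF False] w_def z_def by (simp add: add.commute)
    qed
  qed
qed

section \<open>Maxima of bounded frame functions\<close>

lemma height_bounds: "0 \<le> height v" "height v \<le> 1"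
proof -
  have "(v$3)\<^sup>2 \<le> v \<bullet> v" by (simp add: inner_real3 power2_eq_square)
  then show "0 \<le> height v" "height v \<le> 1" unfolding height_def by (simp, intro divide_le_eq_1[THEN iffD2]) auto
qed

section \<open>Symmetrisation by a quarter turn\<close>

definition quarter_turn :: "real^3 \<Rightarrow> real^3" where
  "quarter_turn v = vector [- v$2, v$1, v$3]"

lemma inner_quarter_turn: "quarter_turn u \<bullet> quarter_turn v = u \<bullet> v"
  by (simp add: quarter_turn_def inner_real3)

lemma quarter_turn_eq_0_iff [simp]: "quarter_turn v = 0 \<longleftrightarrow> v = 0"
  by (auto simp: quarter_turn_def vec3_eq_iff)

lemma quarter_turn_scaleR: "quarter_turn (c *\<^sub>R v) = c *\<^sub>R quarter_turn v"
  by (simp add: quarter_turn_def vec3_eq_iff)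

lemma e3_simps [simp]: "e3 \<noteq> 0" "e3 \<bullet> e3 = 1" "v \<bullet> e3 = v$3" "quarter_turn e3 = e3" "height e3 = 1"
  by (auto simp: inner_real3 vec3_eq_iff quarter_turn_def height_def)

text \<open>On the equator \<open>v\<close>, \<open>quarter_turn v\<close> and \<open>e3\<close>
  form a frame, whence the subtracted constant; the weight of the result is then its value
  \<open>3 * f e3 - w\<close> at the pole.\<close>

lemma pole_function_symmetrised:
  assumes f: "frame_function f w"
  shows "pole_function (\<lambda>v. f v + f (quarter_turn v) - (w - f e3))"
proof
  show "frame_function (\<lambda>v. f v + f (quarter_turn v) - (w - f e3)) (f e3 + f (quarter_turn e3) - (w - f e3))"
    unfolding frame_function_def
  proof (intro conjI allI impI)
    fix u v t :: "real^3"
    assume a: "u \<noteq> 0" "v \<noteq> 0" "t \<noteq> 0" "u \<bullet> v = 0" "u \<bullet> t = 0" "v \<bullet> t = 0"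
    have "f u + f v + f t = w" "f (quarter_turn u) + f (quarter_turn v) + f (quarter_turn t) = w"
      using frame_function_sum[OF f, of u v t] frame_function_sum[OF f, of "quarter_turn u" "quarter_turn v" "quarter_turn t"] a
      by (simp_all add: inner_quarter_turn)
    then show "f u + f (quarter_turn u) - (w - f e3) + (f v + f (quarter_turn v) - (w - f e3)) +
       (f t + f (quarter_turn t) - (w - f e3)) = f e3 + f (quarter_turn e3) - (w - f e3)" by simp
  qed (simp add: frame_function_scale[OF f] quarter_turn_scaleR)
next
  fix v :: "real^3" assume "v \<noteq> 0" "v$3 = 0"
  moreover have "v \<bullet> quarter_turn v = (v$3)\<^sup>2" "quarter_turn v $ 3 = v$3"
    by (simp_all add: quarter_turn_def inner_real3 power2_eq_square)
  ultimately show "f v + f (quarter_turn v) - (w - f e3) = 0"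
    using frame_function_sum[OF f, of v "quarter_turn v" e3] by simp
qed

text \<open>The complement of \<open>s\<close> has value at most \<open>2 * M - (w - f e3)\<close>;
  subtracting this from the value at \<open>e3\<close> leaves
  \<open>- 2 * (M - f e3)\<close>.\<close>

lemma bounded_pole_function_symmetrised:
  assumes f: "frame_function f w" and M: "\<And>v. v \<noteq> 0 \<Longrightarrow> f v \<le> M"
  shows "bounded_pole_function (\<lambda>v. f v + f (quarter_turn v) - (w - f e3)) (2 * (M - f e3))"
proof -
  interpret pole_function "\<lambda>v. f v + f (quarter_turn v) - (w - f e3)"
    by (rule pole_function_symmetrised[OF f])
  show ?thesis
  proof
    fix s :: "real^3" assume "s \<noteq> 0"
    then obtain v where "v \<noteq> 0" "f s + f (quarter_turn s) - (w - f e3) + (f v + f (quarter_turn v) - (w - f e3)) =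
       f e3 + f (quarter_turn e3) - (w - f e3)" using ex_complement by blast
    then show "- (2 * (M - f e3)) \<le> f s + f (quarter_turn s) - (w - f e3)"
      using M[of v] M[of "quarter_turn v"] by simp
  qed (use M[of e3] in simp)
qed

text \<open>
  The constant \<open>N\<close> is universal, so the value at a limit of almost maximising lines can be
  compared with the supremum although \<open>f\<close> is not known to be continuous.
\<close>

lemma near_maximum:
  obtains N :: nat where "\<And>f w M n s. frame_function f w \<Longrightarrow> (\<And>v. v \<noteq> 0 \<Longrightarrow> f v \<le> M) \<Longrightarrow> 2 \<le> n \<Longrightarrow>
    s \<noteq> 0 \<Longrightarrow> 1 - 1 / (2 * real n) \<le> height s \<Longrightarrow>
    2 * f e3 - M - (3 * M - w) / real n - 2 * real N * (M - f e3) \<le> f s"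
proof -
  have "1 < sqrt 2" by simp
  then obtain N :: nat where N: "\<And>C \<delta> s t. bounded_pole_function C \<delta> \<Longrightarrow> s \<noteq> 0 \<Longrightarrow> t \<noteq> 0 \<Longrightarrow> 0 < height s \<Longrightarrow> height s < 1 \<Longrightarrow>
    (sqrt 2)\<^sup>2 * (1 - height s) * height t \<le> (1 - height t) * height s \<Longrightarrow> C t \<le> C s + real N * \<delta>"
    by (rule approx_decreasing) blast
  show ?thesis
  proof (rule that[of N])
    fix f w M and n :: nat and s :: "real^3"
    assume f: "frame_function f w" and M: "\<And>v. v \<noteq> 0 \<Longrightarrow> f v \<le> M" and n: "2 \<le> n"
      and s: "s \<noteq> 0" and hs: "1 - 1 / (2 * real n) \<le> height s"
    define C where "C = (\<lambda>v. f v + f (quarter_turn v) - (w - f e3))"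
    have bC: "bounded_pole_function C (2 * (M - f e3))"
      unfolding C_def by (rule bounded_pole_function_symmetrised[OF f M])
    interpret bounded_pole_function C "2 * (M - f e3)" by (rule bC)
    \<comment> \<open>A line \<open>s\<close> close to the pole has a complement \<open>t\<close>
      close to the equator. Its value is small because \<open>t\<close> lies well below a vector
      \<open>v\<close> of height \<open>1 / n\<close> worth at most the \<open>n\<close>th part of
      \<open>C e3\<close>.\<close>
    obtain t where t: "t \<noteq> 0" "C s + C t = C e3" "height t = 1 - height s" using ex_complement[OF s] by blast
    obtain v where v: "v \<noteq> 0" "height v = 1 / real n" "real n * C v \<le> C e3"
      using split_min[of e3 n] n by auto
    have "2 * (1 - height v) * height t \<le> (1 - height t) * height v"
    proof -
      have t1: "height t \<le> 1 / (2 * real n)" using t hs by simp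
      have "2 * (1 - height v) * height t \<le> 2 * (1 - 1 / real n) * (1 / (2 * real n))"
        unfolding v using t1 n by (intro mult_left_mono mult_nonneg_nonneg) simp_all
      also have "\<dots> \<le> (1 - 1 / (2 * real n)) * (1 / real n)" using n by (simp add: field_simps)
      also have "\<dots> \<le> (1 - height t) * height v" unfolding v using t1 by (intro mult_right_mono) simp_all
      finally show ?thesis .
    qed
    then have "C t \<le> C v + real N * (2 * (M - f e3))"
      using N[OF bC v(1) t(1)] v(2) n by simp
    moreover have "C v \<le> (3 * M - w) / real n"
    proof -
      have "C e3 \<le> 3 * M - w" using M[of e3] by (simp add: C_def)
      then have "real n * C v \<le> 3 * M - w" using v(3) by simp
      then show ?thesis using n by (simp add: pos_le_divide_eq mult.commute)
    qed
    moreover have "C s \<le> f s + M - (w - f e3)" "C e3 = 3 * f e3 - w"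
      using M[of "quarter_turn s"] s by (simp_all add: C_def)
    ultimately show "2 * f e3 - M - (3 * M - w) / real n - 2 * real N * (M - f e3) \<le> f s"
      using t(2) by (simp add: algebra_simps)
  qed
qed

text \<open>Each member of a convergent maximising sequence serves as pole for
  \<open>near_maximum\<close>, with the limit \<open>l\<close> as the nearby line. For fixed
  \<open>n\<close>, advancing along the sequence removes the multiple of \<open>M - f q\<close>;
  letting \<open>n\<close> grow removes the rest.\<close>

lemma attains_maximum:
  assumes f: "frame_function f w" and B: "\<And>v. v \<noteq> 0 \<Longrightarrow> f v \<le> B"
  obtains p where "p \<bullet> p = 1" "\<And>v. v \<noteq> 0 \<Longrightarrow> f v \<le> f p"
proof -
  obtain N :: nat where near: "\<And>f w M n s. frame_function f w \<Longrightarrow> (\<And>v. v \<noteq> 0 \<Longrightarrow> f v \<le> M) \<Longrightarrow> 2 \<le> n \<Longrightarrow>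
    s \<noteq> 0 \<Longrightarrow> 1 - 1 / (2 * real n) \<le> height s \<Longrightarrow>
    2 * f e3 - M - (3 * M - w) / real n - 2 * real N * (M - f e3) \<le> f s"
    by (rule near_maximum) blast
  define M where "M = Sup (f ` (-{0}))"
  have bdd: "bdd_above (f ` (-{0}))" using B by (auto intro!: bdd_aboveI)
  have M: "f v \<le> M" if "v \<noteq> 0" for v
    unfolding M_def using that bdd by (intro cSup_upper) auto
  have "\<exists>p. norm p = 1 \<and> M - 1 / Suc k < f p" for k
  proof -
    have "M - 1 / Suc k < Sup (f ` (-{0}))" by (simp add: M_def)
    moreover have "f ` (-{0}) \<noteq> {}" by (metis Compl_iff empty_iff imageI singletonD e3_simps(1))
    ultimately obtain v where v: "v \<noteq> 0" "M - 1 / Suc k < f v"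
      using less_cSupD[of "f ` (-{0})" "M - 1 / Suc k"] by auto
    then show ?thesis using frame_function_scale[OF f, of "inverse (norm v)" v]
      by (intro exI[of _ "v /\<^sub>R norm v"]) simp
  qed
  then obtain p where p: "\<And>k. norm (p k) = 1" "\<And>k. M - 1 / Suc k < f (p k)" by metis
  have "compact (sphere (0::real^3) 1)" by simp
  then obtain l r where l: "l \<in> sphere 0 1" "strict_mono r" "(p \<circ> r) \<longlonglongrightarrow> l"
    using p(1) unfolding compact_def by (metis dist_0_norm mem_sphere)
  have l1: "l \<bullet> l = 1" using l(1) by (simp add: norm_eq_1)
  have ap: "2 * f q - M - (3 * M - w) / real n - 2 * real N * (M - f q) \<le> f l"
    if q: "norm q = 1" and n: "2 \<le> n" and ql: "1 - 1 / (2 * real n) \<le> (l \<bullet> q)\<^sup>2" for q n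
  proof -
    have "q \<bullet> q = 1" using q by (simp add: norm_eq_1)
    then obtain a b where o: "orthonormal3 a b q" by (rule ex_orthonormal3_last)
    obtain u where u: "l = combination a b q u" using combination_surj[OF o] .
    have u1: "u \<bullet> u = 1" using inner_combination[OF o, of u u] u l1 by simp
    have "u$3 = l \<bullet> q" using inner_combination_basis(3)[OF o] u by simp
    then have hu: "1 - 1 / (2 * real n) \<le> height u" using ql by (simp add: height_def u1)
    have "u \<noteq> 0" using u1 by auto
    moreover have "combination a b q e3 = q" by (simp add: combination_def)
    ultimately show ?thesis
      using near[OF frame_function_combination[OF f o] _ n _ hu, of M] M combination_eq_0_iff[OF o] u by simp
  qed
  have fM: "(\<lambda>k. f (p (r k))) \<longlonglongrightarrow> M"
  proof (rule tendsto_sandwich)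
    show "\<forall>\<^sub>F k in sequentially. M - 1 / Suc k \<le> f (p (r k))"
    proof (intro always_eventually allI)
      fix k
      have "1 / real (Suc (r k)) \<le> 1 / real (Suc k)" using seq_suble[OF l(2), of k] by (intro divide_left_mono) auto
      then show "M - 1 / Suc k \<le> f (p (r k))" using p(2)[of "r k"] by linarith
    qed
    have "p k \<noteq> 0" for k using p(1)[of k] by auto
    then show "\<forall>\<^sub>F k in sequentially. f (p (r k)) \<le> M" using M by simp
    have "(\<lambda>k. M - 1 / Suc k) \<longlonglongrightarrow> M - 0" 
      by (intro tendsto_diff tendsto_const LIMSEQ_Suc[OF lim_1_over_n])
    then show "(\<lambda>k. M - 1 / Suc k) \<longlonglongrightarrow> M" by simp
  qed simp
  have pl: "(\<lambda>k. (l \<bullet> p (r k))\<^sup>2) \<longlonglongrightarrow> (l \<bullet> l)\<^sup>2"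
    using l(3) by (auto simp: o_def intro!: tendsto_intros)
  have "M - (3 * M - w) / real n \<le> f l" if n: "2 \<le> n" for n
  proof -
    have "(\<lambda>k. 2 * f (p (r k)) - M - (3 * M - w) / real n - 2 * real N * (M - f (p (r k))))
      \<longlonglongrightarrow> 2 * M - M - (3 * M - w) / real n - 2 * real N * (M - M)"
      by (intro tendsto_intros fM)
    moreover have "1 - 1 / (2 * real n) < (l \<bullet> l)\<^sup>2" using l1 n by simp
    then have "\<forall>\<^sub>F k in sequentially. 1 - 1 / (2 * real n) < (l \<bullet> p (r k))\<^sup>2"
      using order_tendstoD(1)[OF pl] by blast
    then have "\<forall>\<^sub>F k in sequentially. 2 * f (p (r k)) - M - (3 * M - w) / real n - 2 * real N * (M - f (p (r k))) \<le> f l"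
      by eventually_elim (use ap[OF p(1) n] in simp)
    ultimately have "2 * M - M - (3 * M - w) / real n - 2 * real N * (M - M) \<le> f l"
      using tendsto_upperbound by fastforce
    then show ?thesis by simp
  qed
  moreover have "(\<lambda>n. M - (3 * M - w) / real n) \<longlonglongrightarrow> M - 0"
    by (intro tendsto_intros lim_const_over_n)
  ultimately have "M \<le> f l" 
    by (metis (no_types, lifting) LIMSEQ_le_const2 diff_zero)
  then show ?thesis using that[of l] l1 M by (meson order_trans)
qed

text \<open>
  Without continuity, additivity in the height and monotonicity still force linearity: a vector whose
  height exceeds \<open>k / n\<close> splits into \<open>k\<close> vectors higher than \<open>1 / n\<close>.
\<close>

lemma pole_function_linear:
  assumes C: "bounded_pole_function C 0" and s: "s \<noteq> 0"
  shows "C s = C e3 * height s"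
proof -
  interpret bounded_pole_function C 0 by (rule C)
  let ?K = "C e3"
  have nonneg: "0 \<le> C v" if "v \<noteq> 0" for v using lower[OF that] by simp
  have le: "C v \<le> ?K" if "v \<noteq> 0" for v
    using ex_complement[OF that] nonneg by force
  have top: "C v = ?K" if v: "v \<noteq> 0" "height v = 1" for v
  proof -
    obtain t where t: "t \<noteq> 0" "C v + C t = ?K" "height t = 0" using ex_complement[OF v(1)] v(2) by auto
    then have "t$3 = 0" by (simp add: height_def)
    then show ?thesis using equator[OF t(1)] t(2) by simp
  qed
  have mono: "C t \<le> C v" if nz: "t \<noteq> 0" "v \<noteq> 0" and lt: "height t < height v" for t v
  proof (cases "height v = 1")
    case True
    then show ?thesis using top[OF nz(2)] le[OF nz(1)] by simp
  next
    case False
    then have v: "0 < height v" "height v < 1" using lt height_bounds[of v] height_bounds[of t] by auto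
    \<comment> \<open>Square of the best ratio that \<open>approx_decreasing\<close> allows; it
      exceeds 1 because \<open>height t < height v\<close>, and for \<open>height t = 0\<close>
      every ratio is allowed. Since the error is 0, the number of lines costs nothing.\<close>
    define q where "q = (if height t = 0 then 4 else (1 - height t) * height v / ((1 - height v) * height t))"
    have q: "1 < q" "q * (1 - height v) * height t \<le> (1 - height t) * height v"
      using v lt height_bounds[of t] by (auto simp: q_def field_simps)
    then have "1 < sqrt q" "(sqrt q)\<^sup>2 = q" by simp_all
    with approx_decreasing[OF this(1)] show ?thesis using C v q(2) nz
      by (metis add.right_neutral mult_zero_right)
  qed
  have low: "real k * ?K / real n \<le> C v" if n: "0 < n" and "v \<noteq> 0" "real k / real n < height v" for k n v
    using that(2,3)
  proof (induction k arbitrary: v)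
    case 0
    then show ?case using nonneg by simp
  next
    case (Suc k)
    let ?a = "1 / real (Suc k)"
    obtain v1 v2 where v: "v1 \<noteq> 0" "v2 \<noteq> 0" "C v1 + C v2 = C v" "height v1 = ?a * height v" "height v2 = (1 - ?a) * height v"
      using split[OF Suc.prems(1), of ?a] by auto
    obtain p where p: "p \<noteq> 0" "height p = 1 / real n" "?K \<le> real n * C p"
      using split_max[of e3 n] n by auto
    have "real (Suc k) / real n / real (Suc k) < height v / real (Suc k)"
      using Suc.prems(2) by (intro divide_strict_right_mono) simp_all
    then have "1 / real n < height v1" using v(4) by simp
    then have "C p \<le> C v1" using mono[OF p(1) v(1)] p(2) by simp
    moreover have "?K / real n \<le> C p" using p(3) n by (simp add: pos_divide_le_eq mult.commute)
    moreover have "real k * ?K / real n \<le> C v2"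
    proof (cases "k = 0")
      case True
      then show ?thesis using nonneg v by simp
    next
      case False
      have "1 - ?a = real k / real (Suc k)" by (simp add: field_simps)
      moreover have "real (Suc k) / real n * (real k / real (Suc k)) < height v * (real k / real (Suc k))"
        using Suc.prems(2) False by (intro mult_strict_right_mono) simp_all
      ultimately have "real k / real n < height v2" using v(5) by (simp add: mult.commute)
      then show ?thesis using Suc.IH[OF v(2)] by simp
    qed
    ultimately show ?case using v(3) by (simp add: add_divide_distrib algebra_simps)
  qed
  have ge: "?K * height v \<le> C v" if v: "v \<noteq> 0" for v
  proof (rule ccontr)
    assume "\<not> ?K * height v \<le> C v"
    then have lt: "0 < ?K * height v - C v" by simp
    obtain n :: nat where n: "?K / (?K * height v - C v) < real n" using reals_Archimedean2 by blast
    define m where "m = n + 1"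
    have m: "0 < m" "?K < real m * (?K * height v - C v)" using n lt by (auto simp: m_def field_simps)
    have "0 < height v" using lt nonneg[OF v] height_bounds(1)[of v] by (cases "height v = 0") auto
    then have mp: "0 < real m * height v" using m by simp
    \<comment> \<open>The largest integer strictly below \<open>m * height v\<close>, as
      \<open>low\<close> needs a strict inequality.\<close>
    define k where "k = nat (\<lceil>real m * height v\<rceil> - 1)"
    have "real k = of_int (\<lceil>real m * height v\<rceil> - 1)"
      using mp unfolding k_def by (intro of_nat_nat) linarith
    then have k: "real k < real m * height v" "real m * height v \<le> real k + 1" by linarith+
    then have "real k * ?K / real m \<le> C v" using low[OF m(1) v] m(1) by (simp add: field_simps)
    then have "real k * ?K \<le> real m * C v" using m(1) by (simp add: field_simps)
    moreover have "real m * height v * ?K \<le> (real k + 1) * ?K" using k(2) nonneg[of e3] by (intro mult_right_mono) auto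
    ultimately show False using m(2) by (simp add: algebra_simps)
  qed
  \<comment> \<open>The lower bound at the complement \<open>t\<close> is an upper bound at
    \<open>s\<close>.\<close>
  obtain t where "t \<noteq> 0" "C s + C t = ?K" "height t = 1 - height s" using ex_complement[OF s] by blast
  moreover have "?K * height s + ?K * (1 - height s) = ?K" by (simp add: algebra_simps)
  ultimately show ?thesis using ge[OF s] ge[of t] by simp
qed

text \<open>With the pole at a maximum the error of \<open>bounded_pole_function_symmetrised\<close>
  is 0, so linearity in the height applies.\<close>

lemma maximum_symmetrised:
  assumes f: "frame_function f w" and M: "\<And>v. v \<noteq> 0 \<Longrightarrow> f v \<le> f e3" and v: "v \<noteq> 0"
  shows "f v + f (quarter_turn v) = w - f e3 + (3 * f e3 - w) * height v"
proof -
  have "bounded_pole_function (\<lambda>v. f v + f (quarter_turn v) - (w - f e3)) 0"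
    using bounded_pole_function_symmetrised[OF f M] by simp
  from pole_function_linear[OF this v] show ?thesis by (simp add: algebra_simps)
qed

section \<open>Bounded frame functions are quadratic\<close>

lemma maximum_rotated:
  assumes f: "frame_function f w" and o: "orthonormal3 a b p"
    and M: "\<And>v. v \<noteq> 0 \<Longrightarrow> f v \<le> f p" and u: "u \<noteq> 0"
  shows "f (combination a b p u) + f (combination a b p (quarter_turn u)) = w - f p + (3 * f p - w) * height u"
proof -
  have "combination a b p e3 = p" by (simp add: combination_def)
  then show ?thesis
    using maximum_symmetrised[OF frame_function_combination[OF f o] _ u] M by (simp add: combination_eq_0_iff[OF o])
qed

definition diagonal_form :: "real \<Rightarrow> real \<Rightarrow> real \<Rightarrow> real^3 \<Rightarrow> real" where
  "diagonal_form m \<alpha> M v = (m * (v$1)\<^sup>2 + \<alpha> * (v$2)\<^sup>2 + M * (v$3)\<^sup>2) / (v \<bullet> v)"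

text \<open>The weight is the trace of the form: by \<open>parseval3\<close> the squared cosines
  between a coordinate axis and the members of a frame add up to 1.\<close>

lemma frame_function_diagonal_form: "frame_function (diagonal_form m \<alpha> M) (m + \<alpha> + M)"
  unfolding frame_function_def
proof (intro conjI allI impI)
  fix v :: "real^3" and c :: real assume "c \<noteq> 0"
  moreover have "diagonal_form m \<alpha> M (c *\<^sub>R v) =
    (c\<^sup>2 * (m * (v$1)\<^sup>2 + \<alpha> * (v$2)\<^sup>2 + M * (v$3)\<^sup>2)) / (c\<^sup>2 * (v \<bullet> v))"
    by (simp add: diagonal_form_def power2_eq_square algebra_simps)
  ultimately show "diagonal_form m \<alpha> M (c *\<^sub>R v) = diagonal_form m \<alpha> M v"
    by (simp add: diagonal_form_def)
next
  fix u v t :: "real^3"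
  assume o: "u \<noteq> 0" "v \<noteq> 0" "t \<noteq> 0" "u \<bullet> v = 0" "u \<bullet> t = 0" "v \<bullet> t = 0"
  have "(u$i)\<^sup>2 / (u \<bullet> u) + (v$i)\<^sup>2 / (v \<bullet> v) + (t$i)\<^sup>2 / (t \<bullet> t) = 1" for i
    using parseval3[OF o, of "axis i 1" "axis i 1"]
    by (simp add: inner_axis' inner_axis power2_eq_square)
  from this[of 1] this[of 2] this[of 3]
  have "m * ((u$1)\<^sup>2 / (u \<bullet> u) + (v$1)\<^sup>2 / (v \<bullet> v) + (t$1)\<^sup>2 / (t \<bullet> t))
    + \<alpha> * ((u$2)\<^sup>2 / (u \<bullet> u) + (v$2)\<^sup>2 / (v \<bullet> v) + (t$2)\<^sup>2 / (t \<bullet> t))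
    + M * ((u$3)\<^sup>2 / (u \<bullet> u) + (v$3)\<^sup>2 / (v \<bullet> v) + (t$3)\<^sup>2 / (t \<bullet> t)) = m + \<alpha> + M" by simp
  then show "diagonal_form m \<alpha> M u + diagonal_form m \<alpha> M v + diagonal_form m \<alpha> M t = m + \<alpha> + M"
    unfolding diagonal_form_def by (simp add: add_divide_distrib algebra_simps)
qed

lemma frame_function_diff:
  assumes "frame_function f w" "frame_function g w'"
  shows "frame_function (\<lambda>v. f v - g v) (w - w')"
  using assms unfolding frame_function_def by (simp add: algebra_simps)

lemma frame_function_uminus:
  assumes f: "frame_function f w"
  shows "frame_function (\<lambda>v. - f v) (- w)"
  unfolding frame_function_def
proof (intro conjI allI impI)
  fix u v t :: "real^3"
  assume "u \<noteq> 0" "v \<noteq> 0" "t \<noteq> 0" "u \<bullet> v = 0" "u \<bullet> t = 0" "v \<bullet> t = 0"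
  then show "- f u + - f v + - f t = - w" using frame_function_sum[OF f, of u v t] by simp
qed (simp add: frame_function_scale[OF f])

text \<open>
  By antisymmetry \<open>h\<close> vanishes on the six planes \<open>x = \<plusminus>y\<close>, \<open>y = \<plusminus>z\<close>, \<open>x = \<plusminus>z\<close>. If its maximum at \<open>p\<close> were positive,
  symmetrising about \<open>p\<close> would make \<open>h\<close> positive at every angle \<open>\<theta>\<close> from \<open>p\<close> with \<open>sin\<^sup>2 \<theta> < 1/3\<close>, but
  one of the six planes is at an angle with \<open>sin\<^sup>2 \<theta> \<le> 1/8\<close>.
\<close>

lemma antisymmetric_frame_function_eq_0:
  assumes h: "frame_function h 0" and B: "\<And>v. v \<noteq> 0 \<Longrightarrow> h v \<le> B"
    and H3: "\<And>x y z. vector [x, y, z] \<noteq> (0::real^3) \<Longrightarrow> h (vector [- y, x, z]) = - h (vector [x, y, z])"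
    and H1: "\<And>x y z. vector [x, y, z] \<noteq> (0::real^3) \<Longrightarrow> h (vector [x, - z, y]) = - h (vector [x, y, z])"
    and v: "v \<noteq> 0"
  shows "h v = 0"
proof -
  have nz: "vector [x, y, z] \<noteq> (0::real^3) \<longleftrightarrow> x \<noteq> 0 \<or> y \<noteq> 0 \<or> z \<noteq> 0" for x y z :: real
    by (simp add: vec3_eq_iff)
  have neg: "h (vector [- x, - y, - z]) = h (vector [x, y, z])" for x y z
    using frame_function_scale[OF h, of "-1" "vector [x, y, z]"]
    by (simp add: vec3_eq_iff[of "- vector [x,y,z]" "vector [-x,-y,-z]", simplified])
  \<comment> \<open>In two quarter turns about the third axis the signs cancel; together with
    evenness this gives invariance under the reflection.\<close>
  have s3: "h (vector [x, y, - z]) = h (vector [x, y, z])" if "x \<noteq> 0 \<or> y \<noteq> 0 \<or> z \<noteq> 0" for x y z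
  proof -
    have "h (vector [- y, x, - z]) = - h (vector [x, y, - z])" by (rule H3) (use that in \<open>simp add: nz\<close>)
    moreover have "h (vector [- x, - y, - z]) = - h (vector [- y, x, - z])" by (rule H3) (use that in \<open>auto simp: nz\<close>)
    ultimately show ?thesis using neg[of x y z] by simp
  qed
  have s1: "h (vector [- x, y, z]) = h (vector [x, y, z])" if "x \<noteq> 0 \<or> y \<noteq> 0 \<or> z \<noteq> 0" for x y z
  proof -
    have "h (vector [- x, - z, y]) = - h (vector [- x, y, z])" by (rule H1) (use that in \<open>simp add: nz\<close>)
    moreover have "h (vector [- x, - y, - z]) = - h (vector [- x, - z, y])" by (rule H1) (use that in \<open>auto simp: nz\<close>)
    ultimately show ?thesis using neg[of x y z] by simp
  qed
  have s2: "h (vector [x, - y, z]) = h (vector [x, y, z])" if "x \<noteq> 0 \<or> y \<noteq> 0 \<or> z \<noteq> 0" for x y z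
    using s1[of x "- y" z] s3[of "- x" "- y" z] neg[of x y z] that by simp
  have ab: "h (vector [\<bar>x\<bar>, \<bar>y\<bar>, \<bar>z\<bar>]) = h (vector [x, y, z])" if "x \<noteq> 0 \<or> y \<noteq> 0 \<or> z \<noteq> 0" for x y z
    using that s1[of x] s2[of _ y] s3[of _ _ z] s1[of x "- y"] s1[of x _ "- z"] s2[of _ y "- z"]
    by (auto simp: abs_if s1 s2 s3)
  \<comment> \<open>A transposition is a quarter turn followed by a reflection, so it reverses the
    sign, and \<open>h\<close> vanishes where two coordinates agree.\<close>
  have t12: "h (vector [y, x, z]) = - h (vector [x, y, z])" if "x \<noteq> 0 \<or> y \<noteq> 0 \<or> z \<noteq> 0" for x y z
    using H3[of x y z] s1[of y x z] that by (auto simp: nz)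
  have t23: "h (vector [x, z, y]) = - h (vector [x, y, z])" if "x \<noteq> 0 \<or> y \<noteq> 0 \<or> z \<noteq> 0" for x y z
    using H1[of x y z] s2[of x z y] that by (auto simp: nz)
  have t13: "h (vector [z, y, x]) = - h (vector [x, y, z])" if "x \<noteq> 0 \<or> y \<noteq> 0 \<or> z \<noteq> 0" for x y z
    using t12[of y z x] t23[of y x z] t12[of x y z] that by auto
  obtain q where q: "q \<bullet> q = 1" "\<And>v. v \<noteq> 0 \<Longrightarrow> h v \<le> h q"
    using attains_maximum[OF h B] by blast
  \<comment> \<open>Reflections make all coordinates nonnegative, so only the three planes of equal
    coordinates have to be considered.\<close>
  define a b c where "a = \<bar>q$1\<bar>" and "b = \<bar>q$2\<bar>" and "c = \<bar>q$3\<bar>"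
  define p :: "real^3" where "p = vector [a, b, c]"
  have pp: "a * a + b * b + c * c = 1" using q(1) by (simp add: inner_real3 a_def b_def c_def)
  have abc: "0 \<le> a" "0 \<le> b" "0 \<le> c" "a \<le> 1" "b \<le> 1" "c \<le> 1"
  proof -
    show "0 \<le> a" "0 \<le> b" "0 \<le> c" by (simp_all add: a_def b_def c_def)
    have "a\<^sup>2 \<le> 1\<^sup>2" "b\<^sup>2 \<le> 1\<^sup>2" "c\<^sup>2 \<le> 1\<^sup>2" using pp zero_le_square[of a] zero_le_square[of b] zero_le_square[of c]
      unfolding power2_eq_square by linarith+
    then show "a \<le> 1" "b \<le> 1" "c \<le> 1" by (auto intro: power2_le_imp_le)
  qed
  have "q = vector [q$1, q$2, q$3]" by (simp add: vec3_eq_iff)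
  moreover have "q$1 \<noteq> 0 \<or> q$2 \<noteq> 0 \<or> q$3 \<noteq> 0" using q(1) by (auto simp: inner_real3)
  ultimately have "h p = h q" using ab[of "q$1" "q$2" "q$3"] by (simp add: p_def a_def b_def c_def)
  then have max: "h v \<le> h p" if "v \<noteq> 0" for v using q(2)[OF that] by simp
  have p1: "p \<bullet> p = 1" using pp by (simp add: p_def inner_real3)
  \<comment> \<open>The condition \<open>s \<bullet> p = s \<bullet> s\<close> says that
    \<open>s\<close> is the projection of \<open>p\<close> to the line of \<open>s\<close>, so its
    height about \<open>p\<close> is \<open>s \<bullet> s\<close>. A positive \<open>h p\<close>
    would force this height to be at most 2/3.\<close>
  have key: "h p \<le> 0" if s: "h s = 0" "s \<bullet> p = s \<bullet> s" "7/8 \<le> s \<bullet> s" for s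
  proof -
    obtain x y where o: "orthonormal3 x y p" using ex_orthonormal3_last[OF p1] .
    obtain u where u: "s = combination x y p u" using combination_surj[OF o] .
    have "u$3 = s \<bullet> p" "u \<bullet> u = s \<bullet> s" unfolding u by (simp_all add: inner_combination_basis[OF o] inner_combination[OF o])
    then have hu: "height u = s \<bullet> s" using s(2) by (simp add: height_def power2_eq_square)
    have u0: "u \<noteq> 0" using s(3) u combination_eq_0_iff[OF o, of u] by auto
    have "h s + h (combination x y p (quarter_turn u)) = - h p + 3 * h p * (s \<bullet> s)"
      using maximum_rotated[OF h o max u0] hu u by simp
    moreover have "h (combination x y p (quarter_turn u)) \<le> h p" using u0 by (intro max) (simp add: combination_eq_0_iff[OF o])
    ultimately have "3 * h p * (s \<bullet> s) \<le> 2 * h p" using s(1) by simp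
    show "h p \<le> 0"
    proof (rule ccontr)
      assume "\<not> h p \<le> 0"
      then have "h p * (7/8) \<le> h p * (s \<bullet> s)" using s(3) by (intro mult_left_mono) auto
      then show False using \<open>3 * h p * (s \<bullet> s) \<le> 2 * h p\<close> \<open>\<not> h p \<le> 0\<close> by simp
    qed
  qed
  have sq: "(x + y) / 2 * ((x + y) / 2) + (x + y) / 2 * ((x + y) / 2) = x * x + y * y - (x - y)\<^sup>2 / 2" for x y :: real
    by (simp add: power2_eq_square field_simps)
  have small: "(x - y)\<^sup>2 / 2 \<le> 1/8" if "\<bar>x - y\<bar> \<le> 1/2" for x y :: real
  proof -
    have "\<bar>x - y\<bar>\<^sup>2 \<le> (1/2)\<^sup>2" by (rule power_mono[OF that]) simp
    then show ?thesis by (simp add: power2_eq_square)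
  qed
  have "h p \<le> 0"
  proof -
    \<comment> \<open>Of three numbers in [0, 1] two differ by at most 1/2; averaging them projects
      \<open>p\<close> onto the corresponding plane, with squared length at least
      \<open>1 - 1/8\<close>.\<close>
    consider "\<bar>a - b\<bar> \<le> 1/2" | "\<bar>b - c\<bar> \<le> 1/2" | "\<bar>a - c\<bar> \<le> 1/2"
      using abc by linarith
    then show ?thesis
    proof cases
      case 1
      let ?s = "vector [(a + b) / 2, (a + b) / 2, c] :: real^3"
      have ss: "?s \<bullet> ?s = 1 - (a - b)\<^sup>2 / 2" unfolding inner_real3 vector_3 using sq[of a b] pp by linarith
      have sp: "?s \<bullet> p = ?s \<bullet> ?s" unfolding ss using pp by (simp add: inner_real3 p_def power2_eq_square field_simps)
      have ge: "7/8 \<le> ?s \<bullet> ?s" unfolding ss using small[OF 1] by simp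
      then have "?s \<noteq> 0" by force
      then show ?thesis using t12[of "(a + b) / 2" "(a + b) / 2" c] by (intro key[of ?s] sp ge) (auto simp: nz)
    next
      case 2
      let ?s = "vector [a, (b + c) / 2, (b + c) / 2] :: real^3"
      have ss: "?s \<bullet> ?s = 1 - (b - c)\<^sup>2 / 2" unfolding inner_real3 vector_3 using sq[of b c] pp by linarith
      have sp: "?s \<bullet> p = ?s \<bullet> ?s" unfolding ss using pp by (simp add: inner_real3 p_def power2_eq_square field_simps)
      have ge: "7/8 \<le> ?s \<bullet> ?s" unfolding ss using small[OF 2] by simp
      then have "?s \<noteq> 0" by force
      then show ?thesis using t23[of a "(b + c) / 2" "(b + c) / 2"] by (intro key[of ?s] sp ge) (auto simp: nz)
    next
      case 3
      let ?s = "vector [(a + c) / 2, b, (a + c) / 2] :: real^3"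
      have ss: "?s \<bullet> ?s = 1 - (a - c)\<^sup>2 / 2" unfolding inner_real3 vector_3 using sq[of a c] pp by linarith
      have sp: "?s \<bullet> p = ?s \<bullet> ?s" unfolding ss using pp by (simp add: inner_real3 p_def power2_eq_square field_simps)
      have ge: "7/8 \<le> ?s \<bullet> ?s" unfolding ss using small[OF 3] by simp
      then have "?s \<noteq> 0" by force
      then show ?thesis using t13[of "(a + c) / 2" b "(a + c) / 2"] by (intro key[of ?s] sp ge) (auto simp: nz)
    qed
  qed
  then have le: "h v \<le> 0" if "v \<noteq> 0" for v using max[OF that] by simp
  have "vector [v$1, v$2, v$3] = v" by (simp add: vec3_eq_iff)
  then have "h (vector [- v$2, v$1, v$3]) = - h v" using H3[of "v$1" "v$2" "v$3"] v by simp
  moreover have "vector [- v$2, v$1, v$3] \<noteq> (0::real^3)" using v by (auto simp: vec3_eq_iff)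
  ultimately show ?thesis using le[OF v] le[of "vector [- v$2, v$1, v$3]"] by simp
qed

text \<open>\<open>Q\<close> has the weight of \<open>f\<close> and the same values at
  \<open>e3\<close> and on the first axis, so it satisfies the same identities for quarter turns
  about these axes as \<open>f\<close>; for the first axis they come from the maximum of
  \<open>- f\<close>.\<close>

lemma diagonal_of_extrema:
  assumes f: "frame_function f w"
    and M: "\<And>v. v \<noteq> 0 \<Longrightarrow> f v \<le> f e3" and m: "\<And>v. v \<noteq> 0 \<Longrightarrow> f (vector [1,0,0]) \<le> f v"
    and v: "v \<noteq> 0"
  shows "f v = diagonal_form (f (vector [1,0,0])) (w - f (vector [1,0,0]) - f e3) (f e3) v"
proof -
  let ?e1 = "vector [1,0,0] :: real^3" and ?e2 = "vector [0,1,0] :: real^3"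
  define Q where "Q = diagonal_form (f ?e1) (w - f ?e1 - f e3) (f e3)"
  define h where "h = (\<lambda>v. f v - Q v)"
  have "frame_function Q w"
    using frame_function_diagonal_form[of "f ?e1" "w - f ?e1 - f e3" "f e3"] by (simp add: Q_def)
  then have h: "frame_function h 0" using frame_function_diff[OF f, of Q w] by (simp add: h_def)
  have Qd: "Q (vector [x, y, z]) = (f ?e1 * x\<^sup>2 + (w - f ?e1 - f e3) * y\<^sup>2 + f e3 * z\<^sup>2) / (x\<^sup>2 + y\<^sup>2 + z\<^sup>2)" for x y z
    by (simp add: Q_def diagonal_form_def inner_real3 power2_eq_square)
  have pos: "x\<^sup>2 + y\<^sup>2 + z\<^sup>2 \<noteq> 0" if "vector [x, y, z] \<noteq> (0::real^3)" for x y z :: real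
    using that by (auto simp: vec3_eq_iff add_nonneg_eq_0_iff)
  \<comment> \<open>This cyclic order makes the first axis the pole, so that
    \<open>quarter_turn\<close> becomes a rotation about it.\<close>
  have o: "orthonormal3 ?e2 e3 ?e1" by (simp add: orthonormal3_def inner_real3)
  have H3: "h (vector [- y, x, z]) = - h (vector [x, y, z])" if "vector [x, y, z] \<noteq> (0::real^3)" for x y z
  proof -
    have "f (vector [x, y, z]) + f (vector [- y, x, z]) = w - f e3 + (3 * f e3 - w) * z\<^sup>2 / (x\<^sup>2 + y\<^sup>2 + z\<^sup>2)"
      using maximum_symmetrised[OF f M that] by (simp add: quarter_turn_def height_def inner_real3 power2_eq_square)
    also have "\<dots> = Q (vector [x, y, z]) + Q (vector [- y, x, z])"
      unfolding Qd using pos[OF that] by (simp add: divide_simps add.commute) (simp add: algebra_simps)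
    finally show ?thesis by (simp add: h_def)
  qed
  have H1: "h (vector [x, - z, y]) = - h (vector [x, y, z])" if "vector [x, y, z] \<noteq> (0::real^3)" for x y z
  proof -
    have r: "combination ?e2 e3 ?e1 (vector [y, z, x]) = vector [x, y, z]"
      "combination ?e2 e3 ?e1 (quarter_turn (vector [y, z, x])) = vector [x, - z, y]"
      by (simp_all add: combination_def quarter_turn_def vec3_eq_iff)
    have "vector [y, z, x] \<noteq> (0::real^3)" using that by (auto simp: vec3_eq_iff)
    then have "- f (vector [x, y, z]) - f (vector [x, - z, y]) = - w + f ?e1 + (w - 3 * f ?e1) * x\<^sup>2 / (x\<^sup>2 + y\<^sup>2 + z\<^sup>2)"
      using maximum_rotated[OF frame_function_uminus[OF f] o _, of "vector [y, z, x]"] m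
      unfolding r by (simp add: height_def inner_real3 power2_eq_square add_ac)
    also have "\<dots> = - Q (vector [x, y, z]) - Q (vector [x, - z, y])"
      unfolding Qd using pos[OF that] by (simp add: divide_simps add_ac) (simp add: algebra_simps)
    finally show ?thesis by (simp add: h_def)
  qed
  have "h v \<le> f e3 + (\<bar>f ?e1\<bar> + \<bar>w - f ?e1 - f e3\<bar> + \<bar>f e3\<bar>)" if "v \<noteq> 0" for v
  proof -
    have vv: "0 < v \<bullet> v" using that by simp
    have "(v$i)\<^sup>2 / (v \<bullet> v) \<le> 1" for i
      using vv component_le_norm_cart[of v i] by (simp add: dot_square_norm abs_le_square_iff[symmetric])
    then have "\<bar>c * (v$i)\<^sup>2 / (v \<bullet> v)\<bar> \<le> \<bar>c\<bar>" for c i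
      using vv by (simp add: abs_mult mult_left_le flip: times_divide_eq_right)
    from this[of "f ?e1" 1] this[of "w - f ?e1 - f e3" 2] this[of "f e3" 3]
    have "- Q v \<le> \<bar>f ?e1\<bar> + \<bar>w - f ?e1 - f e3\<bar> + \<bar>f e3\<bar>"
      unfolding Q_def diagonal_form_def add_divide_distrib by linarith
    then show ?thesis using M[OF that] by (simp add: h_def)
  qed
  from antisymmetric_frame_function_eq_0[OF h this H3 H1 v] show ?thesis by (simp add: h_def Q_def)
qed

text \<open>A minimum \<open>r\<close> need not be orthogonal to \<open>p\<close>. In the plane of
  \<open>p\<close> and \<open>r\<close>, with \<open>e\<close> orthogonal to \<open>p\<close> and
  \<open>?c\<close> orthogonal to \<open>r\<close>, one has \<open>f r + f ?c = f p + f e\<close>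
  and \<open>f ?c \<le> f p\<close>; hence \<open>e\<close> is a minimum too.\<close>

theorem bounded_frame_function_diagonal:
  assumes f: "frame_function f w" and B: "\<And>v. v \<noteq> 0 \<Longrightarrow> b \<le> f v"
    and p: "p \<bullet> p = 1" and M: "\<And>v. v \<noteq> 0 \<Longrightarrow> f v \<le> f p"
  obtains a b m \<alpha> where "orthonormal3 a b p" "\<And>u. u \<noteq> 0 \<Longrightarrow> f (combination a b p u) = diagonal_form m \<alpha> (f p) u"
proof -
  have "\<exists>e. e \<bullet> e = 1 \<and> p \<bullet> e = 0 \<and> (\<forall>v. v \<noteq> 0 \<longrightarrow> f e \<le> f v)"
  proof -
    obtain r where r: "r \<bullet> r = 1" "\<And>v. v \<noteq> 0 \<Longrightarrow> f r \<le> f v"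
      using attains_maximum[OF frame_function_uminus[OF f], of "- b"] B by auto
    define e0 where "e0 = r - (r \<bullet> p) *\<^sub>R p"
    obtain e1 where e1: "e1 \<bullet> e1 = 1" "p \<bullet> e1 = 0" by (rule ex_orthogonal_unit3)
    \<comment> \<open>If \<open>r\<close> is parallel to \<open>p\<close>, any unit vector
      orthogonal to \<open>p\<close> will do.\<close>
    define e where "e = (if e0 = 0 then e1 else e0 /\<^sub>R norm e0)"
    have e: "e \<bullet> e = 1" "p \<bullet> e = 0"
      using e1 p by (auto simp: e_def e0_def inner_diff_right inner_commute dot_square_norm power2_eq_square)
    have re: "r = (r \<bullet> p) *\<^sub>R p + (if e0 = 0 then 0 else norm e0) *\<^sub>R e" 
      by (simp add: e_def e0_def)
    obtain \<gamma> \<beta> where re: "r = \<gamma> *\<^sub>R p + \<beta> *\<^sub>R e" using re by blast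
    have nz: "p \<noteq> 0" "e \<noteq> 0" using p e by auto
    have "\<gamma> \<noteq> 0 \<or> \<beta> \<noteq> 0" using re r(1) by auto
    note frame_function_circle[OF f nz e(2) this]
    moreover have "(- \<beta> * (e \<bullet> e)) *\<^sub>R p + (\<gamma> * (p \<bullet> p)) *\<^sub>R e \<noteq> 0" (is "?c \<noteq> 0")
    proof
      assume "?c = 0"
      then have "?c \<bullet> p = 0" "?c \<bullet> e = 0" by simp_all
      then have "\<beta> = 0" "\<gamma> = 0" using e p by (simp_all add: inner_diff_left inner_commute[of e p])
      then show False using \<open>\<gamma> \<noteq> 0 \<or> \<beta> \<noteq> 0\<close> by simp
    qed
    ultimately have "f e \<le> f r" using M re by fastforce
    then show ?thesis using e r(2) by (meson order_trans)
  qed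
  then obtain e where e: "e \<bullet> e = 1" "p \<bullet> e = 0" "\<And>v. v \<noteq> 0 \<Longrightarrow> f e \<le> f v" by blast
  have o: "orthonormal3 e (cross3 p e) p"
    using orthonormal3_extend[OF p e(1,2)] by (auto simp: orthonormal3_def inner_commute)
  let ?g = "\<lambda>v. f (combination e (cross3 p e) p v)"
  have ep: "combination e (cross3 p e) p e3 = p" "combination e (cross3 p e) p (vector [1,0,0]) = e" by (simp_all add: combination_def)
  have "?g u = diagonal_form (f e) (w - f e - f p) (f p) u" if "u \<noteq> 0" for u
    using diagonal_of_extrema[OF frame_function_combination[OF f o] _ _ that] M e(3)
    by (simp add: ep combination_eq_0_iff[OF o])
  then show ?thesis using that o by blast
qed

section \<open>Gleason's theorem\<close>

lemma cinner_add_right: "cinner x (y + z) = cinner x y + cinner x z"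
  and cinner_add_left: "cinner (x + y) z = cinner x z + cinner y z"
  and cinner_diff_right: "cinner x (y - z) = cinner x y - cinner x z"
  and cinner_scale_right: "cinner x (c *s y) = c * cinner x y"
  and cinner_scale_left: "cinner (c *s x) y = cnj c * cinner x y"
  and cinner_zero_left: "cinner 0 y = 0"
  and cinner_zero_right: "cinner x 0 = 0"
  by (simp_all add: cinner_def algebra_simps sum.distrib sum_subtractf sum_distrib_left)

lemma cnj_cinner: "cnj (cinner x y) = cinner y x"
  by (simp add: cinner_def mult.commute)

lemma scaleR_eq_vector_scalar_mult: "r *\<^sub>R (x :: complex^'n) = of_real r *s x"
  by (simp add: vec_eq_iff complex_eq_iff)

lemma cinner_scaleR_right: "cinner x (r *\<^sub>R y) = of_real r * cinner x y"
  by (simp add: scaleR_eq_vector_scalar_mult cinner_scale_right)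

lemma operator_scaleR:
  fixes A B :: "'n::finite operator"
  shows "(r *\<^sub>R A) *v x = r *\<^sub>R (A *v x)" "A *v (r *\<^sub>R x) = r *\<^sub>R (A *v x)"
    "(r *\<^sub>R A) ** B = r *\<^sub>R (A ** B)" "A ** (r *\<^sub>R B) = r *\<^sub>R (A ** B)"
  by (simp_all add: vec_eq_iff matrix_vector_mult_def matrix_matrix_mult_def scaleR_sum_right)

lemma Re_cinner: "Re (cinner x y) = x \<bullet> y"
  by (simp add: cinner_def inner_vec_def inner_complex_def)

lemma cinner_self: "cinner x x = of_real (x \<bullet> x)"
  by (auto simp: complex_eq_iff Re_cinner) (metis cnj_cinner complex_cnj_cancel_iff Reals_cnj_iff complex_is_Real_iff)

lemma norm_vector_scalar_mult: "norm (c *s (x::complex^'n)) = norm c * norm x"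
  by (simp add: norm_vec_def norm_mult L2_set_def power_mult_distrib real_sqrt_mult flip: sum_distrib_left)

lemma inner_vector_scalar_mult: "(c *s (x::complex^'n)) \<bullet> (c *s x) = (norm c)\<^sup>2 * (x \<bullet> x)"
  by (simp add: dot_square_norm norm_vector_scalar_mult power_mult_distrib)

lemma adjoint_op_add: "adjoint_op (A + B) = adjoint_op A + adjoint_op B"
  and adjoint_op_diff: "adjoint_op (A - B) = adjoint_op A - adjoint_op B"
  and adjoint_op_mat: "adjoint_op (mat 1) = mat 1"
  and adjoint_op_zero: "adjoint_op 0 = 0"
  and adjoint_op_mult: "adjoint_op (A ** B) = adjoint_op B ** adjoint_op A"
  by (auto simp: adjoint_op_def vec_eq_iff mat_def matrix_matrix_mult_def mult.commute)

lemma cinner_adjoint_op: "cinner (adjoint_op A *v x) y = cinner x (A *v y)"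
proof -
  have "cinner (adjoint_op A *v x) y = (\<Sum>i\<in>UNIV. \<Sum>j\<in>UNIV. A $ j $ i * cnj (x $ j) * y $ i)"
    by (simp add: cinner_def matrix_vector_mult_def adjoint_op_def sum_distrib_right)
  also have "\<dots> = (\<Sum>j\<in>UNIV. \<Sum>i\<in>UNIV. A $ j $ i * cnj (x $ j) * y $ i)" by (rule sum.swap)
  also have "\<dots> = cinner x (A *v y)"
    by (simp add: cinner_def matrix_vector_mult_def sum_distrib_left mult_ac)
  finally show ?thesis .
qed

lemma matrix_vector_mult_vector_scalar: "(A :: 'n::finite operator) *v (c *s x) = c *s (A *v x)"
  by (simp add: vec_eq_iff matrix_vector_mult_def sum_distrib_left mult_ac)

lemma trace_scaleR: "trace (r *\<^sub>R A) = r *\<^sub>R trace (A :: 'n::finite operator)"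
  by (simp add: trace_def scaleR_sum_right)

lemma trace_eq_sum_cinner: "trace (A :: 'n::finite operator) = (\<Sum>i\<in>UNIV. cinner (axis i 1) (A *v axis i 1))"
  by (simp add: trace_def cinner_def matrix_vector_mult_def axis_def if_distrib if_distribR cong: if_cong)

lemma Proj_self_adjoint: "P \<in> Proj \<Longrightarrow> cinner (P *v x) y = cinner x (P *v y)"
  by (metis (mono_tags, lifting) Proj_def cinner_adjoint_op mem_Collect_eq)

lemma Proj_idem: "P \<in> Proj \<Longrightarrow> P ** P = P" "P \<in> Proj \<Longrightarrow> P *v (P *v x) = P *v x"
  by (simp_all add: Proj_def matrix_vector_mul_assoc)

lemma Proj_zero: "0 \<in> Proj" and Proj_one: "mat 1 \<in> Proj"
  by (simp_all add: Proj_def adjoint_op_mat adjoint_op_zero)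

lemma Proj_orthogonal_commute:
  assumes "P \<in> Proj" "Q \<in> Proj" "P ** Q = 0"
  shows "Q ** P = 0"
  by (metis (mono_tags, lifting) Proj_def adjoint_op_mult adjoint_op_zero assms mem_Collect_eq)

lemma matrix_plus_rdistrib: "(B + C) ** (A :: 'n::finite operator) = B ** A + C ** A"
  by (simp add: vec_eq_iff matrix_matrix_mult_def algebra_simps sum.distrib)

lemma matrix_diff_ldistrib: "(A :: 'n::finite operator) ** (B - C) = A ** B - A ** C"
  and matrix_diff_rdistrib: "(B - C) ** (A :: 'n::finite operator) = B ** A - C ** A"
  by (simp_all add: vec_eq_iff matrix_matrix_mult_def algebra_simps sum_subtractf)

lemma Proj_add:
  assumes "P \<in> Proj" "Q \<in> Proj" "P ** Q = 0"
  shows "P + Q \<in> Proj"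
  using assms Proj_orthogonal_commute[OF assms]
  by (simp add: Proj_def adjoint_op_add matrix_add_ldistrib matrix_plus_rdistrib)

lemma Proj_diff:
  assumes "P \<in> Proj" "Q \<in> Proj" "P ** Q = Q"
  shows "P - Q \<in> Proj" "(P - Q) ** Q = 0"
proof -
  have "Q ** P = Q" using assms by (metis (mono_tags, lifting) Proj_def adjoint_op_mult mem_Collect_eq)
  then show "P - Q \<in> Proj" "(P - Q) ** Q = 0" using assms
    by (simp_all add: Proj_def adjoint_op_diff matrix_diff_ldistrib matrix_diff_rdistrib)
qed

lemma Proj_complement: "P \<in> Proj \<Longrightarrow> mat 1 - P \<in> Proj"
  by (simp add: Proj_diff Proj_one)

lemma Proj_positive: "P \<in> Proj \<Longrightarrow> positive_op P"
  unfolding positive_op_def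
  by (metis Proj_idem(2) Proj_self_adjoint cinner_self inner_ge_zero nonneg_Reals_of_real_iff)

lemma positive_op_trace: "positive_op A \<Longrightarrow> trace A \<in> \<real>\<^sub>\<ge>\<^sub>0"
  by (simp add: trace_eq_sum_cinner positive_op_def complex_nonneg_Reals_iff Re_sum Im_sum sum_nonneg)

text \<open>Orthogonal projector onto the line of \<open>x\<close>, scale invariant without
  normalisation; it is 0 for \<open>x = 0\<close>.\<close>

definition ray :: "complex^'n::finite \<Rightarrow> 'n operator" where
  "ray x = (\<chi> i j. x $ i * cnj (x $ j) / of_real (x \<bullet> x))"

lemma ray_mult: "ray x *v y = (cinner x y / of_real (x \<bullet> x)) *s x"
  by (simp add: ray_def vec_eq_iff matrix_vector_mult_def cinner_def sum_distrib_left sum_divide_distrib mult_ac)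

lemma ray_mult_self: "ray x *v x = x"
  by (cases "x = 0") (simp_all add: ray_mult cinner_self)

lemma ray_scale:
  assumes "c \<noteq> 0"
  shows "ray (c *s x) = ray x"
proof -
  have "complex_of_real ((c *s x) \<bullet> (c *s x)) = (c * cnj c) * of_real (x \<bullet> x)"
    by (simp only: inner_vector_scalar_mult of_real_mult complex_norm_square)
  then show ?thesis using assms by (simp add: ray_def vec_eq_iff)
qed

lemma mult_ray: "A ** ray x = (\<chi> i j. (A *v x) $ i * cnj (x $ j) / of_real (x \<bullet> x))"
  by (simp add: vec_eq_iff ray_def matrix_matrix_mult_def matrix_vector_mult_def sum_distrib_left sum_divide_distrib mult_ac)

lemma ray_orthogonal: "cinner x y = 0 \<Longrightarrow> ray x ** ray y = 0"
  by (simp add: mult_ray ray_mult vec_eq_iff)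

lemma Proj_ray: "P *v x = x \<Longrightarrow> P ** ray x = ray x"
  by (simp add: mult_ray) (simp add: ray_def)

lemma ray_Proj: "ray x \<in> Proj"
  using Proj_ray[OF ray_mult_self, of x]
  by (simp add: Proj_def) (simp add: adjoint_op_def ray_def vec_eq_iff mult.commute)

lemma trace_mult_ray: "trace (A ** ray x) = cinner x (A *v x) / of_real (x \<bullet> x)"
  by (simp add: mult_ray trace_def cinner_def sum_divide_distrib mult.commute)

lemma trace_ray: "x \<noteq> 0 \<Longrightarrow> trace (ray x) = 1"
  using trace_mult_ray[of "mat 1" x] by (simp add: cinner_self)

lemma ex_range_vector:
  assumes "P \<in> Proj" "P \<noteq> 0"
  obtains x where "norm x = 1" "P *v x = x"
proof -
  obtain y where y: "P *v y \<noteq> 0" using assms(2) by (metis matrix_eq matrix_vector_mult_0)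
  let ?x = "P *v y /\<^sub>R norm (P *v y)"
  have "P *v ?x = ?x" using Proj_idem(2)[OF assms(1)]
    by (simp add: scaleR_eq_vector_scalar_mult matrix_vector_mult_vector_scalar)
  then show ?thesis using that[of ?x] y by simp
qed

text \<open>The projector onto the plane of \<open>x\<close> and \<open>y\<close> has trace 2, so
  its complement has nonzero trace and fixes a unit vector.\<close>

lemma ex_orthogonal_unit:
  fixes x y :: "complex^'n::finite"
  assumes n: "3 \<le> CARD('n)" and xy: "x \<noteq> 0" "y \<noteq> 0" "cinner x y = 0"
  obtains z where "norm z = 1" "cinner x z = 0" "cinner y z = 0"
proof -
  define Q where "Q = ray x + ray y"
  have Q: "Q \<in> Proj" unfolding Q_def by (intro Proj_add ray_Proj ray_orthogonal xy)
  have "trace (mat 1 - Q) = of_nat CARD('n) - 2" using xy by (simp add: Q_def trace_sub trace_add trace_I trace_ray)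
  also have "\<dots> \<noteq> 0"
  proof -
    have "real CARD('n) - 2 \<noteq> 0" using n by linarith
    then show ?thesis by (simp add: complex_eq_iff)
  qed
  finally have "mat 1 - Q \<noteq> 0" by (auto simp: trace_def)
  then obtain z where z: "norm z = 1" "(mat 1 - Q) *v z = z" 
    using ex_range_vector Proj_complement[OF Q] by blast
  have "Q *v z = 0" using z(2) by (simp add: matrix_vector_mult_diff_rdistrib)
  moreover have "cinner x (Q *v z) = cinner x z" "cinner y (Q *v z) = cinner y z"
    using xy cnj_cinner[of x y]
    by (simp_all add: Q_def matrix_vector_mult_add_rdistrib ray_mult cinner_add_right cinner_scale_right cinner_self)
  ultimately show ?thesis using that[OF z(1)] by (simp add: cinner_zero_right)
qed

section \<open>Measures on projectors\<close>

locale projector_measure =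
  fixes \<mu> :: "'n::finite operator \<Rightarrow> real"
  assumes dim: "3 \<le> CARD('n)"
    and nonneg: "P \<in> Proj \<Longrightarrow> 0 \<le> \<mu> P"
    and additive: "P \<in> Proj \<Longrightarrow> Q \<in> Proj \<Longrightarrow> P ** Q = 0 \<Longrightarrow> \<mu> (P + Q) = \<mu> P + \<mu> Q"
begin

abbreviation total :: real where "total \<equiv> \<mu> (mat 1)"

definition \<omega> :: "complex^'n \<Rightarrow> real" where "\<omega> x = \<mu> (ray x)"

lemma omega_nonneg: "0 \<le> \<omega> x"
  by (simp add: \<omega>_def nonneg ray_Proj)

lemma omega_le: "\<omega> x \<le> total"
proof -
  have "(mat 1 - ray x) ** ray x = 0" using Proj_diff(2)[OF Proj_one ray_Proj, of x] by simp
  then show ?thesis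
    using additive[of "mat 1 - ray x" "ray x"] nonneg[of "mat 1 - ray x"]
    by (simp add: \<omega>_def Proj_complement ray_Proj)
qed

lemma omega_scale: "c \<noteq> 0 \<Longrightarrow> \<omega> (c *s x) = \<omega> x"
  by (simp add: \<omega>_def ray_scale)

lemma omega_orthogonal_triple:
  assumes "cinner x y = 0" "cinner x z = 0" "cinner y z = 0"
  shows "\<omega> x + \<omega> y + \<omega> z = \<mu> (ray x + ray y + ray z)"
proof -
  have "ray x ** ray y = 0" "(ray x + ray y) ** ray z = 0"
    using assms by (simp_all add: ray_orthogonal matrix_plus_rdistrib)
  then show ?thesis by (simp add: \<omega>_def additive Proj_add ray_Proj)
qed

text \<open>Inner products of real combinations are real, so a real frame stays orthogonal over the
  complex numbers. Its rays always sum to the same operator \<open>S\<close>, so the weight does not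
  depend on the frame.\<close>

lemma frame_function_totally_real:
  assumes o: "orthonormal3 x y z" and c: "cinner x y = 0" "cinner x z = 0" "cinner y z = 0"
  shows "\<exists>w. frame_function (\<lambda>a. \<omega> (combination x y z a)) w"
proof -
  let ?R = "combination x y z"
  have cR: "cinner (?R a) (?R b) = of_real (a \<bullet> b)" for a b
  proof -
    have "cinner x x = 1" "cinner y y = 1" "cinner z z = 1" "cinner y x = 0" "cinner z x = 0" "cinner z y = 0"
      using o c cnj_cinner[of x y] cnj_cinner[of x z] cnj_cinner[of y z] by (simp_all add: orthonormal3_def cinner_self)
    then show ?thesis using c
      by (simp add: combination_def scaleR_eq_vector_scalar_mult cinner_add_left cinner_add_right
          cinner_scale_left cinner_scale_right inner_real3)
  qed
  have RR: "?R a \<bullet> ?R b = a \<bullet> b" for a b by (rule inner_combination[OF o])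
  define S :: "'n operator" where "S = (\<chi> i j. x$i * cnj (x$j) + y$i * cnj (y$j) + z$i * cnj (z$j))"
  have sumS: "ray (?R a) + ray (?R b) + ray (?R c) = S"
    if "a \<noteq> 0" "b \<noteq> 0" "c \<noteq> 0" "a \<bullet> b = 0" "a \<bullet> c = 0" "b \<bullet> c = 0" for a b c
  proof -
    \<comment> \<open>The entries of a ray are bilinear in the rows of real and imaginary parts, so
      \<open>parseval3\<close> evaluates the four sums involved.\<close>
    define re im :: "'n \<Rightarrow> real^3" where "re = (\<lambda>i. vector [Re (x$i), Re (y$i), Re (z$i)])"
      and "im = (\<lambda>i. vector [Im (x$i), Im (y$i), Im (z$i)])"
    have comp: "?R v $ i = Complex (re i \<bullet> v) (im i \<bullet> v)" for v i
      by (simp add: combination_def re_def im_def inner_real3 complex_eq_iff mult.commute)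
    have ent: "ray (?R v) $ i $ j = Complex ((re i \<bullet> v) * (re j \<bullet> v) / (v \<bullet> v) + (im i \<bullet> v) * (im j \<bullet> v) / (v \<bullet> v))
        ((im i \<bullet> v) * (re j \<bullet> v) / (v \<bullet> v) - (re i \<bullet> v) * (im j \<bullet> v) / (v \<bullet> v))" for v i j
      by (simp add: ray_def RR comp complex_eq_iff add_divide_distrib diff_divide_distrib)
    note p = parseval3[OF that, symmetric]
    have "(ray (?R a) + ray (?R b) + ray (?R c)) $ i $ j = S $ i $ j" for i j
    proof -
      have "(ray (?R a) + ray (?R b) + ray (?R c)) $ i $ j =
        Complex (re i \<bullet> re j + im i \<bullet> im j) (im i \<bullet> re j - re i \<bullet> im j)"
        using p[of "re i" "re j"] p[of "im i" "im j"] p[of "im i" "re j"] p[of "re i" "im j"]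
        by (simp add: ent complex_eq_iff)
      also have "\<dots> = S $ i $ j"
        by (simp add: S_def re_def im_def inner_real3 complex_eq_iff)
      finally show ?thesis .
    qed
    then show ?thesis by (simp add: vec_eq_iff)
  qed
  have "frame_function (\<lambda>a. \<omega> (?R a)) (\<mu> S)"
    unfolding frame_function_def
  proof (intro conjI allI impI)
    fix v and k :: real assume "k \<noteq> 0"
    moreover have "?R (k *\<^sub>R v) = of_real k *s ?R v"
      unfolding scaleR_eq_vector_scalar_mult[symmetric] by (simp add: combination_def algebra_simps)
    ultimately show "\<omega> (?R (k *\<^sub>R v)) = \<omega> (?R v)" by (simp add: omega_scale)
  next
    fix a b c :: "real^3"
    assume a: "a \<noteq> 0" "b \<noteq> 0" "c \<noteq> 0" "a \<bullet> b = 0" "a \<bullet> c = 0" "b \<bullet> c = 0"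
    show "\<omega> (?R a) + \<omega> (?R b) + \<omega> (?R c) = \<mu> S"
      using omega_orthogonal_triple[of "?R a" "?R b" "?R c"] a sumS[OF a] by (simp add: cR)
  qed
  then show ?thesis by blast
qed

text \<open>The auxiliary \<open>z\<close> completes the pair to a totally real triple; this is
  where dimension at least 3 enters. On that triple \<omega> is a quadratic form, and
  \<open>B\<close> is its off-diagonal entry for \<open>x\<close> and \<open>y\<close>.\<close>

lemma omega_real_plane:
  assumes x: "norm x = 1" "norm y = 1" "cinner x y = 0"
  obtains B where "\<And>\<alpha> \<beta>. \<omega> (\<alpha> *\<^sub>R x + \<beta> *\<^sub>R y) * (\<alpha>\<^sup>2 + \<beta>\<^sup>2) = \<omega> x * \<alpha>\<^sup>2 + 2 * B * \<alpha> * \<beta> + \<omega> y * \<beta>\<^sup>2"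
proof -
  have nz: "x \<noteq> 0" "y \<noteq> 0" using x by auto
  obtain z where z: "norm z = 1" "cinner x z = 0" "cinner y z = 0"
    using ex_orthogonal_unit[OF dim nz x(3)] .
  have o: "orthonormal3 x y z"
    using x z by (simp add: orthonormal3_def dot_square_norm flip: Re_cinner)
  obtain w where fr: "frame_function (\<lambda>a. \<omega> (combination x y z a)) w"
    using frame_function_totally_real[OF o x(3) z(2,3)] by blast
  let ?g = "\<lambda>a. \<omega> (combination x y z a)"
  obtain p where p: "p \<bullet> p = 1" "\<And>v. v \<noteq> 0 \<Longrightarrow> ?g v \<le> ?g p"
    using attains_maximum[OF fr omega_le] by blast
  obtain a b m \<gamma> where ab: "orthonormal3 a b p" "\<And>u. u \<noteq> 0 \<Longrightarrow> ?g (combination a b p u) = diagonal_form m \<gamma> (?g p) u"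
    using bounded_frame_function_diagonal[OF fr omega_nonneg p] by blast
  have q: "?g v * (v \<bullet> v) = m * (v \<bullet> a)\<^sup>2 + \<gamma> * (v \<bullet> b)\<^sup>2 + ?g p * (v \<bullet> p)\<^sup>2" for v
  proof (cases "v = 0")
    case False
    obtain u where u: "v = combination a b p u" using combination_surj[OF ab(1)] .
    then have "u \<noteq> 0" using False combination_eq_0_iff[OF ab(1)] by auto
    then show ?thesis using ab(2) unfolding u
      by (simp add: inner_combination_basis[OF ab(1)] inner_combination[OF ab(1)] diagonal_form_def)
  qed simp
  let ?B = "m * a$1 * a$2 + \<gamma> * b$1 * b$2 + ?g p * p$1 * p$2"
  show ?thesis
  proof (rule that[of ?B])
    fix \<alpha> \<beta> :: real
    have r: "combination x y z (vector [s, t, 0]) = s *\<^sub>R x + t *\<^sub>R y" for s t by (simp add: combination_def)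
    have s: "\<omega> (s *\<^sub>R x + t *\<^sub>R y) * (s\<^sup>2 + t\<^sup>2) =
       m * (s * a$1 + t * a$2)\<^sup>2 + \<gamma> * (s * b$1 + t * b$2)\<^sup>2 + ?g p * (s * p$1 + t * p$2)\<^sup>2" for s t
      using q[of "vector [s, t, 0]"] by (simp add: r inner_real3 power2_eq_square)
    show "\<omega> (\<alpha> *\<^sub>R x + \<beta> *\<^sub>R y) * (\<alpha>\<^sup>2 + \<beta>\<^sup>2) = \<omega> x * \<alpha>\<^sup>2 + 2 * ?B * \<alpha> * \<beta> + \<omega> y * \<beta>\<^sup>2"
      using s[of \<alpha> \<beta>] s[of 1 0] s[of 0 1] by (simp add: power2_eq_square algebra_simps)
  qed
qed

text \<open>The value 1 at 0 keeps phases invertible, so zero coefficients need no separate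
  case.\<close>

definition phase :: "complex \<Rightarrow> complex" where "phase a = (if a = 0 then 1 else sgn a)"

lemma phase: "norm (phase a) = 1" "a = of_real (norm a) * phase a" "phase a \<noteq> 0"
  by (auto simp: phase_def norm_sgn sgn_eq norm_divide)

text \<open>Once a common phase is removed, the vector has real coefficients over \<open>x\<close>
  and a rephased \<open>y\<close>; hence real planes suffice for complex combinations.\<close>

lemma omega_plane_phase: "\<omega> (a *s x + b *s y) = \<omega> (norm a *\<^sub>R x + norm b *\<^sub>R ((phase b / phase a) *s y))"
proof -
  have "a *s x + b *s y = phase a *s (norm a *\<^sub>R x + norm b *\<^sub>R ((phase b / phase a) *s y))"
    using phase[of a] phase(2)[of b]
    by (simp add: scaleR_eq_vector_scalar_mult vec_eq_iff algebra_simps)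
  then show ?thesis using omega_scale phase(3) by metis
qed

lemma phase_quotient:
  assumes "norm y = 1" "cinner x y = 0"
  shows "norm ((phase b / phase a) *s y) = 1" "cinner x ((phase b / phase a) *s y) = 0"
    "\<omega> ((phase b / phase a) *s y) = \<omega> y"
  using assms phase by (simp_all add: norm_vector_scalar_mult norm_divide cinner_scale_right omega_scale)

text \<open>In the real plane through \<open>p\<close> and the normalised part of \<open>v\<close>
  orthogonal to it, the difference of values is a term quadratic in \<open>norm z\<close> plus a
  cross term. They are bounded by \<open>total * norm z\<close> and
  \<open>2 * total * norm z\<close>, hence the constant 3.\<close>

lemma omega_Lipschitz:
  assumes p: "norm p = 1" "norm v = 1"
  shows "\<bar>\<omega> v - \<omega> p\<bar> \<le> 3 * total * norm (v - p)"
proof -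
  have total: "0 \<le> total" by (rule nonneg[OF Proj_one])
  define a where "a = cinner p v"
  define z where "z = v - a *s p"
  have pz: "cinner p z = 0" using p by (simp add: z_def a_def cinner_diff_right cinner_scale_right cinner_self dot_square_norm)
  have pyth: "(norm (z + c *s p))\<^sup>2 = (norm z)\<^sup>2 + (norm c)\<^sup>2" for c
  proof -
    have "p \<bullet> z = 0" "(c *s p) \<bullet> z = 0" using pz by (simp_all add: cinner_scale_left flip: Re_cinner)
    then show ?thesis using p(1) norm_add_Pythagorean[of z "c *s p"]
      by (simp add: orthogonal_def inner_commute norm_vector_scalar_mult)
  qed
  have zle: "norm z \<le> norm (v - p)"
  proof -
    have eq: "v - p = z + (a - 1) *s p" by (simp add: z_def vec_eq_iff algebra_simps)
    have "(norm z)\<^sup>2 \<le> (norm (v - p))\<^sup>2" unfolding eq pyth by simp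
    then show ?thesis by (rule power2_le_imp_le) simp
  qed
  have nv: "(norm a)\<^sup>2 + (norm z)\<^sup>2 = 1"
    using pyth[of a] p(2) by (simp add: z_def add.commute)
  show ?thesis
  proof (cases "z = 0")
    case True
    then have "v = a *s p" by (simp add: z_def)
    moreover have "a \<noteq> 0" using nv True by auto
    ultimately show ?thesis using omega_scale total by simp
  next
    case False
    define y where "y = z /\<^sub>R norm z"
    have y: "norm y = 1" "cinner p y = 0"
      using False pz by (simp_all add: y_def cinner_scaleR_right)
    define y' where "y' = (phase (of_real (norm z)) / phase a) *s y"
    have y': "norm y' = 1" "cinner p y' = 0" unfolding y'_def by (rule phase_quotient[OF y])+
    obtain B where B: "\<And>\<alpha> \<beta>. \<omega> (\<alpha> *\<^sub>R p + \<beta> *\<^sub>R y') * (\<alpha>\<^sup>2 + \<beta>\<^sup>2) = \<omega> p * \<alpha>\<^sup>2 + 2 * B * \<alpha> * \<beta> + \<omega> y' * \<beta>\<^sup>2"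
      using omega_real_plane[OF p(1) y'] by blast
    \<comment> \<open>At \<open>\<alpha> = \<beta> = 1\<close> the identity expresses
      \<open>2 * B\<close> through three values in \<open>[0, total]\<close>.\<close>
    have Bb: "\<bar>B\<bar> \<le> total"
      using B[of 1 1] omega_le[of "1 *\<^sub>R p + 1 *\<^sub>R y'"] omega_nonneg[of "1 *\<^sub>R p + 1 *\<^sub>R y'"] omega_le[of p] omega_le[of y'] omega_nonneg[of p] omega_nonneg[of y']
      by simp
    have "v = a *s p + of_real (norm z) *s y"
      using False by (simp add: z_def y_def flip: scaleR_eq_vector_scalar_mult)
    then have "\<omega> v = \<omega> (norm a *\<^sub>R p + norm z *\<^sub>R y')"
      using omega_plane_phase[of a p "of_real (norm z)" y] by (simp add: y'_def)
    then have "\<omega> v = \<omega> p * (norm a)\<^sup>2 + 2 * B * norm a * norm z + \<omega> y' * (norm z)\<^sup>2"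
      using B[of "norm a" "norm z"] nv by simp
    also have "(norm a)\<^sup>2 = 1 - (norm z)\<^sup>2" using nv by simp
    finally have "\<omega> v - \<omega> p = (\<omega> y' - \<omega> p) * (norm z)\<^sup>2 + 2 * B * norm a * norm z" by (simp add: algebra_simps)
    moreover have "\<bar>(\<omega> y' - \<omega> p) * (norm z)\<^sup>2\<bar> \<le> total * norm z"
    proof -
      have "\<bar>\<omega> y' - \<omega> p\<bar> \<le> total" using omega_le[of p] omega_le[of y'] omega_nonneg[of p] omega_nonneg[of y'] by simp
      moreover have "(norm z)\<^sup>2 \<le> norm z"
      proof -
        have "(norm z)\<^sup>2 \<le> 1\<^sup>2" using nv zero_le_power2[of "norm a"] unfolding power_one by linarith
        then have "norm z \<le> 1" by (rule power2_le_imp_le) simp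
        then show ?thesis by (simp add: power2_eq_square mult_left_le)
      qed
      ultimately show ?thesis using total by (simp add: abs_mult mult_mono)
    qed
    moreover have "\<bar>2 * B * norm a * norm z\<bar> \<le> 2 * total * norm z"
    proof -
      have "(norm a)\<^sup>2 \<le> 1\<^sup>2" using nv zero_le_power2[of "norm z"] unfolding power_one by linarith
      then have "norm a \<le> 1" by (rule power2_le_imp_le) simp
      then have "\<bar>B\<bar> * norm a \<le> total * 1" using Bb total by (intro mult_mono) auto
      then have "\<bar>B\<bar> * norm a * norm z \<le> total * 1 * norm z" by (rule mult_right_mono) simp
      then show ?thesis by (simp add: abs_mult)
    qed
    ultimately have "\<bar>\<omega> v - \<omega> p\<bar> \<le> 3 * total * norm z" by linarith
    also have "\<dots> \<le> 3 * total * norm (v - p)" using zle total by (intro mult_left_mono) auto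
    finally show ?thesis .
  qed
qed

lemma continuous_on_omega: "continuous_on (sphere 0 1) \<omega>"
  by (rule lipschitz_on_continuous_on[of "3 * total"])
     (use omega_Lipschitz nonneg[OF Proj_one] in \<open>auto simp: lipschitz_on_def dist_norm\<close>)

text \<open>A cross term would be a first-order increase at \<open>x\<close>: maximality bounds
  \<open>2 * B * \<alpha>\<close> above for all real \<alpha>, so \<open>B\<close> vanishes.\<close>

lemma omega_at_maximum:
  assumes x: "norm x = 1" "norm y = 1" "cinner x y = 0"
    and max: "\<And>a b. \<omega> (a *s x + b *s y) \<le> \<omega> x"
  shows "\<omega> (a *s x + b *s y) * ((norm a)\<^sup>2 + (norm b)\<^sup>2) = \<omega> x * (norm a)\<^sup>2 + \<omega> y * (norm b)\<^sup>2"
proof -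
  define y' where "y' = (phase b / phase a) *s y"
  have y': "norm y' = 1" "cinner x y' = 0" "\<omega> y' = \<omega> y" unfolding y'_def by (rule phase_quotient[OF x(2,3)])+
  obtain B where B: "\<And>\<alpha> \<beta>. \<omega> (\<alpha> *\<^sub>R x + \<beta> *\<^sub>R y') * (\<alpha>\<^sup>2 + \<beta>\<^sup>2) = \<omega> x * \<alpha>\<^sup>2 + 2 * B * \<alpha> * \<beta> + \<omega> y' * \<beta>\<^sup>2"
    using omega_real_plane[OF x(1) y'(1,2)] by blast
  have le: "2 * B * \<alpha> \<le> \<omega> x - \<omega> y" for \<alpha>
  proof -
    have "\<alpha> *\<^sub>R x + 1 *\<^sub>R y' = of_real \<alpha> *s x + (phase b / phase a) *s y"
      by (simp add: y'_def scaleR_eq_vector_scalar_mult)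
    then have "\<omega> (\<alpha> *\<^sub>R x + 1 *\<^sub>R y') \<le> \<omega> x" using max by metis
    then have "\<omega> (\<alpha> *\<^sub>R x + 1 *\<^sub>R y') * (\<alpha>\<^sup>2 + 1\<^sup>2) \<le> \<omega> x * (\<alpha>\<^sup>2 + 1\<^sup>2)" by (rule mult_right_mono) simp
    then show ?thesis unfolding B using y'(3) by (simp add: algebra_simps)
  qed
  have "B = 0"
  proof (rule ccontr)
    assume "B \<noteq> 0"
    then show False using le[of "(\<omega> x - \<omega> y + 1) / (2 * B)"] by simp
  qed
  then show ?thesis using B[of "norm a" "norm b"] omega_plane_phase[of a x b y] y'(3) by (simp add: y'_def)
qed

text \<open>
  In the eigenbasis of the density operator, the first vector is a line of maximal measure, along
  which the quadratic form has no cross terms; it is split off and the rest is treated recursively.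
\<close>

lemma ex_density_on_range:
  assumes "P \<in> Proj" "Re (trace P) < real n"
  shows "\<exists>\<rho>. positive_op \<rho> \<and> \<rho> ** P = \<rho> \<and> P ** \<rho> = \<rho> \<and>
    (\<forall>v. v \<noteq> 0 \<longrightarrow> P *v v = v \<longrightarrow> \<omega> v * (v \<bullet> v) = Re (cinner v (\<rho> *v v)))"
  using assms
proof (induction n arbitrary: P)
  \<comment> \<open>A projector has nonnegative trace, so the strict bound is contradictory.\<close>
  case 0
  then show ?case using positive_op_trace[OF Proj_positive[OF 0(1)]] by (simp add: complex_nonneg_Reals_iff)
next
  case (Suc n)
  show ?case
  proof (cases "P = 0")
    case True
    then show ?thesis by (intro exI[of _ 0]) (auto simp: positive_op_def cinner_zero_right)
  next
    case False
    let ?S = "{v. norm v = 1 \<and> P *v v = v}"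
    have "compact ?S"
    proof -
      have "closed {v. P *v v = v}"
        by (intro closed_Collect_eq continuous_intros linear_continuous_on matrix_vector_mul_bounded_linear)
      then have "compact (sphere 0 1 \<inter> {v. P *v v = v})" by (intro compact_Int_closed) auto
      then show ?thesis by (simp add: sphere_def Collect_conj_eq[symmetric] Int_def)
    qed
    moreover have "?S \<noteq> {}" using ex_range_vector[OF Suc.prems(1) False] by blast
    moreover have "continuous_on ?S \<omega>" by (rule continuous_on_subset[OF continuous_on_omega]) auto
    ultimately obtain x where x: "norm x = 1" "P *v x = x" "\<And>v. norm v = 1 \<Longrightarrow> P *v v = v \<Longrightarrow> \<omega> v \<le> \<omega> x"
      using continuous_attains_sup[of ?S \<omega>] by blast
    have x0: "x \<noteq> 0" using x(1) by auto
    \<comment> \<open>Scaling, and the value 0 at the zero vector, extend maximality to the whole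
      range of \<open>P\<close>, as \<open>omega_at_maximum\<close> demands.\<close>
    have omega_max: "\<omega> v \<le> \<omega> x" if "P *v v = v" for v
    proof (cases "v = 0")
      case True
      have "\<omega> (0 :: complex^'n) = 0"
        using additive[OF Proj_zero Proj_zero] by (simp add: \<omega>_def ray_def zero_vec_def[symmetric])
      then show ?thesis using True omega_nonneg by simp
    next
      case False
      have "P *v (v /\<^sub>R norm v) = v /\<^sub>R norm v"
        by (simp add: scaleR_eq_vector_scalar_mult matrix_vector_mult_vector_scalar that)
      then have "\<omega> (v /\<^sub>R norm v) \<le> \<omega> x" using False by (intro x(3)) simp_all
      then show ?thesis using False by (simp add: scaleR_eq_vector_scalar_mult omega_scale)
    qed
    define Q where "Q = P - ray x"
    have Q: "Q \<in> Proj" unfolding Q_def by (rule Proj_diff[OF Suc.prems(1) ray_Proj Proj_ray[OF x(2)]])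
    have "Re (trace Q) < real n" using Suc.prems(2) by (simp add: Q_def trace_sub trace_ray[OF x0])
    from Suc.IH[OF Q this] obtain \<sigma> where \<sigma>: "positive_op \<sigma>" "\<sigma> ** Q = \<sigma>" "Q ** \<sigma> = \<sigma>"
      "\<And>v. v \<noteq> 0 \<Longrightarrow> Q *v v = v \<Longrightarrow> \<omega> v * (v \<bullet> v) = Re (cinner v (\<sigma> *v v))" by blast
    have PR: "P ** ray x = ray x" by (rule Proj_ray[OF x(2)])
    have RP: "ray x ** P = ray x"
      using PR Suc.prems(1) ray_Proj[of x] by (metis (mono_tags, lifting) Proj_def adjoint_op_mult mem_Collect_eq)
    have PQ: "P ** Q = Q" "Q ** P = Q"
      using PR RP Proj_idem(1)[OF Suc.prems(1)] by (simp_all add: Q_def matrix_diff_ldistrib matrix_diff_rdistrib)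
    define \<rho> where "\<rho> = \<omega> x *\<^sub>R ray x + \<sigma>"
    have xx: "x \<bullet> x = 1" using x(1) by (simp add: dot_square_norm)
    have \<rho>v: "cinner v (\<rho> *v v) = of_real (\<omega> x * (norm (cinner x v))\<^sup>2) + cinner v (\<sigma> *v v)" for v
    proof -
      have "\<rho> *v v = (of_real (\<omega> x) * cinner x v) *s x + \<sigma> *v v"
        by (simp add: \<rho>_def matrix_vector_mult_add_rdistrib operator_scaleR ray_mult xx scaleR_eq_vector_scalar_mult)
      moreover have "cinner x v * cinner v x = of_real ((norm (cinner x v))\<^sup>2)"
        by (simp only: complex_norm_square cnj_cinner)
      ultimately show ?thesis by (simp add: cinner_add_right cinner_scale_right mult.assoc)
    qed
    show ?thesis
    proof (intro exI[of _ \<rho>] conjI allI impI)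
      show "positive_op \<rho>"
        unfolding positive_op_def \<rho>v
      proof
        fix v
        have "cinner v (\<sigma> *v v) \<in> \<real>\<^sub>\<ge>\<^sub>0" using \<sigma>(1) by (simp add: positive_op_def)
        then show "of_real (\<omega> x * (norm (cinner x v))\<^sup>2) + cinner v (\<sigma> *v v) \<in> \<real>\<^sub>\<ge>\<^sub>0"
          using omega_nonneg[of x] by (intro nonneg_Reals_add_I) (simp_all only: nonneg_Reals_of_real_iff, simp)
      qed
      have "\<sigma> ** P = \<sigma>" "P ** \<sigma> = \<sigma>"
        using \<sigma>(2,3) PQ by (metis matrix_mul_assoc)+
      then show "\<rho> ** P = \<rho>" "P ** \<rho> = \<rho>"
        by (simp_all add: \<rho>_def matrix_add_ldistrib matrix_plus_rdistrib RP PR operator_scaleR)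
    next
      fix v assume v: "v \<noteq> 0" "P *v v = v"
      define a where "a = cinner x v"
      define z where "z = v - a *s x"
      have Qv: "Q *v v = z" using v(2) by (simp add: Q_def z_def a_def matrix_vector_mult_diff_rdistrib ray_mult xx)
      have Qz: "Q *v z = z" using Proj_idem(2)[OF Q, of v] Qv by simp
      have xz: "cinner x z = 0" by (simp add: z_def a_def cinner_diff_right cinner_scale_right cinner_self xx)
      \<comment> \<open>\<open>\<sigma>\<close> lives on the range of \<open>Q\<close>, so it sees
        only the part \<open>z\<close> of \<open>v\<close> orthogonal to \<open>x\<close>.\<close>
      have "\<sigma> *v v = \<sigma> *v z" "Q *v (\<sigma> *v z) = \<sigma> *v z"
        using \<sigma>(2,3) Qv by (metis matrix_vector_mul_assoc)+
      then have sv: "cinner v (\<sigma> *v v) = cinner z (\<sigma> *v z)"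
        using Proj_self_adjoint[OF Q, of v "\<sigma> *v z"] Qv by simp
      have vd: "v = a *s x + z" by (simp add: z_def)
      show "\<omega> v * (v \<bullet> v) = Re (cinner v (\<rho> *v v))"
      proof (cases "z = 0")
        case True
        then have "a \<noteq> 0" "v = a *s x" using v(1) vd by auto
        then show ?thesis unfolding \<rho>v sv a_def[symmetric] using True
          by (simp add: omega_scale inner_vector_scalar_mult xx cinner_zero_left)
      next
        case False
        define y where "y = z /\<^sub>R norm z"
        have y: "norm y = 1" "cinner x y = 0"
          using False xz by (simp_all add: y_def cinner_scaleR_right)
        have zy: "z = of_real (norm z) *s y" using False by (simp add: y_def flip: scaleR_eq_vector_scalar_mult)
        have "P *v z = z" by (metis Qz PQ(1) matrix_vector_mul_assoc)
        then have "P *v y = y" by (simp add: y_def scaleR_eq_vector_scalar_mult matrix_vector_mult_vector_scalar)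
        then have "\<omega> (c *s x + d *s y) \<le> \<omega> x" for c d
          using x(2) by (intro omega_max) (simp add: matrix_vector_right_distrib matrix_vector_mult_vector_scalar)
        from omega_at_maximum[OF x(1) y this, of a "of_real (norm z)"]
        have "\<omega> v * ((norm a)\<^sup>2 + (norm z)\<^sup>2) = \<omega> x * (norm a)\<^sup>2 + \<omega> y * (norm z)\<^sup>2"
          using vd zy by simp
        moreover have "v \<bullet> v = (norm a)\<^sup>2 + (norm z)\<^sup>2"
        proof -
          have "orthogonal (a *s x) z"
            using xz unfolding orthogonal_def by (simp add: cinner_scale_left flip: Re_cinner)
          then show ?thesis using norm_add_Pythagorean[of "a *s x" z] vd x(1)
            by (simp add: dot_square_norm norm_vector_scalar_mult)
        qed
        moreover have "\<omega> y = \<omega> z" using False by (simp add: y_def scaleR_eq_vector_scalar_mult omega_scale)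
        then have "\<omega> y * (norm z)\<^sup>2 = Re (cinner z (\<sigma> *v z))"
          using \<sigma>(4)[OF False Qz] by (simp add: dot_square_norm)
        ultimately show ?thesis unfolding \<rho>v sv a_def[symmetric] by simp
      qed
    qed
  qed
qed

text \<open>The operator is determined on rays; splitting off the ray of a fixed unit vector lowers
  the trace by 1, and additivity carries the formula to every projector.\<close>

theorem gleason: "\<exists>\<rho>. positive_op \<rho> \<and> (\<forall>P\<in>Proj. \<mu> P = Re (trace (\<rho> ** P)))"
proof -
  obtain n :: nat where "Re (trace (mat 1 :: 'n operator)) < real n" using reals_Archimedean2 by blast
  from ex_density_on_range[OF Proj_one this]
  obtain \<rho> where \<rho>: "positive_op \<rho>" "\<And>v. v \<noteq> 0 \<Longrightarrow> \<omega> v * (v \<bullet> v) = Re (cinner v (\<rho> *v v))" by auto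
  have "\<mu> P = Re (trace (\<rho> ** P))" if "P \<in> Proj" "Re (trace P) < real k" for P k
    using that
  proof (induction k arbitrary: P)
    case 0
    then show ?case using positive_op_trace[OF Proj_positive[OF 0(1)]] by (simp add: complex_nonneg_Reals_iff)
  next
    case (Suc k)
    show ?case
    proof (cases "P = 0")
      case True
      then show ?thesis using additive[OF Proj_zero Proj_zero] by (simp add: trace_def)
    next
      case False
      obtain x where x: "norm x = 1" "P *v x = x" using ex_range_vector[OF Suc.prems(1) False] .
      have x0: "x \<noteq> 0" using x(1) by auto
      note Q = Proj_diff[OF Suc.prems(1) ray_Proj Proj_ray[OF x(2)]]
      have "Re (trace (P - ray x)) < real k" using Suc.prems(2) by (simp add: trace_sub trace_ray[OF x0])
      then have "\<mu> (P - ray x) = Re (trace (\<rho> ** (P - ray x)))" using Suc.IH Q(1) by blast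
      moreover have "\<mu> P = \<mu> (P - ray x) + \<mu> (ray x)" using additive[OF Q(1) ray_Proj Q(2)] by simp
      moreover have "\<mu> (ray x) = Re (trace (\<rho> ** ray x))"
        using \<rho>(2)[OF x0] x(1) by (simp add: \<omega>_def trace_mult_ray dot_square_norm)
      ultimately show ?thesis by (simp add: matrix_diff_ldistrib trace_sub)
    qed
  qed
  then show ?thesis using \<rho>(1) reals_Archimedean2 by blast
qed

end

section \<open>States\<close>

text \<open>By cyclicity this is the trace of the positive operator
  \<open>P ** (\<rho> ** P)\<close>.\<close>

lemma trace_Proj_nonneg:
  assumes "positive_op \<rho>" "P \<in> Proj"
  shows "0 \<le> Re (trace (\<rho> ** P))"
proof -
  have "positive_op (P ** (\<rho> ** P))"
    using assms unfolding positive_op_def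
    by (simp flip: matrix_vector_mul_assoc Proj_self_adjoint[OF assms(2)])
  moreover have "trace (P ** (\<rho> ** P)) = trace (\<rho> ** P)"
    using trace_mul_sym[of P "\<rho> ** P"] Proj_idem(1)[OF assms(2)] by (simp flip: matrix_mul_assoc)
  ultimately show ?thesis using positive_op_trace by (metis complex_nonneg_Reals_iff)
qed

text \<open>Polarisation: the vectors \<open>x + y\<close> and \<open>x + i y\<close> together
  isolate the mixed terms.\<close>

lemma operator_eqI:
  fixes A B :: "'n::finite operator"
  assumes "\<And>x. cinner x (A *v x) = cinner x (B *v x)"
  shows "A = B"
proof -
  define D where "D = A - B"
  have D: "cinner x (D *v x) = 0" for x
    by (simp add: D_def matrix_vector_mult_diff_rdistrib cinner_diff_right assms)
  have "cinner x (D *v y) = 0" for x y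
  proof -
    have "cinner x (D *v y) + cinner y (D *v x) = 0"
      using D[of "x + y"] D[of x] D[of y]
      by (simp add: matrix_vector_right_distrib cinner_add_left cinner_add_right add.commute)
    moreover have "\<i> * cinner x (D *v y) - \<i> * cinner y (D *v x) = 0"
      using D[of "x + \<i> *s y"] D[of x] D[of y]
      by (simp add: matrix_vector_right_distrib matrix_vector_mult_vector_scalar cinner_add_left cinner_add_right
          cinner_scale_left cinner_scale_right)
    ultimately show ?thesis by (simp add: complex_eq_iff)
  qed
  then have "D *v y = 0" for y using cinner_self[of "D *v y"] by simp
  then have "D = 0" by (simp add: matrix_eq)
  then show ?thesis by (simp add: D_def)
qed

text \<open>For \<open>y\<close> in the range of \<open>P a\<close>, the squared norms of all
  \<open>P c *v y\<close> add up to that of \<open>y\<close>, and the term \<open>c = a\<close>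
  alone exhausts the sum.\<close>

lemma resolution_orthogonal:
  assumes A: "finite A" "\<And>a. a \<in> A \<Longrightarrow> P a \<in> Proj" "(\<Sum>a\<in>A. P a) = mat 1"
    and ab: "a \<in> A" "b \<in> A" "a \<noteq> b"
  shows "P b ** P a = 0"
proof -
  have sumv: "(\<Sum>c\<in>B. P c) *v y = (\<Sum>c\<in>B. P c *v y)" if "finite B" for B y
    using that by (induction B rule: finite_induct) (simp_all add: matrix_vector_mult_add_rdistrib)
  have "P b *v (P a *v x) = 0" for x
  proof -
    define y where "y = P a *v x"
    have y: "P a *v y = y" using Proj_idem(2)[OF A(2)[OF ab(1)]] by (simp add: y_def)
    have sq: "y \<bullet> (P c *v y) = (P c *v y) \<bullet> (P c *v y)" if "c \<in> A" for c
      using Proj_self_adjoint[OF A(2)[OF that], of y "P c *v y"] Proj_idem(2)[OF A(2)[OF that], of y]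
      by (metis Re_cinner Proj_self_adjoint A(2) that)
    have "y \<bullet> y = y \<bullet> ((\<Sum>c\<in>A. P c) *v y)" by (simp add: A(3))
    also have "\<dots> = (\<Sum>c\<in>A. (P c *v y) \<bullet> (P c *v y))"
      unfolding sumv[OF A(1)] inner_sum_right by (intro sum.cong HOL.refl sq)
    also have "\<dots> = y \<bullet> y + (\<Sum>c\<in>A - {a}. (P c *v y) \<bullet> (P c *v y))"
      using A(1) ab(1) y by (simp add: sum.remove[of A a])
    finally have "(\<Sum>c\<in>A - {a}. (P c *v y) \<bullet> (P c *v y)) = 0" by simp
    then have "(P b *v y) \<bullet> (P b *v y) = 0"
      using A(1) ab by (subst (asm) sum_nonneg_eq_0_iff) auto
    then show ?thesis by (simp add: y_def)
  qed
  then show ?thesis by (simp add: matrix_eq flip: matrix_vector_mul_assoc)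
qed

text \<open>Makes sums over fibres, and hence \<open>pushforward\<close>, stay within
  projectors.\<close>

lemma resolution_sum_Proj:
  assumes A: "finite A" "\<And>a. a \<in> A \<Longrightarrow> P a \<in> Proj" "(\<Sum>a\<in>A. P a) = mat 1"
    and B: "B \<subseteq> A"
  shows "(\<Sum>b\<in>B. P b) \<in> Proj"
proof -
  have "finite B" using A(1) B finite_subset by blast
  then show ?thesis using B
  proof (induction B rule: finite_induct)
    case empty
    then show ?case by (simp add: Proj_zero)
  next
    case (insert b B)
    have "P b ** (\<Sum>c\<in>C. P c) = (\<Sum>c\<in>C. P b ** P c)" if "finite C" for C
      using that by (induction C rule: finite_induct) (simp_all add: matrix_add_ldistrib)
    then have "P b ** (\<Sum>c\<in>B. P c) = 0"
      using insert resolution_orthogonal[OF A, of _ b] by (simp add: subset_iff) (metis (no_types, lifting) sum.neutral)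
    then show ?case using insert A(2) by (simp add: Proj_add)
  qed
qed

section \<open>Simplices of the measurement set and of its subobject\<close>

lemma cells_nerve_Z3 [simp]: "cells nerve_Z3 n = {k. length k = n}"
  by (simp add: nerve_Z3_def)

lemma finite_cells_nerve_Z3: "finite {k :: 3 list. length k = n}"
  using finite_lists_length_eq[of "UNIV :: 3 set" n] by simp

lemma cells_measurements:
  "cells (measurements nerve_Z3) n =
    {\<pi> \<in> {k. length k = n} \<rightarrow>\<^sub>E Proj. (\<Sum>k | length k = n. \<pi> k) = mat 1}"
  by (simp add: measurements_def)

lemma pushforward_cells:
  assumes "\<pi> \<in> cells (measurements nerve_Z3) n" and "\<And>k. length k = n \<Longrightarrow> length (\<theta> k) = m"
  shows "pushforward {k. length k = n} {k. length k = m} \<theta> \<pi> \<in> cells (measurements nerve_Z3) m"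
proof -
  have \<pi>: "\<And>k. k \<in> {k. length k = n} \<Longrightarrow> \<pi> k \<in> Proj" "(\<Sum>k | length k = n. \<pi> k) = mat 1"
    using assms(1) by (auto simp: cells_measurements)
  have "(\<Sum>y | length y = m. \<Sum>x\<in>{x \<in> {k. length k = n}. \<theta> x = y}. \<pi> x) = (\<Sum>k | length k = n. \<pi> k)"
    by (rule sum.group) (use finite_cells_nerve_Z3 assms(2) in auto)
  moreover have "(\<Sum>x\<in>{x \<in> {k. length k = n}. \<theta> x = y}. \<pi> x) \<in> Proj" for y
    by (rule resolution_sum_Proj[OF finite_cells_nerve_Z3 \<pi>]) auto
  ultimately show ?thesis using \<pi>(2) by (auto simp: cells_measurements pushforward_def)
qed

lemma three_eq_zero: "(3::3) = 0"
  by simp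

lemma exhaust_Z3: "(a::3) = 0 \<or> a = 1 \<or> a = 2"
  using exhaust_3[of a] three_eq_zero by auto

text \<open>
  The pairs \<open>(a, b)\<close> allowed in \<open>X\<^sub>2\<close> are exactly those with this property, and unlike membership in \<open>X\<^sub>2\<close>
  it makes sense, and is preserved by all faces and degeneracies, in every dimension.
\<close>

definition admissible :: "3 list \<Rightarrow> bool" where
  "admissible k \<longleftrightarrow> filter (\<lambda>a. a \<noteq> 0) k \<in> {[], [1], [2], [2, 2]}"

lemma admissible_face:
  assumes "admissible k" "length k = Suc n" "i \<le> Suc n"
  shows "admissible (nerve_face (Suc n) i k)"
proof -
  consider "i = 0" | "i = Suc n" | "0 < i" "i < Suc n" using assms(3) by linarith
  then show ?thesis
  proof cases
    case 1
    obtain a k' where "k = a # k'" using assms(2) by (cases k) auto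
    then show ?thesis using 1 assms(1) by (auto simp: nerve_face_def admissible_def split: if_splits)
  next
    case 2
    obtain a k' where "k = k' @ [a]" using assms(2) by (cases k rule: rev_cases) auto
    then show ?thesis using 2 assms(1) by (auto simp: nerve_face_def admissible_def append_eq_Cons_conv split: if_splits)
  next
    case 3
    define u v where "u = take (i - 1) k" and "v = drop (Suc i) k"
    have "k = take (i - 1) k @ k ! (i - 1) # k ! i # drop (Suc i) k"
      using 3 assms(2) by (metis Cons_nth_drop_Suc One_nat_def Suc_pred append_take_drop_id less_Suc_eq less_imp_diff_less)
    then obtain a b where k: "k = u @ a # b # v" and ab: "a = k ! (i - 1)" "b = k ! i" unfolding u_def v_def by blast
    have f: "nerve_face (Suc n) i k = u @ (a + b) # v"
      using 3 by (simp add: nerve_face_def ab u_def v_def)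
    show ?thesis
    proof (cases "a = 0 \<or> b = 0")
      case True
      then show ?thesis using assms(1) unfolding admissible_def f by (subst (asm) k) auto
    next
      case False
      \<comment> \<open>Only \<open>[2, 2]\<close> has two nonzero entries, and
        \<open>2 + 2 = 1\<close> in Z/3 keeps the result admissible.\<close>
      then have "filter (\<lambda>a. a \<noteq> 0) u = []" "filter (\<lambda>a. a \<noteq> 0) v = []" "a = 2" "b = 2"
        using assms(1) unfolding admissible_def
        by (subst (asm) k; auto simp: append_eq_Cons_conv)+
      then show ?thesis unfolding admissible_def f by simp
    qed
  qed
qed

lemma admissible_degen: "admissible k \<Longrightarrow> admissible (nerve_degen n i k)"
  unfolding admissible_def nerve_degen_def
  by (metis (mono_tags, lifting) append_Cons append_Nil append_take_drop_id filter.simps(2) filter_append)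

text \<open>Measurements supported on admissible tuples are closed under faces and degeneracies and
  lie in \<open>X_trunc\<close>, so they belong to \<open>Z_cyc\<close>. This suffices to identify
  its cells in dimensions 1 and 2.\<close>

definition admissible_cells :: "nat \<Rightarrow> (3 list \<Rightarrow> two_qutrits operator) set" where
  "admissible_cells n = {\<pi> \<in> cells Y_cyc n. \<forall>k. length k = n \<longrightarrow> \<pi> k \<noteq> 0 \<longrightarrow> admissible k}"

lemma pushforward_admissible:
  assumes \<pi>: "\<pi> \<in> admissible_cells n"
    and len: "\<And>k. length k = n \<Longrightarrow> length (\<theta> k) = m"
    and adm: "\<And>k. length k = n \<Longrightarrow> admissible k \<Longrightarrow> admissible (\<theta> k)"
  shows "pushforward {k. length k = n} {k. length k = m} \<theta> \<pi> \<in> admissible_cells m"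
proof -
  have "admissible y" if y: "length y = m" "(\<Sum>x\<in>{x \<in> {k. length k = n}. \<theta> x = y}. \<pi> x) \<noteq> 0" for y
  proof -
    obtain x where "x \<in> {x \<in> {k. length k = n}. \<theta> x = y}" "\<pi> x \<noteq> 0"
      using y(2) by (meson sum.neutral)
    then show ?thesis using \<pi> adm by (auto simp: admissible_cells_def)
  qed
  then show ?thesis using pushforward_cells[OF _ len, of \<pi>] \<pi>
    by (simp add: admissible_cells_def pushforward_def)
qed

lemma sub_simplex_admissible:
  assumes "sub_simplex Y_cyc n \<sigma> m \<sigma>'" "\<sigma> \<in> admissible_cells n"
  shows "\<sigma>' \<in> admissible_cells m"
  using assms
proof (induction rule: sub_simplex.induct)
  case (face m x i)
  then have "x \<in> admissible_cells (Suc m)" by simp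
  then have "pushforward {k. length k = Suc m} {k. length k = m} (nerve_face (Suc m) i) x \<in> admissible_cells m"
    by (rule pushforward_admissible) (use face(2) length_nerve_face admissible_face in blast)+
  then show ?case by (simp add: measurements_def nerve_Z3_def)
next
  case (degen m x i)
  then have "x \<in> admissible_cells m" by simp
  then have "pushforward {k. length k = m} {k. length k = Suc m} (nerve_degen m i) x \<in> admissible_cells (Suc m)"
    by (rule pushforward_admissible) (use degen(2) admissible_degen in \<open>auto simp: nerve_degen_def\<close>)
  then show ?case by (simp add: measurements_def nerve_Z3_def)
qed

lemma admissible_cells_X_trunc: "\<sigma> \<in> admissible_cells m \<Longrightarrow> \<sigma> \<in> X_trunc m"
proof -
  assume \<sigma>: "\<sigma> \<in> admissible_cells m"
  have "\<sigma> k = 0" if "m = 2" "length k = 2" "\<not> admissible k" for k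
    using \<sigma> that by (auto simp: admissible_cells_def)
  then have "\<sigma> [1, 1] = 0 \<and> \<sigma> [2, 1] = 0 \<and> \<sigma> [1, 2] = 0" if "m = 2"
    using that by (simp add: admissible_def)
  then show ?thesis using \<sigma> by (auto simp: admissible_cells_def X_trunc_def)
qed

lemma admissible_cells_Z: "\<sigma> \<in> admissible_cells n \<Longrightarrow> \<sigma> \<in> cells Z_cyc n"
  using sub_simplex_admissible admissible_cells_X_trunc
  by (fastforce simp: Z_cyc_def F2_def admissible_cells_def)

lemma cells_Z_1: "cells Z_cyc 1 = cells Y_cyc 1"
proof
  show "cells Z_cyc 1 \<subseteq> cells Y_cyc 1" by (auto simp: Z_cyc_def F2_def)
  have "admissible k" if k: "length k = 1" for k
  proof -
    obtain a where "k = [a]" using k by (auto simp: length_Suc_conv)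
    then show ?thesis using exhaust_Z3[of a] by (auto simp: admissible_def)
  qed
  then show "cells Y_cyc 1 \<subseteq> cells Z_cyc 1"
    using admissible_cells_Z by (auto simp: admissible_cells_def)
qed

lemma cells_Z_2: "cells Z_cyc 2 = {\<pi> \<in> cells Y_cyc 2. \<pi> [1, 1] = 0 \<and> \<pi> [2, 1] = 0 \<and> \<pi> [1, 2] = 0}"
proof
  show "cells Z_cyc 2 \<subseteq> {\<pi> \<in> cells Y_cyc 2. \<pi> [1, 1] = 0 \<and> \<pi> [2, 1] = 0 \<and> \<pi> [1, 2] = 0}"
  proof
    fix \<sigma> assume "\<sigma> \<in> cells Z_cyc 2"
    then have "\<sigma> \<in> X_trunc 2" using sub_simplex.refl[of Y_cyc 2 \<sigma>] by (auto simp: Z_cyc_def F2_def)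
    then show "\<sigma> \<in> {\<pi> \<in> cells Y_cyc 2. \<pi> [1, 1] = 0 \<and> \<pi> [2, 1] = 0 \<and> \<pi> [1, 2] = 0}"
      by (simp add: X_trunc_def)
  qed
  have "admissible k \<or> k = [1, 1] \<or> k = [2, 1] \<or> k = [1, 2]" if k: "length k = 2" for k
  proof -
    obtain a b where "k = [a, b]" using k by (auto simp: length_Suc_conv numeral_2_eq_2)
    then show ?thesis using exhaust_Z3[of a] exhaust_Z3[of b] by (auto simp: admissible_def)
  qed
  then show "{\<pi> \<in> cells Y_cyc 2. \<pi> [1, 1] = 0 \<and> \<pi> [2, 1] = 0 \<and> \<pi> [1, 2] = 0} \<subseteq> cells Z_cyc 2"
    by (intro subsetI admissible_cells_Z) (auto simp: admissible_cells_def)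
qed

section \<open>Triples of projectors and the faces of 2-simplices\<close>

definition triple :: "two_qutrits operator \<Rightarrow> two_qutrits operator \<Rightarrow> two_qutrits operator \<Rightarrow> 3 list \<Rightarrow> two_qutrits operator" where
  "triple a b c = (\<lambda>k\<in>{k. length k = 1}. if k = [0] then a else if k = [1] then b else c)"

lemma triple_simps [simp]: "triple a b c [0] = a" "triple a b c [1] = b" "triple a b c [2] = c"
  by (simp_all add: triple_def)

lemma sum_Z3: "(\<Sum>a\<in>UNIV. g a) = g 0 + g 1 + g (2::3)" for g :: "3 \<Rightarrow> 'a::comm_monoid_add"
  unfolding sum_3 three_eq_zero by (simp add: ac_simps)

lemma sum_lists_1: "(\<Sum>k | length k = 1 \<and> Q k. g k) = (\<Sum>a\<in>UNIV. if Q [a] then g [a] else 0)"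
  for g :: "3 list \<Rightarrow> 'a::comm_monoid_add"
proof -
  have "{k :: 3 list. length k = 1 \<and> Q k} = (\<lambda>a. [a]) ` {a. Q [a]}" by (auto simp: length_Suc_conv)
  then show ?thesis by (simp add: sum.reindex inj_on_def flip: sum.inter_filter)
qed

lemma sum_lists_2: "(\<Sum>k | length k = 2 \<and> Q k. g k) = (\<Sum>a\<in>UNIV. \<Sum>b\<in>UNIV. if Q [a, b] then g [a, b] else 0)"
  for g :: "3 list \<Rightarrow> 'a::comm_monoid_add"
proof -
  have "{k :: 3 list. length k = 2 \<and> Q k} = (\<lambda>(a, b). [a, b]) ` {(a, b). Q [a, b]}"
    by (auto simp: length_Suc_conv numeral_2_eq_2)
  then have "(\<Sum>k | length k = 2 \<and> Q k. g k) = (\<Sum>p\<in>{(a, b). Q [a, b]}. case p of (a, b) \<Rightarrow> g [a, b])"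
    by (simp add: sum.reindex inj_on_def case_prod_unfold)
  also have "\<dots> = (\<Sum>p\<in>UNIV. case p of (a, b) \<Rightarrow> if Q [a, b] then g [a, b] else 0)"
    by (rule sum.mono_neutral_cong_left) (auto split: if_splits)
  also have "\<dots> = (\<Sum>a\<in>UNIV. \<Sum>b\<in>UNIV. if Q [a, b] then g [a, b] else 0)"
    by (simp add: sum.cartesian_product UNIV_Times_UNIV)
  finally show ?thesis .
qed

lemma triple_cells:
  assumes "a \<in> Proj" "b \<in> Proj" "c \<in> Proj" "a + b + c = mat 1"
  shows "triple a b c \<in> cells Z_cyc 1"
proof -
  have "(\<Sum>k | length k = 1. triple a b c k) = mat 1"
    using sum_lists_1[of "triple a b c" "\<lambda>_. True"] assms(4) by (simp add: sum_Z3)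
  moreover have "triple a b c \<in> {k. length k = 1} \<rightarrow>\<^sub>E Proj"
    using assms(1-3) by (simp add: triple_def PiE_iff)
  ultimately show ?thesis unfolding cells_Z_1 cells_measurements by simp
qed

lemma cells_Z_1_eq_triple:
  assumes "\<pi> \<in> cells Z_cyc 1"
  shows "\<pi> = triple (\<pi> [0]) (\<pi> [1]) (\<pi> [2])" "\<pi> [0] + \<pi> [1] + \<pi> [2] = mat 1"
    "\<pi> [0] \<in> Proj" "\<pi> [1] \<in> Proj" "\<pi> [2] \<in> Proj"
proof -
  have \<pi>: "\<pi> \<in> {k. length k = 1} \<rightarrow>\<^sub>E Proj" "(\<Sum>k | length k = 1. \<pi> k) = mat 1"
    using assms unfolding cells_Z_1 cells_measurements by auto
  show "\<pi> = triple (\<pi> [0]) (\<pi> [1]) (\<pi> [2])"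
  proof
    fix k
    show "\<pi> k = triple (\<pi> [0]) (\<pi> [1]) (\<pi> [2]) k"
    proof (cases "length k = 1")
      case True
      then obtain a where "k = [a]" by (auto simp: length_Suc_conv)
      then show ?thesis using exhaust_Z3[of a] by auto
    next
      case False
      then show ?thesis using \<pi>(1) by (auto simp: triple_def PiE_iff extensional_def)
    qed
  qed
  show "\<pi> [0] + \<pi> [1] + \<pi> [2] = mat 1"
    using \<pi>(2) sum_lists_1[of \<pi> "\<lambda>_. True"] by (simp add: sum_Z3)
  show "\<pi> [0] \<in> Proj" "\<pi> [1] \<in> Proj" "\<pi> [2] \<in> Proj"
    using \<pi>(1) by auto
qed

text \<open>In Z/3 the map from \<open>k\<close> to \<open>1 - k\<close> exchanges 0 and 1 and fixes
  2.\<close>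

lemma cyc_triple: "cyc Z_cyc 1 (triple a b c) = triple b a c"
proof -
  have "cyc Z_cyc 1 (triple a b c) = pushforward {k. length k = 1} {k. length k = 1} (nerve_cyc 1) (triple a b c)"
    by (simp add: Z_cyc_def F2_def measurements_def nerve_Z3_def)
  also have "\<dots> = triple b a c"
  proof
    fix k :: "3 list"
    show "pushforward {k. length k = 1} {k. length k = 1} (nerve_cyc 1) (triple a b c) k = triple b a c k"
    proof (cases "length k = 1")
      case True
      then obtain i where k: "k = [i]" by (auto simp: length_Suc_conv)
      have "pushforward {k. length k = 1} {k. length k = 1} (nerve_cyc 1) (triple a b c) k =
        (\<Sum>x | length x = 1 \<and> nerve_cyc 1 x = [i]. triple a b c x)"
        by (simp add: pushforward_def k)
      also have "\<dots> = triple b a c k"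
        unfolding sum_lists_1 sum_Z3 nerve_cyc_def k using exhaust_Z3[of i] by auto
      finally show ?thesis .
    qed (simp add: pushforward_def triple_def)
  qed
  finally show ?thesis .
qed

lemma face_Z_2:
  assumes \<sigma>: "\<sigma> \<in> cells Z_cyc 2"
  shows "face Z_cyc 2 0 \<sigma> = triple (\<sigma> [0,0] + \<sigma> [1,0] + \<sigma> [2,0]) (\<sigma> [0,1]) (\<sigma> [0,2] + \<sigma> [2,2])"
    "face Z_cyc 2 1 \<sigma> = triple (\<sigma> [0,0]) (\<sigma> [0,1] + \<sigma> [1,0] + \<sigma> [2,2]) (\<sigma> [0,2] + \<sigma> [2,0])"
    "face Z_cyc 2 2 \<sigma> = triple (\<sigma> [0,0] + \<sigma> [0,1] + \<sigma> [0,2]) (\<sigma> [1,0]) (\<sigma> [2,0] + \<sigma> [2,2])"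
proof -
  have z: "\<sigma> [1,1] = 0" "\<sigma> [2,1] = 0" "\<sigma> [1,2] = 0" using \<sigma> by (auto simp: cells_Z_2)
  have f: "face Z_cyc 2 i \<sigma> = triple (g 0) (g 1) (g 2)"
    if g: "\<And>y. g y = (\<Sum>a\<in>UNIV. \<Sum>b\<in>UNIV. if nerve_face 2 i [a, b] = [y] then \<sigma> [a, b] else 0)" for g i
  proof
    fix k
    have e: "face Z_cyc 2 i \<sigma> = pushforward {k. length k = 2} {k. length k = 1} (nerve_face 2 i) \<sigma>"
      by (simp add: Z_cyc_def F2_def measurements_def nerve_Z3_def)
    show "face Z_cyc 2 i \<sigma> k = triple (g 0) (g 1) (g 2) k"
    proof (cases "length k = 1")
      case True
      then obtain y where k: "k = [y]" by (auto simp: length_Suc_conv)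
      have "face Z_cyc 2 i \<sigma> k = (\<Sum>x | length x = 2 \<and> nerve_face 2 i x = [y]. \<sigma> x)"
        by (simp add: e pushforward_def k)
      also have "\<dots> = g y" unfolding sum_lists_2 g ..
      also have "\<dots> = triple (g 0) (g 1) (g 2) k" using exhaust_Z3[of y] by (auto simp: k)
      finally show ?thesis .
    qed (simp add: e pushforward_def triple_def)
  qed
  show "face Z_cyc 2 0 \<sigma> = triple (\<sigma> [0,0] + \<sigma> [1,0] + \<sigma> [2,0]) (\<sigma> [0,1]) (\<sigma> [0,2] + \<sigma> [2,2])"
    unfolding f[OF HOL.refl] sum_Z3 nerve_face_def by (simp add: z)
  show "face Z_cyc 2 1 \<sigma> = triple (\<sigma> [0,0]) (\<sigma> [0,1] + \<sigma> [1,0] + \<sigma> [2,2]) (\<sigma> [0,2] + \<sigma> [2,0])"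
    unfolding f[OF HOL.refl] sum_Z3 nerve_face_def by (simp add: z)
  show "face Z_cyc 2 2 \<sigma> = triple (\<sigma> [0,0] + \<sigma> [0,1] + \<sigma> [0,2]) (\<sigma> [1,0]) (\<sigma> [2,0] + \<sigma> [2,2])"
    unfolding f[OF HOL.refl] sum_Z3 nerve_face_def by (simp add: z)
qed

lemma face_Z_2_closed:
  assumes \<sigma>: "\<sigma> \<in> cells Z_cyc 2" and i: "i \<le> 2"
  shows "face Z_cyc 2 i \<sigma> \<in> cells Z_cyc 1"
proof -
  have "pushforward {k. length k = 2} {k. length k = 1} (nerve_face 2 i) \<sigma> \<in> cells Y_cyc 1"
  proof (rule pushforward_cells)
    show "\<sigma> \<in> cells Y_cyc 2" using \<sigma> by (simp add: cells_Z_2)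
    show "length (nerve_face 2 i k) = 1" if "length k = 2" for k :: "3 list"
      using length_nerve_face[of k 1 i] that i by (simp add: numeral_2_eq_2)
  qed
  then show ?thesis unfolding cells_Z_1 by (simp add: Z_cyc_def F2_def measurements_def nerve_Z3_def)
qed

section \<open>From density operators to states\<close>

definition state_of :: "two_qutrits operator \<Rightarrow> (3 list \<Rightarrow> two_qutrits operator) \<Rightarrow> real" where
  "state_of \<rho> = (\<lambda>\<pi>\<in>cells Z_cyc 1. Re (trace (\<rho> ** ((mat 1 - \<pi> [0]) - (1/2) *\<^sub>R \<pi> [2]))))"

text \<open>Since the triple sums to the identity, the operator tested against \<rho> is
  \<open>b + (1/2) *\<^sub>R c\<close>, a form that makes bounds and additivity visible.\<close>

lemma state_of_triple:
  assumes "triple a b c \<in> cells Z_cyc 1"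
  shows "state_of \<rho> (triple a b c) = Re (trace (\<rho> ** b)) + Re (trace (\<rho> ** c)) / 2"
proof -
  have eq: "mat 1 - a - (1/2) *\<^sub>R c = b + (1/2) *\<^sub>R c"
  proof -
    have "mat 1 = a + b + c" using cells_Z_1_eq_triple(2)[OF assms] by simp
    moreover have "c = (1/2) *\<^sub>R c + (1/2) *\<^sub>R c" by (simp flip: scaleR_left.add)
    ultimately show ?thesis by (simp add: algebra_simps)
  qed
  have "state_of \<rho> (triple a b c) = Re (trace (\<rho> ** (mat 1 - a - (1/2) *\<^sub>R c)))"
    using assms by (simp add: state_of_def)
  also have "\<dots> = Re (trace (\<rho> ** b)) + Re (trace (\<rho> ** c)) / 2"
    unfolding eq by (simp add: matrix_add_ldistrib trace_add operator_scaleR trace_scaleR)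
  finally show ?thesis .
qed

lemma trace_resolution:
  assumes "\<rho> \<in> Den" "a + b + c = mat 1"
  shows "Re (trace (\<rho> ** a)) + Re (trace (\<rho> ** b)) + Re (trace (\<rho> ** c)) = 1"
proof -
  have "trace (\<rho> ** (a + b + c)) = 1" using assms by (simp add: Den_def)
  then show ?thesis by (simp add: matrix_add_ldistrib trace_add complex_eq_iff)
qed

text \<open>The three traces sum to 1, so exchanging the first two turns the value into its
  complement. In the face relation the \<open>[2, 2]\<close> entry counts once on the left and as
  two halves on the right.\<close>

lemma state_of_states:
  assumes \<rho>: "\<rho> \<in> Den"
  shows "state_of \<rho> \<in> states Z_cyc"
proof -
  let ?t = "\<lambda>a. Re (trace (\<rho> ** a))"
  have \<rho>': "positive_op \<rho>" using \<rho> by (simp add: Den_def)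
  have "state_of \<rho> \<pi> \<in> {0..1}" "state_of \<rho> (cyc Z_cyc 1 \<pi>) = 1 - state_of \<rho> \<pi>" if \<pi>: "\<pi> \<in> cells Z_cyc 1" for \<pi>
  proof -
    obtain a b c where abc: "\<pi> = triple a b c" "a + b + c = mat 1" "a \<in> Proj" "b \<in> Proj" "c \<in> Proj"
      using cells_Z_1_eq_triple[OF \<pi>] by blast
    note t = trace_Proj_nonneg[OF \<rho>' abc(3)] trace_Proj_nonneg[OF \<rho>' abc(4)] trace_Proj_nonneg[OF \<rho>' abc(5)]
      trace_resolution[OF \<rho> abc(2)]
    have "triple b a c \<in> cells Z_cyc 1" using abc by (intro triple_cells) (simp_all add: add.commute)
    then show "state_of \<rho> \<pi> \<in> {0..1}" "state_of \<rho> (cyc Z_cyc 1 \<pi>) = 1 - state_of \<rho> \<pi>"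
      using \<pi> t unfolding abc(1) cyc_triple by (simp_all add: state_of_triple)
  qed
  moreover have "state_of \<rho> (face Z_cyc 2 1 \<sigma>) = state_of \<rho> (face Z_cyc 2 2 \<sigma>) + state_of \<rho> (face Z_cyc 2 0 \<sigma>)"
    if \<sigma>: "\<sigma> \<in> cells Z_cyc 2" for \<sigma>
    using face_Z_2_closed[OF \<sigma>, of 0] face_Z_2_closed[OF \<sigma>, of 1] face_Z_2_closed[OF \<sigma>, of 2]
    unfolding face_Z_2[OF \<sigma>] by (simp add: state_of_triple matrix_add_ldistrib trace_add field_simps)
  ultimately show ?thesis
    unfolding states_def by (auto simp: state_of_def)
qed

text \<open>A ray occurs as outcome 1 of a measurement whose outcome 2 is 0, so the state determines
  all \<open>cinner x (\<rho> *v x)\<close>.\<close>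

lemma state_of_inj: "inj_on state_of Den"
proof (rule inj_onI)
  fix \<rho> \<rho>' :: "two_qutrits operator"
  assume d: "\<rho> \<in> Den" "\<rho>' \<in> Den" and e: "state_of \<rho> = state_of \<rho>'"
  show "\<rho> = \<rho>'"
  proof (rule operator_eqI)
    fix x
    show "cinner x (\<rho> *v x) = cinner x (\<rho>' *v x)"
    proof (cases "x = 0")
      case False
      have "triple (mat 1 - ray x) (ray x) 0 \<in> cells Z_cyc 1"
        by (intro triple_cells Proj_complement ray_Proj Proj_zero) simp
      then have "Re (trace (\<rho> ** ray x)) = Re (trace (\<rho>' ** ray x))"
        using fun_cong[OF e, of "triple (mat 1 - ray x) (ray x) 0"] by (simp add: state_of_triple trace_def)
      then have "Re (cinner x (\<rho> *v x)) = Re (cinner x (\<rho>' *v x))"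
        using False by (simp add: trace_mult_ray)
      moreover have "Im (cinner x (\<rho> *v x)) = 0" "Im (cinner x (\<rho>' *v x)) = 0"
        using d by (simp_all add: Den_def positive_op_def complex_nonneg_Reals_iff)
      ultimately show ?thesis by (simp add: complex_eq_iff)
    qed (simp add: cinner_zero_left)
  qed
qed

section \<open>From states to density operators\<close>

definition sextuple where
  "sextuple p q r s t u = (\<lambda>k\<in>{k :: 3 list. length k = 2}.
     if k = [0,0] then p else if k = [0,1] then q else if k = [1,0] then r
     else if k = [0,2] then s else if k = [2,0] then t else if k = [2,2] then u else (0 :: two_qutrits operator))"

text \<open>The six projectors are the entries that a 2-simplex may have, so this is the whole
  additivity condition in terms of triples.\<close>

lemma states_relation:
  assumes \<phi>: "\<phi> \<in> states Z_cyc"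
    and P: "p \<in> Proj" "q \<in> Proj" "r \<in> Proj" "s \<in> Proj" "t \<in> Proj" "u \<in> Proj"
    and sum: "p + q + r + s + t + u = mat 1"
  shows "\<phi> (triple p (q + r + u) (s + t)) =
    \<phi> (triple (p + q + s) r (t + u)) + \<phi> (triple (p + r + t) q (s + u))"
proof -
  let ?\<sigma> = "sextuple p q r s t u"
  have "(\<Sum>k | length k = 2. ?\<sigma> k) = mat 1"
    using sum_lists_2[of ?\<sigma> "\<lambda>_. True"] sum by (simp add: sum_Z3 sextuple_def ac_simps)
  then have \<sigma>: "?\<sigma> \<in> cells Z_cyc 2"
    using P Proj_zero unfolding cells_Z_2 cells_measurements by (auto simp: sextuple_def)
  have "\<phi> (face Z_cyc 2 1 ?\<sigma>) = \<phi> (face Z_cyc 2 2 ?\<sigma>) + \<phi> (face Z_cyc 2 0 ?\<sigma>)"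
    using \<phi> \<sigma> by (simp add: states_def)
  then show ?thesis unfolding face_Z_2[OF \<sigma>] by (simp add: sextuple_def)
qed

lemma state_of_surj:
  assumes \<phi>: "\<phi> \<in> states Z_cyc"
  shows "\<exists>\<rho>\<in>Den. \<phi> = state_of \<rho>"
proof -
  define \<mu> where "\<mu> P = \<phi> (triple (mat 1 - P) P 0)" for P
  have tri: "triple (mat 1 - P) P 0 \<in> cells Z_cyc 1" if "P \<in> Proj" for P
    using that by (intro triple_cells Proj_complement Proj_zero) simp_all
  interpret projector_measure \<mu>
  proof
    show "3 \<le> CARD(3 \<times> 3)" by simp
    show "0 \<le> \<mu> P" if "P \<in> Proj" for P
      using \<phi> tri[OF that] by (auto simp: \<mu>_def states_def)
    show "\<mu> (P + Q) = \<mu> P + \<mu> Q" if PQ: "P \<in> Proj" "Q \<in> Proj" "P ** Q = 0" for P Q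
    proof -
      have "mat 1 - (P + Q) \<in> Proj" using PQ by (intro Proj_complement Proj_add)
      then show ?thesis
        using states_relation[OF \<phi>, of "mat 1 - (P + Q)" P Q 0 0 0] PQ
        by (simp add: \<mu>_def Proj_zero add.commute)
    qed
  qed
  obtain \<rho> where \<rho>: "positive_op \<rho>" "\<And>P. P \<in> Proj \<Longrightarrow> \<mu> P = Re (trace (\<rho> ** P))" using gleason by blast
  have one: "\<mu> (mat 1) = 1"
  proof -
    \<comment> \<open>The simplex concentrated at \<open>[0, 0]\<close> has three equal faces, so
      their value equals twice itself.\<close>
    have "\<phi> (triple (mat 1) 0 0) = 0"
      using states_relation[OF \<phi> Proj_one Proj_zero Proj_zero Proj_zero Proj_zero Proj_zero] by simp
    moreover have "triple (mat 1) 0 0 \<in> cells Z_cyc 1" by (intro triple_cells Proj_one Proj_zero) simp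
    then have "\<phi> (triple 0 (mat 1) 0) = 1 - \<phi> (triple (mat 1) 0 0)"
      using \<phi> cyc_triple[of "mat 1" 0 0] by (auto simp: states_def)
    ultimately show ?thesis by (simp add: \<mu>_def)
  qed
  then have "Re (trace \<rho>) = 1" using \<rho>(2)[OF Proj_one] by simp
  then have "trace \<rho> = 1" using positive_op_trace[OF \<rho>(1)] by (simp add: complex_nonneg_Reals_iff complex_eq_iff)
  then have den: "\<rho> \<in> Den" using \<rho>(1) by (simp add: Den_def)
  \<comment> \<open>With support on \<open>[0, 0]\<close> and \<open>[2, 2]\<close> the two outer
    faces coincide and carry \<open>c\<close> as outcome 2, while the inner face carries it as
    outcome 1; hence the half.\<close>
  have half: "\<phi> (triple (mat 1 - c) 0 c) = \<mu> c / 2" if "c \<in> Proj" for c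
    using states_relation[OF \<phi>, of "mat 1 - c" 0 0 0 0 c] Proj_complement[OF that] that
    by (simp add: \<mu>_def Proj_zero)
  have "\<phi> \<pi> = state_of \<rho> \<pi>" if \<pi>: "\<pi> \<in> cells Z_cyc 1" for \<pi>
  proof -
    obtain a b c where abc: "\<pi> = triple a b c" "a + b + c = mat 1" "a \<in> Proj" "b \<in> Proj" "c \<in> Proj"
      using cells_Z_1_eq_triple[OF \<pi>] by blast
    \<comment> \<open>With \<open>b\<close> at \<open>[0, 1]\<close> and \<open>c\<close> at
      \<open>[2, 0]\<close> one outer face forgets \<open>b\<close> and the other forgets
      \<open>c\<close>.\<close>
    have "\<phi> (triple a b c) = \<phi> (triple (a + b) 0 c) + \<phi> (triple (a + c) b 0)"
      using states_relation[OF \<phi> abc(3,4) Proj_zero Proj_zero abc(5) Proj_zero] abc(2) by simp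
    moreover have "a + b = mat 1 - c" "a + c = mat 1 - b" unfolding abc(2)[symmetric] by simp_all
    ultimately have "\<phi> (triple a b c) = \<mu> c / 2 + \<mu> b" using half[OF abc(5)] by (simp add: \<mu>_def)
    then show ?thesis using \<pi> abc \<rho>(2) by (simp add: state_of_triple)
  qed
  moreover have "\<phi> \<pi> = state_of \<rho> \<pi>" if "\<pi> \<notin> cells Z_cyc 1" for \<pi>
    using \<phi> that by (auto simp: states_def state_of_def PiE_iff extensional_def)
  ultimately show ?thesis using den by blast
qed

theorem proposition6p16:
  shows "bij_betw
    (\<lambda>\<rho>. \<lambda>\<pi>\<in>cells Z_cyc 1. Re (trace (\<rho> ** ((mat 1 - \<pi> [0]) - (1/2) *\<^sub>R \<pi> [2]))))
    (Den :: two_qutrits operator set) (states Z_cyc)"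
  unfolding state_of_def[symmetric] bij_betw_def
proof
  show "inj_on state_of Den" by (rule state_of_inj)
  show "state_of ` Den = states Z_cyc" using state_of_states state_of_surj by (intro equalityI subsetI) auto
qed

end
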